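(* For a graph $G$, the cosmological polytope $\mathcal{C}_G$ is Gorenstein if and only if every edge of $G$ is a loop.
   Context: A graph $G=(V,E)$ is a finite undirected graph with vertex set $V$ and a finite multiset $E$ of edges; multiple edges and loops are allowed, and $G$ has no isolated vertices. Let $\mathbb{R}^{V\cup E}$ have standard unit vectors $\mathbf{e}_\alpha$. The cosmological polytope is $\mathcal{C}_G=\mathrm{conv}(\mathbf{e}_i+\mathbf{e}_j-\mathbf{e}_f,\ \mathbf{e}_i-\mathbf{e}_j+\mathbf{e}_f,\ -\mathbf{e}_i+\mathbf{e}_j+\mathbf{e}_f : f\in E \text{ with endpoints } i,j)$ (for a loop, $i=j$). A lattice polytope $P$ is Gorenstein if its toric ring (the $K$-algebra generated by the monomials corresponding to the lattice points of $P$, graded by degree one for each generator) is a Gorenstein ring. For $\mathcal{C}_G$ this is equivalent (Stanley) to: with $s=\operatorname{codeg}(\mathcal{C}_G)$ (smallest $t\ge1$ with a lattice point in the relative interior of $t\mathcal{C}_G$) and $d=\dim\mathcal{C}_G$, the $h^\ast$-polynomial $h^\ast(\mathcal{C}_G;z)=\sum_i h^\ast_iz^i$ (defined by $1+\sum_{t\ge1}|t\mathcal{C}_G\cap\mathbb{Z}^{V\cup E}|z^t=h^\ast(\mathcal{C}_G;z)/(1-z)^{d+1}$) satisfies $h^\ast_i=h^\ast_{d+1-s-i}$ for all $0\le i\le d+1-s$. *)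

theory Defs
  imports
    "HOL-Analysis.Analysis"
    "HOL-Algebra.Algebra"
    "HOL-Algebra.Algebraic_Closure_Type"
    "HOL-Library.Poly_Mapping"
    "HOL-Library.Uprod"
begin

section \<open>Graphs and cosmological polytopes\<close>

text \<open>
  A finite undirected multigraph with vertex set \<open>V\<close> and edge multiset \<open>E\<close> is given by two finite
  types \<open>'v\<close> (the vertices) and \<open>'e\<close> (the names of the edges) together with a map
  \<open>ends :: 'e \<Rightarrow> 'v uprod\<close> that sends an edge to the unordered pair of its endpoints. The map need not
  be injective (multiple edges), and \<open>Upair i i\<close> is allowed (loops). The space with coordinates
  indexed by the disjoint union of \<open>V\<close> and \<open>E\<close> is \<open>real ^ ('v + 'e)\<close>.
\<close>

definition no_isolated_vertices :: "('e \<Rightarrow> 'v uprod) \<Rightarrow> bool" where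
  "no_isolated_vertices ends \<longleftrightarrow> (\<forall>v. \<exists>f. v \<in> set_uprod (ends f))"

definition is_loop :: "('e \<Rightarrow> 'v uprod) \<Rightarrow> 'e \<Rightarrow> bool" where
  "is_loop ends f \<longleftrightarrow> (\<exists>i. ends f = Upair i i)"

abbreviation vertex_vec :: "'v::finite \<Rightarrow> real ^ ('v + 'e::finite)" where
  "vertex_vec i \<equiv> axis (Inl i) 1"

abbreviation edge_vec :: "'e::finite \<Rightarrow> real ^ ('v::finite + 'e)" where
  "edge_vec f \<equiv> axis (Inr f) 1"

definition cosmological_polytope ::
    "('e::finite \<Rightarrow> 'v::finite uprod) \<Rightarrow> (real ^ ('v + 'e)) set" where
  "cosmological_polytope ends = convex hull
     (\<Union>{{vertex_vec i + vertex_vec j - edge_vec f,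
           vertex_vec i - vertex_vec j + edge_vec f,
           - vertex_vec i + vertex_vec j + edge_vec f} | i j f. ends f = Upair i j})"


section \<open>Gorenstein graded algebras\<close>

text \<open>
  In this section \<open>R\<close> is a commutative ring, \<open>K\<close> a subfield of \<open>R\<close> and \<open>G n\<close> the homogeneous
  component of degree \<open>n\<close> of a grading of \<open>R\<close> by the natural numbers, with \<open>G 0 = K\<close>.
\<close>

definition regular_sequence :: "('a, 'b) ring_scheme \<Rightarrow> 'a list \<Rightarrow> bool" where
  "regular_sequence R ts \<longleftrightarrow>
     set ts \<subseteq> carrier R \<and>
     (\<forall>i<length ts. \<forall>a\<in>carrier R.
        ts ! i \<otimes>\<^bsub>R\<^esub> a \<in> Idl\<^bsub>R\<^esub> (set (take i ts)) \<longrightarrow> a \<in> Idl\<^bsub>R\<^esub> (set (take i ts))) \<and>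
     Idl\<^bsub>R\<^esub> (set ts) \<noteq> carrier R"

definition homogeneous_of_pos_degree :: "(nat \<Rightarrow> 'a set) \<Rightarrow> 'a \<Rightarrow> bool" where
  "homogeneous_of_pos_degree G t \<longleftrightarrow> (\<exists>n>0. t \<in> G n)"

text \<open>The image of \<open>K\<close> in the quotient by the ideal \<open>I\<close>.\<close>

definition quot_scalars :: "('a, 'b) ring_scheme \<Rightarrow> 'a set \<Rightarrow> 'a set \<Rightarrow> 'a set set" where
  "quot_scalars R K I = (\<lambda>c. I +>\<^bsub>R\<^esub> c) ` K"

text \<open>The socle of the quotient by \<open>I\<close>: the elements killed by all elements of positive degree.\<close>

definition quot_socle :: "('a, 'b) ring_scheme \<Rightarrow> (nat \<Rightarrow> 'a set) \<Rightarrow> 'a set \<Rightarrow> 'a set set" where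
  "quot_socle R G I =
     {x \<in> carrier (R Quot I).
        \<forall>r. homogeneous_of_pos_degree G r \<longrightarrow> (I +>\<^bsub>R\<^esub> r) \<otimes>\<^bsub>R Quot I\<^esub> x = \<zero>\<^bsub>R Quot I\<^esub>}"

text \<open>
  \<open>R\<close> is Cohen-Macaulay if some homogeneous system of parameters \<open>ts\<close> is a regular sequence, and
  then its type is the dimension over \<open>K\<close> of the socle of \<open>R / (ts)\<close>; both are independent of the
  choice of \<open>ts\<close>. \<open>R\<close> is Gorenstein if it is Cohen-Macaulay of type one. A regular sequence \<open>ts\<close> of
  homogeneous elements of positive degree is a system of parameters as soon as \<open>R / (ts)\<close> has
  finite dimension over \<open>K\<close>, so the Krull dimension of \<open>R\<close> need not be mentioned; finiteness of this
  quotient also forces \<open>R\<close> to be finitely generated over \<open>K\<close>, hence Noetherian.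
\<close>

definition regular_sop ::
    "('a, 'b) ring_scheme \<Rightarrow> 'a set \<Rightarrow> (nat \<Rightarrow> 'a set) \<Rightarrow> 'a list \<Rightarrow> bool" where
  "regular_sop R K G ts \<longleftrightarrow>
     (\<forall>t\<in>set ts. homogeneous_of_pos_degree G t) \<and>
     regular_sequence R ts \<and>
     (let I = Idl\<^bsub>R\<^esub> (set ts) in
        ring.finite_dimension (R Quot I) (quot_scalars R K I) (carrier (R Quot I)))"

definition gorenstein_graded_algebra ::
    "('a, 'b) ring_scheme \<Rightarrow> 'a set \<Rightarrow> (nat \<Rightarrow> 'a set) \<Rightarrow> bool" where
  "gorenstein_graded_algebra R K G \<longleftrightarrow>
     (\<exists>ts. regular_sop R K G ts \<and>
        (let I = Idl\<^bsub>R\<^esub> (set ts) in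
           ring.dimension (R Quot I) 1 (quot_scalars R K I) (quot_socle R G I)))"


section \<open>Toric rings and Gorenstein polytopes\<close>

text \<open>
  The exponent \<open>(a, n)\<close> stands for the Laurent monomial \<open>x\<^sup>a t\<^sup>n\<close>, where \<open>t\<close> is an extra variable that
  records the degree; a lattice point \<open>a\<close> of the polytope contributes the generator \<open>x\<^sup>a t\<close>.
\<close>

type_synonym ('n, 'k) laurent = "((int ^ 'n) \<times> nat) \<Rightarrow>\<^sub>0 'k"

definition lattice_points :: "(real ^ 'n) set \<Rightarrow> (int ^ 'n) set" where
  "lattice_points P = {a. (\<chi> i. real_of_int (a $ i)) \<in> P}"

definition toric_scalars :: "('n::finite, 'k::field) laurent set" where
  "toric_scalars = range (Poly_Mapping.single 0)"

definition toric_ring :: "(real ^ 'n::finite) set \<Rightarrow> ('n, 'k::field) laurent ring" where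
  "toric_ring P = ring_of_type_algebra
     \<lparr>carrier := generate_ring ring_of_type_algebra
        (toric_scalars \<union> {Poly_Mapping.single (a, 1) 1 | a. a \<in> lattice_points P})\<rparr>"

definition toric_component ::
    "(real ^ 'n::finite) set \<Rightarrow> nat \<Rightarrow> ('n, 'k::field) laurent set" where
  "toric_component P n =
     {p \<in> carrier (toric_ring P). \<forall>m\<in>Poly_Mapping.keys p. snd m = n}"

text \<open>Here \<open>'k\<close> is the coefficient field; the notion is meant for lattice polytopes \<open>P\<close>.\<close>

definition gorenstein_polytope :: "'k::field itself \<Rightarrow> (real ^ 'n::finite) set \<Rightarrow> bool" where
  "gorenstein_polytope _ P \<longleftrightarrow>
     gorenstein_graded_algebra (toric_ring P :: ('n, 'k) laurent ring) toric_scalars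
       (toric_component P)"

end

theory Submission
  imports Defs
begin

text \<open>
  Forgetting the degree, the toric ring of \<open>P\<close> is the monoid algebra of the monoid \<open>S\<close> generated by the
  lattice points of \<open>P\<close>. If it is Gorenstein, then the extended Cech complex on the monomial
  generators has cohomology only in the top degree, and this cohomology is an essential extension of
  a one-dimensional socle; so there is a single \<open>p\<close> such that it is nonzero exactly in the
  multidegrees \<open>- p - S\<close>. In multidegree \<open>v\<close>, however, the complex depends only on which
  localisations of \<open>S\<close> contain \<open>v\<close>. A non-loop edge gives a localisation of \<open>S\<close> that is the product of
  a group and the second Veronese monoid of the octant \<open>\<nat>\<^sup>3\<close>. There the three sign conditions force \<open>p\<close>
  to have coordinates \<open>(1, 1, 1)\<close>, but the elements of the Veronese lattice have even coordinate sum.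

  Conversely, if every edge is a loop, with generators \<open>x\<^sub>v\<close> at the vertices and \<open>y\<^sub>f\<close>, \<open>z\<^sub>f\<close> at the
  edges, then \<open>y\<^sub>f z\<^sub>f = x\<^sub>v\<^sup>2\<close> when \<open>f\<close> is a loop at \<open>v\<close>. The \<open>x\<^sub>v\<close> and \<open>y\<^sub>f - z\<^sub>f\<close> form a regular system of
  parameters, and the quotient \<open>\<Otimes> K[y\<^sub>f] / (y\<^sub>f\<^sup>2)\<close> has the socle spanned by \<open>\<Prod> y\<^sub>f\<close>.
\<close>

section \<open>Group algebras\<close>

text \<open>For a general graph no inequalities describing \<open>S\<close> are at hand, so a
  canonical module cannot be read off from interior lattice points. The Cech complex gets around
  this: it sees \<open>S\<close> only through localisations, and one localisation at a non-loop edge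
  is computable. Its cohomology is studied by descent along the regular sequence. Modulo all
  parameters only the Artinian quotient in degree zero is left, and each step back by one parameter
  is governed by a connecting homomorphism; the grading supplies the torsion and separation
  arguments. The octant comes from the triangle of the edge: its vertices are the squares X^2, Y^2,
  Z^2, and its side midpoints, the unit vectors of the endpoints and of the edge, are the products
  YZ, XZ, XY. The group comes from the opposite face, all of whose lattice points become units. For
  a loop the triangle collapses to a segment, a second Veronese monoid of rank two; there (1, 1) has
  even sum, and parity is no obstruction.\<close>

inductive_set gen :: "'g::comm_monoid_add set \<Rightarrow> 'g set" for M where
  gen_0: "0 \<in> gen M"
| gen_step: "x \<in> M \<Longrightarrow> s \<in> gen M \<Longrightarrow> x + s \<in> gen M"

lemma gen_base: "x \<in> M \<Longrightarrow> x \<in> gen M"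
  using gen_step[OF _ gen_0] by simp

lemma gen_add: "a \<in> gen M \<Longrightarrow> b \<in> gen M \<Longrightarrow> a + b \<in> gen M"
  by (induction rule: gen.induct) (auto simp: add.assoc intro: gen_step)

lemma gen_mono: "M \<subseteq> Y \<Longrightarrow> gen M \<subseteq> gen Y"
proof
  fix s assume "M \<subseteq> Y" "s \<in> gen M"
  from this(2,1) show "s \<in> gen Y"
    by (induction rule: gen.induct) (auto intro: gen.intros)
qed

lemma gen_sum: "(\<And>i. i \<in> I \<Longrightarrow> f i \<in> gen M) \<Longrightarrow> sum f I \<in> gen M"
  by (induction I rule: infinite_finite_induct) (auto intro: gen_0 gen_add)

lemma gen_of_nat_mult:
  fixes M :: "'g::comm_ring_1 set"
  shows "v \<in> gen M \<Longrightarrow> of_nat n * v \<in> gen M"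
  by (induction n) (auto simp: algebra_simps intro: gen_0 gen_add)

lemma additive_gen_nonneg:
  fixes h :: "'g::comm_monoid_add \<Rightarrow> int"
  assumes "\<And>a b. h (a + b) = h a + h b" "\<And>x. x \<in> M \<Longrightarrow> h x \<ge> 0" "s \<in> gen M"
  shows "h s \<ge> 0"
  using assms(3)
proof induction
  case gen_0
  show ?case using assms(1)[of 0 0] by simp
next
  case (gen_step x s)
  then show ?case using assms(1,2) by simp
qed

abbreviation mon :: "'g \<Rightarrow> ('g \<Rightarrow>\<^sub>0 'k::zero_neq_one)" where
  "mon v \<equiv> Poly_Mapping.single v 1"

lemma poly_mapping_expand:
  "f = (\<Sum>v\<in>Poly_Mapping.keys f. Poly_Mapping.single v (Poly_Mapping.lookup f v))"
  by (rule poly_mapping_eqI)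
    (auto simp: lookup_sum lookup_single when_def in_keys_iff sum.delta
      intro!: sum.neutral[symmetric])

lemma lookup_single_mult:
  fixes f :: "'g::ab_group_add \<Rightarrow>\<^sub>0 'k::comm_ring_1"
  shows "Poly_Mapping.lookup (Poly_Mapping.single v c * f) w = c * Poly_Mapping.lookup f (w - v)"
proof -
  have "Poly_Mapping.single v c * f =
      (\<Sum>u\<in>Poly_Mapping.keys f. Poly_Mapping.single (v + u) (c * Poly_Mapping.lookup f u))"
    by (subst (1) poly_mapping_expand[of f]) (simp add: sum_distrib_left mult_single)
  then have "Poly_Mapping.lookup (Poly_Mapping.single v c * f) w =
      (\<Sum>u\<in>Poly_Mapping.keys f. if u = w - v then c * Poly_Mapping.lookup f u else 0)"
    by (simp add: lookup_sum lookup_single when_def eq_diff_eq add.commute)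
  also have "\<dots> = c * Poly_Mapping.lookup f (w - v)"
    by (subst sum.delta) (auto simp: in_keys_iff)
  finally show ?thesis .
qed

text \<open>For a submonoid \<open>T\<close> this is its monoid algebra, realised inside the group
  algebra so that localisations are again sets of this form.\<close>

definition supp_in :: "'g set \<Rightarrow> ('g \<Rightarrow>\<^sub>0 'k::zero) set" where
  "supp_in T = {f. Poly_Mapping.keys f \<subseteq> T}"

lemma supp_inD: "f \<in> supp_in T \<Longrightarrow> Poly_Mapping.lookup f v \<noteq> 0 \<Longrightarrow> v \<in> T"
  by (auto simp: supp_in_def in_keys_iff)

lemma supp_inI: "(\<And>v. Poly_Mapping.lookup f v \<noteq> 0 \<Longrightarrow> v \<in> T) \<Longrightarrow> f \<in> supp_in T"
  by (auto simp: supp_in_def in_keys_iff)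

lemma supp_in_0: "0 \<in> supp_in T"
  by (simp add: supp_in_def)

lemma supp_in_add: "f \<in> supp_in T \<Longrightarrow> g \<in> supp_in T \<Longrightarrow> f + g \<in> supp_in T"
  using keys_add[of f g] by (auto simp: supp_in_def)

lemma supp_in_diff:
  fixes f g :: "'g \<Rightarrow>\<^sub>0 'k::ab_group_add"
  shows "f \<in> supp_in T \<Longrightarrow> g \<in> supp_in T \<Longrightarrow> f - g \<in> supp_in T"
  using keys_diff[of f g] by (auto simp: supp_in_def)

lemma supp_in_uminus:
  fixes f :: "'g \<Rightarrow>\<^sub>0 'k::ab_group_add"
  shows "f \<in> supp_in T \<Longrightarrow> - f \<in> supp_in T"
  by (auto simp: supp_in_def in_keys_iff)

lemma supp_in_mult:
  fixes f g :: "'g::monoid_add \<Rightarrow>\<^sub>0 'k::semiring_0"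
  shows "f \<in> supp_in T \<Longrightarrow> g \<in> supp_in U \<Longrightarrow> (\<And>a b. a \<in> T \<Longrightarrow> b \<in> U \<Longrightarrow> a + b \<in> W) \<Longrightarrow>
    f * g \<in> supp_in W"
  using keys_mult[of f g] by (force simp: supp_in_def)

lemma supp_in_mono: "T \<subseteq> U \<Longrightarrow> supp_in T \<subseteq> supp_in U"
  by (auto simp: supp_in_def)

lemma supp_in_single: "v \<in> T \<Longrightarrow> Poly_Mapping.single v c \<in> supp_in T"
  by (auto simp: supp_in_def)

definition restr :: "('g \<Rightarrow> bool) \<Rightarrow> ('g \<Rightarrow>\<^sub>0 'k::comm_monoid_add) \<Rightarrow> ('g \<Rightarrow>\<^sub>0 'k)" where
  "restr Q f = (\<Sum>v\<in>{v \<in> Poly_Mapping.keys f. Q v}. Poly_Mapping.single v (Poly_Mapping.lookup f v))"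

lemma lookup_restr: "Poly_Mapping.lookup (restr Q f) v = (if Q v then Poly_Mapping.lookup f v else 0)"
proof -
  have "Poly_Mapping.lookup (restr Q f) v =
      (\<Sum>u\<in>{u \<in> Poly_Mapping.keys f. Q u}. if u = v then Poly_Mapping.lookup f u else 0)"
    by (auto simp: restr_def lookup_sum lookup_single when_def intro!: sum.cong)
  then show ?thesis
    by (simp add: sum.delta in_keys_iff)
qed

lemma restr_add: "restr Q (f + g) = restr Q f + restr Q g"
  by (rule poly_mapping_eqI) (simp add: lookup_restr lookup_add)

lemma restr_diff:
  fixes f g :: "'g \<Rightarrow>\<^sub>0 'k::ab_group_add"
  shows "restr Q (f - g) = restr Q f - restr Q g"
  by (rule poly_mapping_eqI) (simp add: lookup_restr lookup_minus)

lemma restr_sum: "restr Q (sum f I) = (\<Sum>i\<in>I. restr Q (f i))"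
  by (rule poly_mapping_eqI) (simp add: lookup_restr lookup_sum)

lemma restr_supp_in: "f \<in> supp_in T \<Longrightarrow> restr Q f \<in> supp_in T"
  by (rule supp_inI) (auto simp: lookup_restr dest: supp_inD split: if_splits)

text \<open>A factor \<open>t\<close> concentrated in one value \<open>n\<close> of \<open>h\<close>
  shifts every slice by \<open>n\<close>. This gives homogeneity of ideals with homogeneous
  generators, both for the degree and for a single coordinate.\<close>

lemma restr_mult_homogeneous:
  fixes f t :: "'g::ab_group_add \<Rightarrow>\<^sub>0 'k::comm_ring_1" and h :: "'g \<Rightarrow> 'd::ab_group_add"
  assumes h: "\<And>a b. h (a + b) = h a + h b"
    and t: "\<And>v. v \<in> Poly_Mapping.keys t \<Longrightarrow> h v = n"
  shows "restr (\<lambda>v. Q (h v)) (f * t) = restr (\<lambda>v. Q (h v + n)) f * t"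
proof -
  have h_diff: "h (w - v) = h w - h v" for v w
    using h[of "w - v" v] by (simp add: algebra_simps)
  have *: "restr (\<lambda>v. Q (h v)) (f * Poly_Mapping.single v c) =
      restr (\<lambda>v. Q (h v + n)) f * Poly_Mapping.single v c" if "h v = n" for v c
    by (rule poly_mapping_eqI)
      (use that in \<open>simp add: lookup_restr mult.commute[of _ "Poly_Mapping.single v c"]
        lookup_single_mult h_diff\<close>)
  have "restr (\<lambda>v. Q (h v)) (f * t) = (\<Sum>v\<in>Poly_Mapping.keys t.
      restr (\<lambda>v. Q (h v)) (f * Poly_Mapping.single v (Poly_Mapping.lookup t v)))"
    by (subst (1) poly_mapping_expand[of t]) (simp add: sum_distrib_left restr_sum)
  also have "\<dots> = (\<Sum>v\<in>Poly_Mapping.keys t.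
      restr (\<lambda>v. Q (h v + n)) f * Poly_Mapping.single v (Poly_Mapping.lookup t v))"
    by (rule sum.cong) (use * t in auto)
  also have "\<dots> = restr (\<lambda>v. Q (h v + n)) f * t"
    by (subst (3) poly_mapping_expand[of t]) (simp add: sum_distrib_left)
  finally show ?thesis .
qed

section \<open>The extended Cech complex\<close>

fun cob :: "('x list \<Rightarrow> 'a::ab_group_add) \<Rightarrow> 'x list \<Rightarrow> 'a" where
  "cob c [] = 0"
| "cob c (x # l) = c l - cob (\<lambda>m. c (x # m)) l"

lemma cob_add: "cob (\<lambda>l. f l + g l) l = cob f l + cob g l"
  by (induction l arbitrary: f g) auto

lemma cob_diff: "cob (\<lambda>l. f l - g l) l = cob f l - cob g l"
  by (induction l arbitrary: f g) auto

lemma cob_zero: "cob (\<lambda>l. 0) l = 0"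
  by (induction l) auto

lemma cob_mult:
  fixes f :: "'x list \<Rightarrow> 'a::ring"
  shows "cob (\<lambda>l. a * f l) l = a * cob f l"
  by (induction l arbitrary: f) (auto simp: algebra_simps)

lemma lookup_cob: "Poly_Mapping.lookup (cob c l) v = cob (\<lambda>l. Poly_Mapping.lookup (c l) v) l"
  by (induction l arbitrary: c) (auto simp: lookup_minus)

lemma cob_cob: "cob (cob c) l = 0"
  by (induction l arbitrary: c) (auto simp: cob_diff)

lemma cob_cong:
  assumes "\<And>m. set m \<subseteq> set l \<Longrightarrow> Suc (length m) = length l \<Longrightarrow> f m = g m"
  shows "cob f l = cob g l"
  using assms
proof (induction l arbitrary: f g)
  case (Cons x l)
  have "cob (\<lambda>m. f (x # m)) l = cob (\<lambda>m. g (x # m)) l"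
    by (rule Cons.IH, rule Cons.prems) auto
  moreover have "f l = g l" using Cons.prems by auto
  ultimately show ?case by simp
qed simp

text \<open>\<open>W\<close> stands for localisations and for ideals in them. \<open>T\<close>
  remembers the entries that the recursion has moved to the front.\<close>

lemma cob_in:
  assumes mono: "\<And>A B. A \<subseteq> B \<Longrightarrow> W A \<subseteq> W B" and zero: "\<And>A. 0 \<in> W A"
    and diff: "\<And>A f g. f \<in> W A \<Longrightarrow> g \<in> W A \<Longrightarrow> f - g \<in> W A"
    and f: "\<And>m. set m \<subseteq> set l \<Longrightarrow> Suc (length m) = length l \<Longrightarrow> f m \<in> W (set m \<union> T)"
  shows "cob f l \<in> W (set l \<union> T)"
  using f
proof (induction l arbitrary: f T)
  case (Cons x l)
  have "cob (\<lambda>m. f (x # m)) l \<in> W (set l \<union> insert x T)"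
  proof (rule Cons.IH)
    fix m assume "set m \<subseteq> set l" "Suc (length m) = length l"
    then have "f (x # m) \<in> W (set (x # m) \<union> T)" by (intro Cons.prems) auto
    then show "f (x # m) \<in> W (set m \<union> insert x T)" by simp
  qed
  moreover have "f l \<in> W (set (x # l) \<union> T)"
    using Cons.prems[of l] mono[of "set l \<union> T" "set (x # l) \<union> T"] by auto
  ultimately show ?case using diff by simp
qed (simp add: zero)

section \<open>Localisations of a graded monoid\<close>

locale graded_monoid =
  fixes M :: "'g::ab_group_add set" and deg :: "'g \<Rightarrow> int"
  assumes finite_M: "finite M"
    and deg_add: "deg (a + b) = deg a + deg b"
    and deg_M: "x \<in> M \<Longrightarrow> deg x = 1"
begin

lemma deg_0: "deg 0 = 0"
  using deg_add[of 0 0] by simp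

lemma deg_nonneg: "s \<in> gen M \<Longrightarrow> deg s \<ge> 0"
  by (rule additive_gen_nonneg[of deg M]) (auto simp: deg_add deg_M)

text \<open>The exponents of a localisation: \<open>Loc \<sigma>\<close> is K[S] with the monomials
  in \<sigma> inverted, S being \<open>gen M\<close>, and \<open>Loc {}\<close> is K[S]
  itself.\<close>

definition loc :: "'g set \<Rightarrow> 'g set" where
  "loc \<sigma> = {v. \<exists>\<tau>\<in>gen \<sigma>. v + \<tau> \<in> gen M}"

lemma gen_empty: "gen {} = {0::'g}"
proof -
  have "s \<in> gen {} \<Longrightarrow> s = 0" for s :: 'g by (induction rule: gen.induct) auto
  then show ?thesis by (auto intro: gen_0)
qed

lemma loc_empty: "loc {} = gen M"
  by (auto simp: loc_def gen_empty)

lemma loc_mono: "\<sigma> \<subseteq> \<tau> \<Longrightarrow> loc \<sigma> \<subseteq> loc \<tau>"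
  using gen_mono[of \<sigma> \<tau>] by (auto simp: loc_def)

lemma loc_add: "v \<in> loc \<sigma> \<Longrightarrow> w \<in> loc \<sigma> \<Longrightarrow> v + w \<in> loc \<sigma>"
proof -
  assume "v \<in> loc \<sigma>" "w \<in> loc \<sigma>"
  then obtain s t where "s \<in> gen \<sigma>" "v + s \<in> gen M" "t \<in> gen \<sigma>" "w + t \<in> gen M"
    by (auto simp: loc_def)
  then have "s + t \<in> gen \<sigma>" "(v + s) + (w + t) \<in> gen M" by (auto intro: gen_add)
  then show ?thesis unfolding loc_def
    by (auto intro!: bexI[of _ "s + t"] simp: algebra_simps)
qed

lemma loc_neg: "x \<in> gen \<sigma> \<Longrightarrow> - x \<in> loc \<sigma>"
  by (auto simp: loc_def intro!: bexI[of _ x] gen_0)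

lemma gen_loc: "s \<in> gen M \<Longrightarrow> s \<in> loc \<sigma>"
  using loc_mono[of "{}" \<sigma>] loc_empty by auto

abbreviation Loc :: "'g set \<Rightarrow> ('g \<Rightarrow>\<^sub>0 'k::field) set" where
  "Loc \<sigma> \<equiv> supp_in (loc \<sigma>)"

lemma Loc_mult: "f \<in> Loc \<sigma> \<Longrightarrow> g \<in> Loc \<sigma> \<Longrightarrow> f * g \<in> Loc \<sigma>"
  by (rule supp_in_mult) (auto intro: loc_add)

lemma Loc_mono: "\<sigma> \<subseteq> \<tau> \<Longrightarrow> Loc \<sigma> \<subseteq> Loc \<tau>"
  by (intro supp_in_mono loc_mono)

lemma Loc_mono': "f \<in> Loc {} \<Longrightarrow> f \<in> Loc \<sigma>"
  using Loc_mono[of "{}" \<sigma>] by auto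

lemma Loc_mon: "s \<in> gen M \<Longrightarrow> Poly_Mapping.single s c \<in> Loc \<sigma>"
  by (intro supp_in_single gen_loc)

lemma Loc_power:
  fixes f :: "'g \<Rightarrow>\<^sub>0 'k::field"
  shows "f \<in> Loc \<sigma> \<Longrightarrow> f ^ n \<in> Loc \<sigma>"
proof (induction n)
  case 0
  show ?case using Loc_mon[OF gen_0, of "1 :: 'k" \<sigma>] by simp
qed (auto intro: Loc_mult)

lemma gen_common:
  assumes "finite V" "\<And>v. v \<in> V \<Longrightarrow> \<exists>\<tau>\<in>gen \<sigma>. v + \<tau> \<in> T"
    and T: "\<And>t s. t \<in> T \<Longrightarrow> s \<in> gen \<sigma> \<Longrightarrow> t + s \<in> T"
  shows "\<exists>\<tau>\<in>gen \<sigma>. \<forall>v\<in>V. v + \<tau> \<in> T"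
  using assms(1,2)
proof (induction V)
  case empty
  show ?case by (auto intro: gen_0)
next
  case (insert v V)
  obtain \<tau> where \<tau>: "\<tau> \<in> gen \<sigma>" "\<forall>v\<in>V. v + \<tau> \<in> T" using insert by blast
  obtain \<rho> where \<rho>: "\<rho> \<in> gen \<sigma>" "v + \<rho> \<in> T" using insert by blast
  have "v + \<rho> + \<tau> \<in> T" "\<forall>v\<in>V. v + \<tau> + \<rho> \<in> T" using T \<tau> \<rho> by auto
  then show ?case using \<tau>(1) \<rho>(1) 
    by (auto intro!: bexI[of _ "\<rho> + \<tau>"] gen_add simp: algebra_simps)
qed

lemma Loc_denominator:
  assumes "f \<in> Loc \<sigma>" "\<sigma> \<subseteq> M"
  obtains \<tau> where "\<tau> \<in> gen \<sigma>" "mon \<tau> * f \<in> Loc {}"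
proof -
  have "\<exists>\<tau>\<in>gen \<sigma>. \<forall>v\<in>Poly_Mapping.keys f. v + \<tau> \<in> gen M"
  proof (rule gen_common)
    show "\<exists>\<tau>\<in>gen \<sigma>. v + \<tau> \<in> gen M" if "v \<in> Poly_Mapping.keys f" for v
      using assms(1) that by (auto simp: supp_in_def loc_def)
    show "t + s \<in> gen M" if "t \<in> gen M" "s \<in> gen \<sigma>" for t s
      using that gen_mono[OF assms(2)] by (auto intro: gen_add)
  qed simp
  then obtain \<tau> where \<tau>: "\<tau> \<in> gen \<sigma>" "\<And>v. v \<in> Poly_Mapping.keys f \<Longrightarrow> v + \<tau> \<in> gen M" by blast
  have "mon \<tau> * f \<in> Loc {}"
  proof (rule supp_inI)
    fix v assume "Poly_Mapping.lookup (mon \<tau> * f) v \<noteq> 0"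
    then have "v - \<tau> \<in> Poly_Mapping.keys f" by (simp add: lookup_single_mult in_keys_iff)
    from \<tau>(2)[OF this] show "v \<in> loc {}" by (simp add: loc_empty)
  qed
  with \<tau>(1) show ?thesis by (rule that)
qed

lemma gen_insert:
  "s \<in> gen (insert x \<sigma>) \<Longrightarrow> \<exists>n. \<exists>\<tau>\<in>gen \<sigma>. (mon s :: 'g \<Rightarrow>\<^sub>0 'k::field) = mon x ^ n * mon \<tau>"
proof (induction rule: gen.induct)
  case gen_0
  show ?case by (rule exI[of _ 0]) (auto intro!: bexI[of _ 0] gen.gen_0)
next
  case (gen_step y s)
  then obtain n \<tau> where n: "\<tau> \<in> gen \<sigma>" "(mon s :: 'g \<Rightarrow>\<^sub>0 'k) = mon x ^ n * mon \<tau>" by blast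
  have eq: "(mon (y + s) :: 'g \<Rightarrow>\<^sub>0 'k) = mon y * mon s" by (simp add: mult_single)
  show ?case
  proof (cases "y = x")
    case True
    have "(mon (y + s) :: 'g \<Rightarrow>\<^sub>0 'k) = mon x ^ Suc n * mon \<tau>"
      unfolding eq by (simp only: True n(2) power_Suc mult.assoc)
    then show ?thesis using n(1) by blast
  next
    case False
    then have "y + \<tau> \<in> gen \<sigma>" using gen_step.hyps(1) n(1) by (auto intro: gen.gen_step)
    moreover have "(mon (y + \<tau>) :: 'g \<Rightarrow>\<^sub>0 'k) = mon y * mon \<tau>" by (simp add: mult_single)
    then have "(mon (y + s) :: 'g \<Rightarrow>\<^sub>0 'k) = mon x ^ n * mon (y + \<tau>)"
      by (simp only: eq n(2) mult.left_commute)
    ultimately show ?thesis by blast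
  qed
qed

lemma mon_power_single: "\<exists>w\<in>gen {x}. (mon x :: 'g \<Rightarrow>\<^sub>0 'k::field) ^ n = mon w"
proof (induction n)
  case 0
  show ?case by (auto intro!: bexI[of _ 0] gen_0)
next
  case (Suc n)
  then obtain w where "w \<in> gen {x}" "(mon x :: 'g \<Rightarrow>\<^sub>0 'k) ^ n = mon w" by blast
  then show ?case by (auto intro!: bexI[of _ "x + w"] gen_step simp: mult_single)
qed

lemma mon_power_M: "x \<in> M \<Longrightarrow> (mon x :: 'g \<Rightarrow>\<^sub>0 'k::field) ^ n \<in> Loc \<sigma>"
  by (intro Loc_power Loc_mon gen_base)

lemma mon_power_cancel_Loc:
  assumes "x \<in> \<sigma>" "f \<in> Loc \<sigma>"
  shows "\<exists>g\<in>Loc \<sigma>. f = (mon x :: 'g \<Rightarrow>\<^sub>0 'k::field) ^ n * g"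
proof -
  obtain w where w: "w \<in> gen {x}" "(mon x :: 'g \<Rightarrow>\<^sub>0 'k) ^ n = mon w" using mon_power_single by blast
  then have "w \<in> gen \<sigma>" using gen_mono[of "{x}" \<sigma>] assms(1) by auto
  then have "mon (- w) * f \<in> Loc \<sigma>" by (intro Loc_mult assms supp_in_single loc_neg)
  moreover have "f = mon w * (mon (- w) * f)" by (simp add: mult.assoc[symmetric] mult_single)
  ultimately show ?thesis using w(2) by metis
qed

text \<open>A denominator is a power of \<open>x\<close> times a monomial over \<sigma>, and the
  latter is already a unit in \<open>Loc \<sigma>\<close>.\<close>

lemma Loc_insert:
  assumes "f \<in> Loc (insert x \<sigma>)" "x \<in> M" "\<sigma> \<subseteq> M"
  shows "\<exists>n. (mon x :: 'g \<Rightarrow>\<^sub>0 'k::field) ^ n * f \<in> Loc \<sigma>"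
proof -
  obtain s where s: "s \<in> gen (insert x \<sigma>)" "mon s * f \<in> Loc {}"
    using Loc_denominator[OF assms(1)] assms(2,3) by auto
  obtain n \<tau> where n: "\<tau> \<in> gen \<sigma>" "(mon s :: 'g \<Rightarrow>\<^sub>0 'k) = mon x ^ n * mon \<tau>"
    using gen_insert[OF s(1)] by blast
  have "mon (- \<tau>) * (mon s * f) \<in> Loc \<sigma>"
    by (intro Loc_mult Loc_mono'[OF s(2)] supp_in_single loc_neg n)
  also have "mon (- \<tau>) * (mon s * f) = mon x ^ n * f * (mon (- \<tau>) * mon \<tau>)"
    by (simp add: n(2) ac_simps del: mult_single)
  also have "\<dots> = mon x ^ n * f" by (simp add: mult_single)
  finally show ?thesis by blast
qed

end

lemma eventually_uniform:
  fixes P :: "'i \<Rightarrow> nat \<Rightarrow> bool"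
  assumes "finite I" "\<And>i. i \<in> I \<Longrightarrow> \<exists>n. P i n" "\<And>i m n. P i m \<Longrightarrow> m \<le> n \<Longrightarrow> P i n"
  shows "\<exists>n. \<forall>i\<in>I. P i n"
  using assms(1,2)
proof (induction I)
  case (insert i I)
  obtain n m where "\<forall>j\<in>I. P j n" "P i m" using insert by blast
  then have "\<forall>j\<in>insert i I. P j (max n m)" using assms(3) by (metis insert_iff max.cobounded1 max.cobounded2)
  then show ?case ..
qed simp

section \<open>Cochains modulo part of a homogeneous sequence\<close>

locale graded_regular_sop = graded_monoid M deg
  for M :: "'g::ab_group_add set" and deg :: "'g \<Rightarrow> int" +
  fixes ts :: "('g \<Rightarrow>\<^sub>0 'k::field) list"
  assumes ts_Loc: "m < length ts \<Longrightarrow> ts ! m \<in> Loc {}"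
    and ts_homogeneous: "m < length ts \<Longrightarrow> \<exists>n>0. \<forall>v\<in>Poly_Mapping.keys (ts ! m). deg v = n"
begin

definition Id :: "nat \<Rightarrow> 'g set \<Rightarrow> ('g \<Rightarrow>\<^sub>0 'k) set" where
  "Id i \<sigma> = {\<Sum>m<i. r m * ts ! m | r. \<forall>m. r m \<in> Loc \<sigma>}"

lemma IdI: "f = (\<Sum>m<i. r m * ts ! m) \<Longrightarrow> (\<And>m. r m \<in> Loc \<sigma>) \<Longrightarrow> f \<in> Id i \<sigma>"
  by (auto simp: Id_def)

lemma Id_0: "0 \<in> Id i \<sigma>"
  unfolding Id_def by (auto intro!: exI[of _ "\<lambda>_. 0"] supp_in_0)

lemma Id_add: "f \<in> Id i \<sigma> \<Longrightarrow> g \<in> Id i \<sigma> \<Longrightarrow> f + g \<in> Id i \<sigma>"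
proof -
  assume "f \<in> Id i \<sigma>" "g \<in> Id i \<sigma>"
  then obtain r q where "f = (\<Sum>m<i. r m * ts ! m)" "\<forall>m. r m \<in> Loc \<sigma>"
    "g = (\<Sum>m<i. q m * ts ! m)" "\<forall>m. q m \<in> Loc \<sigma>" by (auto simp: Id_def)
  then show ?thesis unfolding Id_def
    by (auto intro!: exI[of _ "\<lambda>m. r m + q m"] supp_in_add simp: algebra_simps sum.distrib)
qed

lemma Id_mult: "a \<in> Loc \<sigma> \<Longrightarrow> f \<in> Id i \<sigma> \<Longrightarrow> a * f \<in> Id i \<sigma>"
proof -
  assume a: "a \<in> Loc \<sigma>" and "f \<in> Id i \<sigma>"
  then obtain r where "f = (\<Sum>m<i. r m * ts ! m)" "\<forall>m. r m \<in> Loc \<sigma>" by (auto simp: Id_def)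
  then show ?thesis unfolding Id_def using a
    by (auto intro!: exI[of _ "\<lambda>m. a * r m"] Loc_mult simp: sum_distrib_left mult.assoc)
qed

lemma Id_uminus: "f \<in> Id i \<sigma> \<Longrightarrow> - f \<in> Id i \<sigma>"
proof -
  assume "f \<in> Id i \<sigma>"
  then obtain r where "f = (\<Sum>m<i. r m * ts ! m)" "\<forall>m. r m \<in> Loc \<sigma>" by (auto simp: Id_def)
  then show ?thesis unfolding Id_def
    by (auto intro!: exI[of _ "\<lambda>m. - r m"] supp_in_uminus simp: sum_negf)
qed

lemma Id_diff: "f \<in> Id i \<sigma> \<Longrightarrow> g \<in> Id i \<sigma> \<Longrightarrow> f - g \<in> Id i \<sigma>"
  using Id_add[OF _ Id_uminus, of f i \<sigma> g] by simp

lemma Id_sum: "(\<And>j. j \<in> J \<Longrightarrow> f j \<in> Id i \<sigma>) \<Longrightarrow> sum f J \<in> Id i \<sigma>"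
  by (induction J rule: infinite_finite_induct) (auto intro: Id_0 Id_add)

lemma Id_mono: "\<sigma> \<subseteq> \<tau> \<Longrightarrow> Id i \<sigma> \<subseteq> Id i \<tau>"
  unfolding Id_def using Loc_mono[of \<sigma> \<tau>] by blast

lemma Id_zero_index: "Id 0 \<sigma> = {0}"
  by (auto simp: Id_def intro!: exI[of _ "\<lambda>_. 0"] supp_in_0)

lemma Id_Suc: "f \<in> Id (Suc i) \<sigma> \<longleftrightarrow> (\<exists>g\<in>Id i \<sigma>. \<exists>a\<in>Loc \<sigma>. f = g + ts ! i * a)"
proof
  assume "f \<in> Id (Suc i) \<sigma>"
  then obtain r where r: "f = (\<Sum>m<Suc i. r m * ts ! m)" "\<forall>m. r m \<in> Loc \<sigma>" by (auto simp: Id_def)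
  then have "f = (\<Sum>m<i. r m * ts ! m) + ts ! i * r i" by (simp add: mult.commute)
  moreover have "(\<Sum>m<i. r m * ts ! m) \<in> Id i \<sigma>" using r by (auto simp: Id_def)
  ultimately show "\<exists>g\<in>Id i \<sigma>. \<exists>a\<in>Loc \<sigma>. f = g + ts ! i * a" using r by blast
next
  assume "\<exists>g\<in>Id i \<sigma>. \<exists>a\<in>Loc \<sigma>. f = g + ts ! i * a"
  then obtain r a where r: "f = (\<Sum>m<i. r m * ts ! m) + ts ! i * a" "\<forall>m. r m \<in> Loc \<sigma>" "a \<in> Loc \<sigma>"
    by (auto simp: Id_def)
  let ?q = "\<lambda>m. if m < i then r m else a"
  have "f = (\<Sum>m<Suc i. ?q m * ts ! m)" by (simp add: r mult.commute)
  moreover have "\<forall>m. ?q m \<in> Loc \<sigma>" using r by auto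
  ultimately show "f \<in> Id (Suc i) \<sigma>" by (intro IdI[of f ?q]) auto
qed

lemma Id_Suc_mono: "f \<in> Id i \<sigma> \<Longrightarrow> f \<in> Id (Suc i) \<sigma>"
  unfolding Id_Suc by (rule bexI[of _ f], rule bexI[of _ 0]) (auto intro: supp_in_0)

lemma Id_Suc_mult: "a \<in> Loc \<sigma> \<Longrightarrow> ts ! i * a \<in> Id (Suc i) \<sigma>"
  unfolding Id_Suc by (rule bexI[of _ 0], rule bexI[of _ a]) (auto intro: Id_0)

lemma Id_mono': "f \<in> Id i {} \<Longrightarrow> f \<in> Id i \<sigma>"
  using Id_mono[of "{}" \<sigma> i] by auto

lemma Id_denominator:
  assumes "f \<in> Id i \<sigma>" "\<sigma> \<subseteq> M"
  obtains \<tau> where "\<tau> \<in> gen \<sigma>" "mon \<tau> * f \<in> Id i {}"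
proof -
  obtain r where r: "f = (\<Sum>m<i. r m * ts ! m)" "\<forall>m. r m \<in> Loc \<sigma>" using assms(1) by (auto simp: Id_def)
  have gen_M: "s \<in> gen M" if "s \<in> gen \<sigma>" for s using that gen_mono[OF assms(2)] by blast
  have "\<exists>\<tau>\<in>gen \<sigma>. \<forall>m<n. mon \<tau> * r m \<in> Loc {}" for n
  proof (induction n)
    case 0
    show ?case by (auto intro: gen_0)
  next
    case (Suc n)
    then obtain \<tau> where \<tau>: "\<tau> \<in> gen \<sigma>" "\<forall>m<n. mon \<tau> * r m \<in> Loc {}" by blast
    obtain \<rho> where \<rho>: "\<rho> \<in> gen \<sigma>" "mon \<rho> * r n \<in> Loc {}"
      using Loc_denominator[of "r n" \<sigma>] r assms(2) by blast
    have "mon (\<tau> + \<rho>) * r m = mon \<rho> * (mon \<tau> * r m)" "mon (\<tau> + \<rho>) * r m = mon \<tau> * (mon \<rho> * r m)" for m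
      by (simp_all add: mult.assoc[symmetric] mult_single add.commute)
    then have "\<forall>m<Suc n. mon (\<tau> + \<rho>) * r m \<in> Loc {}"
      using \<tau> \<rho> by (metis Loc_mon Loc_mult gen_M less_Suc_eq)
    then show ?case using \<tau> \<rho> by (auto intro!: bexI[of _ "\<tau> + \<rho>"] gen_add)
  qed
  then obtain \<tau> where \<tau>: "\<tau> \<in> gen \<sigma>" "\<forall>m<i. mon \<tau> * r m \<in> Loc {}" by blast
  \<comment> \<open>\<open>Id\<close> asks for coefficients at every index, so those from
    \<open>i\<close> on are set to 0.\<close>
  have "mon \<tau> * f = (\<Sum>m<i. (if m < i then mon \<tau> * r m else 0) * ts ! m)"
    by (simp add: r(1) sum_distrib_left mult.assoc)
  then have "mon \<tau> * f \<in> Id i {}" by (rule IdI) (use \<tau>(2) in \<open>auto intro: supp_in_0\<close>)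
  with \<tau>(1) show ?thesis by (rule that)
qed

lemma Id_cancel_mon:
  assumes "mon \<tau> * f \<in> Id i \<sigma>" "\<tau> \<in> gen \<sigma>"
  shows "f \<in> Id i \<sigma>"
proof -
  have "mon (- \<tau>) * (mon \<tau> * f) \<in> Id i \<sigma>"
    by (intro Id_mult assms supp_in_single loc_neg)
  then show ?thesis by (simp add: mult.assoc[symmetric] mult_single)
qed

lemma Id_insert:
  assumes "f \<in> Id i (insert x \<sigma>)" "x \<in> M" "\<sigma> \<subseteq> M"
  shows "\<exists>n. mon x ^ n * f \<in> Id i \<sigma>"
proof -
  obtain s where s: "s \<in> gen (insert x \<sigma>)" "mon s * f \<in> Id i {}"
    using Id_denominator[OF assms(1)] assms(2,3) by auto
  obtain n \<tau> where n: "\<tau> \<in> gen \<sigma>" "(mon s :: 'g \<Rightarrow>\<^sub>0 'k) = mon x ^ n * mon \<tau>"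
    using gen_insert[OF s(1)] by blast
  have "mon \<tau> * (mon x ^ n * f) \<in> Id i \<sigma>"
    using Id_mono'[OF s(2), of \<sigma>] by (simp add: n(2) ac_simps)
  then show ?thesis using Id_cancel_mon n(1) by blast
qed

text \<open>Homogeneous generators make the ideal homogeneous: projecting the sum projects each
  coefficient, with \<open>Q\<close> shifted by the degree of its generator.\<close>

lemma Id_restr_deg:
  assumes "f \<in> Id i {}" "i \<le> length ts"
  shows "restr (\<lambda>v. Q (deg v)) f \<in> Id i {}"
proof -
  obtain r where r: "f = (\<Sum>m<i. r m * ts ! m)" "\<forall>m. r m \<in> Loc {}" using assms(1) by (auto simp: Id_def)
  have "\<exists>n. \<forall>v\<in>Poly_Mapping.keys (ts ! m). deg v = n" if "m < i" for m
    using ts_homogeneous[of m] that assms(2) by auto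
  then obtain n where n: "\<And>m v. m < i \<Longrightarrow> v \<in> Poly_Mapping.keys (ts ! m) \<Longrightarrow> deg v = n m" by metis
  have "restr (\<lambda>v. Q (deg v)) f = (\<Sum>m<i. restr (\<lambda>v. Q (deg v + n m)) (r m) * ts ! m)"
    unfolding r(1) restr_sum
    by (intro sum.cong refl restr_mult_homogeneous[where h = deg]) (auto simp: deg_add n)
  then show ?thesis by (rule IdI) (use r(2) in \<open>auto intro: restr_supp_in\<close>)
qed

text \<open>The value at \<open>l\<close> lies in the localisation at the entries of
  \<open>l\<close>, as in the Cech complex. Notation for the comments below: R is
  \<open>Loc {}\<close>, t_i is \<open>ts ! i\<close>, I_i is \<open>Id i {}\<close>, and H^j(R/I_i)
  consists of the cocycles \<open>cyc i j\<close> modulo \<open>bnd i j\<close>.\<close>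

definition C :: "('g list \<Rightarrow> 'g \<Rightarrow>\<^sub>0 'k) set" where
  "C = {c. \<forall>l. set l \<subseteq> M \<longrightarrow> c l \<in> Loc (set l)}"

text \<open>Cochains of degree \<open>j\<close> modulo the first \<open>i\<close> elements of \<open>ts\<close>; only their values on lists of
  length \<open>j\<close> matter.\<close>

definition cyc :: "nat \<Rightarrow> nat \<Rightarrow> ('g list \<Rightarrow> 'g \<Rightarrow>\<^sub>0 'k) \<Rightarrow> bool" where
  "cyc i j c \<longleftrightarrow> c \<in> C \<and> (\<forall>l. set l \<subseteq> M \<longrightarrow> length l = Suc j \<longrightarrow> cob c l \<in> Id i (set l))"

definition bnd :: "nat \<Rightarrow> nat \<Rightarrow> ('g list \<Rightarrow> 'g \<Rightarrow>\<^sub>0 'k) \<Rightarrow> bool" where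
  "bnd i j c \<longleftrightarrow> (\<exists>b\<in>C. \<forall>l. set l \<subseteq> M \<longrightarrow> length l = j \<longrightarrow> c l - cob b l \<in> Id i (set l))"

lemma C_add: "b \<in> C \<Longrightarrow> c \<in> C \<Longrightarrow> (\<lambda>l. b l + c l) \<in> C"
  by (auto simp: C_def intro: supp_in_add)

lemma C_diff: "b \<in> C \<Longrightarrow> c \<in> C \<Longrightarrow> (\<lambda>l. b l - c l) \<in> C"
  by (auto simp: C_def intro: supp_in_diff)

lemma C_mult: "a \<in> Loc {} \<Longrightarrow> c \<in> C \<Longrightarrow> (\<lambda>l. a * c l) \<in> C"
  by (auto simp: C_def intro: Loc_mult Loc_mono')

lemma C_zero: "(\<lambda>l. 0) \<in> C"
  by (auto simp: C_def intro: supp_in_0)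

lemma cob_Id:
  assumes "\<And>m. set m \<subseteq> M \<Longrightarrow> length m = j \<Longrightarrow> f m \<in> Id i (set m)" "set l \<subseteq> M" "length l = Suc j"
  shows "cob f l \<in> Id i (set l)"
  using cob_in[of "Id i" l f "{}"] assms Id_mono Id_0 Id_diff by auto

lemma cob_C:
  assumes "c \<in> C"
  shows "cob c \<in> C"
  unfolding C_def
proof (intro CollectI allI impI)
  fix l :: "'g list" assume "set l \<subseteq> M"
  then have "set m \<subseteq> set l \<Longrightarrow> c m \<in> Loc (set m \<union> {})" for m
    using assms by (auto simp: C_def)
  then have "cob c l \<in> Loc (set l \<union> {})"
    by (intro cob_in[where W = "\<lambda>\<sigma>. Loc \<sigma>"] Loc_mono supp_in_0 supp_in_diff) auto
  then show "cob c l \<in> Loc (set l)" by simp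
qed

lemma bnd_add: "bnd i j b \<Longrightarrow> bnd i j c \<Longrightarrow> bnd i j (\<lambda>l. b l + c l)"
proof -
  assume "bnd i j b" "bnd i j c"
  then obtain x y where *: "x \<in> C" "y \<in> C"
    and "\<And>l. set l \<subseteq> M \<Longrightarrow> length l = j \<Longrightarrow> b l - cob x l \<in> Id i (set l)"
    "\<And>l. set l \<subseteq> M \<Longrightarrow> length l = j \<Longrightarrow> c l - cob y l \<in> Id i (set l)"
    by (auto simp: bnd_def)
  from Id_add[OF this(3,4)] have "set l \<subseteq> M \<Longrightarrow> length l = j \<Longrightarrow>
      b l + c l - cob (\<lambda>l. x l + y l) l \<in> Id i (set l)" for l
    by (simp add: cob_add algebra_simps)
  with C_add[OF *] show ?thesis unfolding bnd_def by blast
qed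

lemma bnd_mult: "a \<in> Loc {} \<Longrightarrow> bnd i j c \<Longrightarrow> bnd i j (\<lambda>l. a * c l)"
proof -
  assume a: "a \<in> Loc {}" and "bnd i j c"
  then obtain x where *: "x \<in> C" 
    and "\<And>l. set l \<subseteq> M \<Longrightarrow> length l = j \<Longrightarrow> c l - cob x l \<in> Id i (set l)"
    by (auto simp: bnd_def)
  from Id_mult[OF Loc_mono'[OF a] this(2)] have "set l \<subseteq> M \<Longrightarrow> length l = j \<Longrightarrow>
      a * c l - cob (\<lambda>l. a * x l) l \<in> Id i (set l)" for l
    by (simp add: cob_mult right_diff_distrib)
  with C_mult[OF a *] show ?thesis unfolding bnd_def by blast
qed

lemma bnd_cong:
  assumes "\<And>l. set l \<subseteq> M \<Longrightarrow> length l = j \<Longrightarrow> b l - c l \<in> Id i (set l)" "bnd i j c"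
  shows "bnd i j b"
proof -
  obtain x where x: "x \<in> C" "\<And>l. set l \<subseteq> M \<Longrightarrow> length l = j \<Longrightarrow> c l - cob x l \<in> Id i (set l)"
    using assms(2) by (auto simp: bnd_def)
  have "b l - cob x l \<in> Id i (set l)" if "set l \<subseteq> M" "length l = j" for l
    using Id_add[OF assms(1)[OF that] x(2)[OF that]] by simp
  with x(1) show ?thesis unfolding bnd_def by blast
qed

lemma bnd_zero: "bnd i j (\<lambda>l. 0)"
  unfolding bnd_def by (rule bexI[of _ "\<lambda>l. 0"]) (auto simp: cob_zero Id_0 C_zero)

lemma bnd_Id: "(\<And>l. set l \<subseteq> M \<Longrightarrow> length l = j \<Longrightarrow> b l \<in> Id i (set l)) \<Longrightarrow> bnd i j b"
  using bnd_cong[OF _ bnd_zero] by simp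

lemma bnd_cob: "b \<in> C \<Longrightarrow> bnd i j (cob b)"
  unfolding bnd_def by (rule bexI[of _ b]) (auto simp: Id_0)

lemma bnd_sum: "(\<And>k. k \<in> K \<Longrightarrow> bnd i j (f k)) \<Longrightarrow> bnd i j (\<lambda>l. \<Sum>k\<in>K. f k l)"
  by (induction K rule: infinite_finite_induct) (auto intro: bnd_zero bnd_add)

lemma cyc_C: "cyc i j c \<Longrightarrow> c \<in> C"
  by (simp add: cyc_def)

lemma cyc_mult: "a \<in> Loc {} \<Longrightarrow> cyc i j c \<Longrightarrow> cyc i j (\<lambda>l. a * c l)"
  by (auto simp: cyc_def cob_mult intro: C_mult Id_mult Loc_mono')

lemma cyc_Suc_mono: "cyc i j c \<Longrightarrow> cyc (Suc i) j c"
  by (auto simp: cyc_def intro: Id_Suc_mono)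

text \<open>The complex becomes contractible after inverting any generator.\<close>

lemma cyc_torsion:
  assumes c: "cyc i j c" and x: "x \<in> M"
  shows "\<exists>n. bnd i j (\<lambda>l. mon x ^ n * c l)"
proof -
  let ?I = "{l. set l \<subseteq> M \<and> length l \<le> j}"
  let ?P = "\<lambda>l n. mon x ^ n * c (x # l) \<in> Loc (set l) \<and>
    (length l = j \<longrightarrow> mon x ^ n * cob c (x # l) \<in> Id i (set l))"
  have up: "?P l n" if "?P l m" "m \<le> n" for l m n
  proof -
    have *: "mon x ^ n = (mon x :: 'g \<Rightarrow>\<^sub>0 'k) ^ (n - m) * mon x ^ m"
      using that(2) by (simp add: power_add[symmetric])
    show ?thesis using that(1) x unfolding * mult.assoc
      by (auto intro!: Loc_mult Id_mult mon_power_M)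
  qed
  have "\<exists>n. \<forall>l\<in>?I. ?P l n"
  proof (rule eventually_uniform)
    show "finite ?I" using finite_lists_length_le[OF finite_M] .
    fix l assume l: "l \<in> ?I"
    have "c (x # l) \<in> Loc (set (x # l))" using c l x unfolding cyc_def C_def
      by (metis (mono_tags, lifting) insert_subset list.simps(15) mem_Collect_eq)
    then obtain n where n: "mon x ^ n * c (x # l) \<in> Loc (set l)" using Loc_insert[of _ x "set l"] l x by auto
    show "\<exists>n. ?P l n"
    proof (cases "length l = j")
      case True
      then have "cob c (x # l) \<in> Id i (set (x # l))" using c l x unfolding cyc_def
        by (metis (mono_tags, lifting) insert_subset length_Cons list.simps(15) mem_Collect_eq)
      then obtain m where m: "mon x ^ m * cob c (x # l) \<in> Id i (set l)" using Id_insert[of _ i x "set l"] l x by auto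
      have "mon x ^ (m + n) * c (x # l) \<in> Loc (set l)" "mon x ^ (n + m) * cob c (x # l) \<in> Id i (set l)"
        using n m x unfolding power_add mult.assoc by (auto intro!: Loc_mult Id_mult mon_power_M)
      then show ?thesis by (auto simp: add.commute intro!: exI[of _ "m + n"])
    qed (use n in auto)
  qed (rule up)
  then obtain n where n: "\<And>l. set l \<subseteq> M \<Longrightarrow> length l \<le> j \<Longrightarrow> ?P l n" by blast
  \<comment> \<open>The homotopy: prepend \<open>x\<close> and let x^n clear the new denominator.
    The exponent \<open>n\<close> is uniform only for the finitely many lists of length at most
    \<open>j\<close>, so \<open>b\<close> is 0 on longer ones in order to stay in
    \<open>C\<close>.\<close>
  define b where "b = (\<lambda>l. if length l \<le> j then mon x ^ n * c (x # l) else 0)"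
  have "b \<in> C" using n by (auto simp: b_def C_def intro: supp_in_0)
  moreover have "mon x ^ n * c l - cob b l \<in> Id i (set l)" if l: "set l \<subseteq> M" "length l = j" for l
  proof -
    have "cob b l = cob (\<lambda>m. mon x ^ n * c (x # m)) l"
      using l by (intro cob_cong) (auto simp: b_def)
    then have "mon x ^ n * c l - cob b l = mon x ^ n * cob c (x # l)"
      by (simp add: cob_mult right_diff_distrib)
    then show ?thesis using n[of l] l by simp
  qed
  ultimately show ?thesis unfolding bnd_def by blast
qed

end

section \<open>Descent along the regular sequence\<close>

locale gorenstein_monoid_algebra = graded_regular_sop M deg ts
  for M :: "'g::ab_group_add set" and deg :: "'g \<Rightarrow> int" and ts :: "('g \<Rightarrow>\<^sub>0 'k::field) list" +
  assumes regular: "i < length ts \<Longrightarrow> a \<in> Loc {} \<Longrightarrow> ts ! i * a \<in> Id i {} \<Longrightarrow> a \<in> Id i {}"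
    and nilpotent: "x \<in> M \<Longrightarrow> \<exists>n. mon x ^ n \<in> Id (length ts) {}"
    and socle: "a \<in> Loc {} \<Longrightarrow> b \<in> Loc {} \<Longrightarrow> (\<And>x. x \<in> M \<Longrightarrow> mon x * a \<in> Id (length ts) {}) \<Longrightarrow>
      (\<And>x. x \<in> M \<Longrightarrow> mon x * b \<in> Id (length ts) {}) \<Longrightarrow>
      \<exists>\<alpha> \<beta>. (\<alpha> \<noteq> 0 \<or> \<beta> \<noteq> 0) \<and>
        Poly_Mapping.single 0 \<alpha> * a + Poly_Mapping.single 0 \<beta> * b \<in> Id (length ts) {}"
begin

abbreviation d :: nat where "d \<equiv> length ts"

lemma ts_Loc': "i < d \<Longrightarrow> ts ! i \<in> Loc \<sigma>"
  by (rule Loc_mono'[OF ts_Loc])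

text \<open>Denominators are cleared, \<open>regular\<close> is applied in R, and the clearing
  monomials cancel because they are units of \<open>Loc \<sigma>\<close>.\<close>

lemma regular_Loc:
  assumes "i < d" "a \<in> Loc \<sigma>" "\<sigma> \<subseteq> M" "ts ! i * a \<in> Id i \<sigma>"
  shows "a \<in> Id i \<sigma>"
proof -
  obtain \<tau> where \<tau>: "\<tau> \<in> gen \<sigma>" "mon \<tau> * a \<in> Loc {}" by (rule Loc_denominator[OF assms(2,3)])
  obtain \<rho> where \<rho>: "\<rho> \<in> gen \<sigma>" "mon \<rho> * (ts ! i * a) \<in> Id i {}" by (rule Id_denominator[OF assms(4,3)])
  have gen_M: "s \<in> gen M" if "s \<in> gen \<sigma>" for s using that gen_mono[OF assms(3)] by blast
  have "ts ! i * (mon \<rho> * (mon \<tau> * a)) = mon \<tau> * (mon \<rho> * (ts ! i * a))" by (simp only: ac_simps)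
  also have "\<dots> \<in> Id i {}" by (rule Id_mult[OF Loc_mon[OF gen_M[OF \<tau>(1)]] \<rho>(2)])
  finally have "mon \<rho> * (mon \<tau> * a) \<in> Id i {}"
    by (rule regular[OF assms(1) Loc_mult[OF Loc_mon[OF gen_M[OF \<rho>(1)]] \<tau>(2)]])
  then have "mon \<rho> * (mon \<tau> * a) \<in> Id i \<sigma>" by (rule Id_mono')
  then show ?thesis by (rule Id_cancel_mon[OF Id_cancel_mon[OF _ \<rho>(1)] \<tau>(1)])
qed

text \<open>A generator in \<sigma> is both a unit of \<open>Loc \<sigma>\<close> and nilpotent
  modulo \<open>ts\<close>, so the localised quotient is zero. Hence the complex of R/I_d lives in
  degree 0 alone.\<close>

lemma Id_top:
  assumes "\<sigma> \<noteq> {}" "\<sigma> \<subseteq> M" "f \<in> Loc \<sigma>"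
  shows "f \<in> Id d \<sigma>"
proof -
  obtain x where x: "x \<in> \<sigma>" "x \<in> M" using assms by blast
  obtain n where n: "mon x ^ n \<in> Id d {}" using nilpotent x by blast
  obtain g where "g \<in> Loc \<sigma>" "f = mon x ^ n * g" using mon_power_cancel_Loc[OF x(1) assms(3)] by blast
  then show ?thesis using Id_mult[of g \<sigma> _ d, OF _ Id_mono'[OF n]] by (simp add: mult.commute)
qed

text \<open>\<open>s\<close> is a sum of \<open>deg s\<close> generators; if each \<open>x\<close>
  occurred at most \<open>N x\<close> times, the degree would not exceed the sum of the
  \<open>N x\<close>.\<close>

lemma gen_pigeonhole:
  assumes "s \<in> gen M" "deg s > (\<Sum>x\<in>M. int (N x))"
  shows "\<exists>x\<in>M. \<exists>s'\<in>gen M. (mon s :: 'g \<Rightarrow>\<^sub>0 'k) = mon s' * mon x ^ N x"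
proof -
  have "\<exists>e. (mon s :: 'g \<Rightarrow>\<^sub>0 'k) = (\<Prod>x\<in>M. mon x ^ e x) \<and> deg s = (\<Sum>x\<in>M. int (e x))"
    using assms(1)
  proof (induction rule: gen.induct)
    case gen_0
    show ?case by (rule exI[of _ "\<lambda>_. 0"]) (simp add: deg_0)
  next
    case (gen_step y s)
    then obtain e where e: "(mon s :: 'g \<Rightarrow>\<^sub>0 'k) = (\<Prod>x\<in>M. mon x ^ e x)" "deg s = (\<Sum>x\<in>M. int (e x))" by blast
    have "(mon (y + s) :: 'g \<Rightarrow>\<^sub>0 'k) = mon y * mon s" by (simp add: mult_single)
    also have "\<dots> = (\<Prod>x\<in>M. if x = y then mon x else 1) * (\<Prod>x\<in>M. mon x ^ e x)"
      using gen_step.hyps(1) finite_M by (simp add: e)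
    also have "\<dots> = (\<Prod>x\<in>M. mon x ^ (e x + (if x = y then 1 else 0)))"
      by (auto simp: prod.distrib[symmetric] power_add mult.commute intro!: prod.cong)
    finally have "(mon (y + s) :: 'g \<Rightarrow>\<^sub>0 'k) = (\<Prod>x\<in>M. mon x ^ (e x + (if x = y then 1 else 0)))" .
    moreover have "(\<Sum>x\<in>M. int (e x + (if x = y then 1 else 0))) = (\<Sum>x\<in>M. int (e x) + (if x = y then 1 else 0))"
      by (intro sum.cong) auto
    then have "deg (y + s) = (\<Sum>x\<in>M. int (e x + (if x = y then 1 else 0)))"
      using gen_step.hyps(1) finite_M by (simp add: e deg_add deg_M sum.distrib)
    ultimately show ?case
      by (intro exI[of _ "\<lambda>x. e x + (if x = y then 1 else 0)"] conjI)
  qed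
  then obtain e where e: "(mon s :: 'g \<Rightarrow>\<^sub>0 'k) = (\<Prod>x\<in>M. mon x ^ e x)" "deg s = (\<Sum>x\<in>M. int (e x))" by blast
  then have "\<not> (\<forall>x\<in>M. e x \<le> N x)" using assms(2) sum_mono[of M "\<lambda>x. int (e x)" "\<lambda>x. int (N x)"] by force
  then obtain x where x: "x \<in> M" "N x \<le> e x" by force
  have "\<exists>w\<in>gen M. (\<Prod>y\<in>A. (mon y :: 'g \<Rightarrow>\<^sub>0 'k) ^ f y) = mon w" if "A \<subseteq> M" for A f
    using finite_subset[OF that finite_M] that
  proof (induction A)
    case empty
    show ?case by (auto intro!: bexI[of _ 0] gen_0)
  next
    case (insert y A)
    then obtain w v where "w \<in> gen M" "(\<Prod>y\<in>A. (mon y :: 'g \<Rightarrow>\<^sub>0 'k) ^ f y) = mon w" "v \<in> gen {y}" "(mon y :: 'g \<Rightarrow>\<^sub>0 'k) ^ f y = mon v"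
      using mon_power_single[of y "f y", where 'k = 'k] by blast
    then show ?case using insert gen_mono[of "{y}" M]
      by (auto intro!: bexI[of _ "v + w"] gen_add simp: mult_single)
  qed
  from this[of "M - {x}" e] this[of "{x}" "\<lambda>_. e x - N x"] x
  obtain w v where w: "w \<in> gen M" "(\<Prod>y\<in>M-{x}. (mon y :: 'g \<Rightarrow>\<^sub>0 'k) ^ e y) = mon w"
    and v: "v \<in> gen M" "(mon x :: 'g \<Rightarrow>\<^sub>0 'k) ^ (e x - N x) = mon v" by auto
  have "(mon s :: 'g \<Rightarrow>\<^sub>0 'k) = mon x ^ e x * mon w"
    unfolding e(1) w(2)[symmetric] using x(1) finite_M by (simp add: prod.remove)
  also have "mon x ^ e x = mon v * (mon x :: 'g \<Rightarrow>\<^sub>0 'k) ^ N x"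
    unfolding v(2)[symmetric] using x(2) by (simp add: power_add[symmetric])
  also have "mon v * mon x ^ N x * mon w = (mon v * mon w) * (mon x :: 'g \<Rightarrow>\<^sub>0 'k) ^ N x"
    by (simp only: ac_simps)
  also have "mon v * mon w = (mon (v + w) :: 'g \<Rightarrow>\<^sub>0 'k)" by (simp add: mult_single)
  finally have "(mon s :: 'g \<Rightarrow>\<^sub>0 'k) = mon (v + w) * mon x ^ N x" .
  then show ?thesis using x(1) gen_add[OF v(1) w(1)] by blast
qed

text \<open>The torsion exponents of the finitely many generators add up to a degree beyond which
  every monomial kills the class.\<close>

lemma cyc_deg_torsion:
  assumes c: "cyc i j c"
  shows "\<exists>N. \<forall>s\<in>gen M. deg s > N \<longrightarrow> bnd i j (\<lambda>l. mon s * c l)"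
proof -
  from cyc_torsion[OF c] obtain N where N: "\<And>x. x \<in> M \<Longrightarrow> bnd i j (\<lambda>l. mon x ^ N x * c l)" by metis
  have "bnd i j (\<lambda>l. mon s * c l)" if s: "s \<in> gen M" "deg s > (\<Sum>x\<in>M. int (N x))" for s
  proof -
    obtain x s' where x: "x \<in> M" "s' \<in> gen M" "(mon s :: 'g \<Rightarrow>\<^sub>0 'k) = mon s' * mon x ^ N x"
      using gen_pigeonhole[OF s] by blast
    show ?thesis using bnd_mult[OF Loc_mon[OF x(2), of 1] N[OF x(1)]]
      by (simp only: x(3) mult.assoc)
  qed
  then show ?thesis by blast
qed

lemma ts_power_deg:
  assumes "i < d" "v \<in> Poly_Mapping.keys (ts ! i ^ n)"
  shows "deg v \<ge> int n" "v \<in> gen M"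
proof -
  have t: "v \<in> gen M" "deg v \<ge> 1" if "v \<in> Poly_Mapping.keys (ts ! i)" for v
    using ts_Loc[OF assms(1)] ts_homogeneous[OF assms(1)] that by (force simp: supp_in_def loc_empty)+
  have "\<forall>v\<in>Poly_Mapping.keys (ts ! i ^ n). deg v \<ge> int n \<and> v \<in> gen M"
  proof (induction n)
    case 0
    show ?case by (auto simp: deg_0 intro: gen_0)
  next
    case (Suc n)
    show ?case
    proof
      fix v assume "v \<in> Poly_Mapping.keys (ts ! i ^ Suc n)"
      then obtain a b where "v = a + b" "a \<in> Poly_Mapping.keys (ts ! i)" "b \<in> Poly_Mapping.keys (ts ! i ^ n)"
        using keys_mult[of "ts ! i" "ts ! i ^ n"] by auto
      then show "deg v \<ge> int (Suc n) \<and> v \<in> gen M" using Suc t[of a] by (auto simp: deg_add intro: gen_add)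
    qed
  qed
  then show "deg v \<ge> int n" "v \<in> gen M" using assms(2) by auto
qed

lemma cyc_ts_torsion:
  assumes c: "cyc i j c" and "e < d"
  shows "\<exists>n. bnd i j (\<lambda>l. ts ! e ^ n * c l)"
proof -
  obtain N where N: "\<And>s. s \<in> gen M \<Longrightarrow> deg s > N \<Longrightarrow> bnd i j (\<lambda>l. mon s * c l)"
    using cyc_deg_torsion[OF c] by blast
  let ?t = "ts ! e ^ nat (N + 1)"
  have "bnd i j (\<lambda>l. \<Sum>v\<in>Poly_Mapping.keys ?t. Poly_Mapping.single 0 (Poly_Mapping.lookup ?t v) * (mon v * c l))"
  proof (intro bnd_sum bnd_mult[OF Loc_mon[OF gen_0] N])
    fix v assume "v \<in> Poly_Mapping.keys ?t"
    from ts_power_deg[OF assms(2) this] show "v \<in> gen M" "deg v > N" by linarith+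
  qed
  moreover have "(\<Sum>v\<in>Poly_Mapping.keys ?t. Poly_Mapping.single 0 (Poly_Mapping.lookup ?t v) * (mon v * c l)) = ?t * c l" for l
  proof -
    have "?t * c l = (\<Sum>v\<in>Poly_Mapping.keys ?t. Poly_Mapping.single v (Poly_Mapping.lookup ?t v)) * c l"
      using poly_mapping_expand[of ?t] by simp
    then show ?thesis by (simp add: sum_distrib_right mult.assoc[symmetric] mult_single)
  qed
  ultimately show ?thesis by auto
qed

lemma Id_Suc_choose:
  assumes "\<And>l. set l \<subseteq> M \<Longrightarrow> length l = j \<Longrightarrow> f l \<in> Id (Suc i) (set l)"
  obtains g a where "\<And>l. set l \<subseteq> M \<Longrightarrow> length l = j \<Longrightarrow> g l \<in> Id i (set l)"
    "\<And>l. set l \<subseteq> M \<Longrightarrow> length l = j \<Longrightarrow> f l = g l + ts ! i * a l" "a \<in> C"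
proof -
  have "\<forall>l\<in>{l. set l \<subseteq> M \<and> length l = j}. \<exists>p. fst p \<in> Id i (set l) \<and> snd p \<in> Loc (set l) \<and>
      f l = fst p + ts ! i * snd p"
    using assms by (fastforce simp: Id_Suc)
  from bchoice[OF this] obtain p where p: "\<And>l. set l \<subseteq> M \<Longrightarrow> length l = j \<Longrightarrow>
      fst (p l) \<in> Id i (set l) \<and> snd (p l) \<in> Loc (set l) \<and> f l = fst (p l) + ts ! i * snd (p l)"
    by blast
  show ?thesis
    by (rule that[of "\<lambda>l. fst (p l)" "\<lambda>l. if length l = j then snd (p l) else 0"])
      (use p in \<open>auto simp: C_def intro: supp_in_0\<close>)
qed

text \<open>Multiplication by t_i gives the exact sequence 0 -> R/I_i -> R/I_i -> R/I_{i+1} -> 0.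
  Its connecting homomorphism takes the coboundary of a lift and divides by t_i; here it is seen to
  send boundaries to boundaries.\<close>

lemma bnd_Suc_cob:
  assumes "bnd (Suc i) j b"
  obtains a where "a \<in> C" "\<And>l. set l \<subseteq> M \<Longrightarrow> length l = Suc j \<Longrightarrow> cob b l - ts ! i * cob a l \<in> Id i (set l)"
proof -
  obtain x where x: "x \<in> C" "\<And>l. set l \<subseteq> M \<Longrightarrow> length l = j \<Longrightarrow> b l - cob x l \<in> Id (Suc i) (set l)"
    using assms by (auto simp: bnd_def)
  obtain g a where g: "\<And>l. set l \<subseteq> M \<Longrightarrow> length l = j \<Longrightarrow> g l \<in> Id i (set l)"
    and ga: "\<And>l. set l \<subseteq> M \<Longrightarrow> length l = j \<Longrightarrow> b l - cob x l = g l + ts ! i * a l" and a: "a \<in> C"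
    using Id_Suc_choose[OF x(2)] by blast
  have "cob b l - ts ! i * cob a l \<in> Id i (set l)" if l: "set l \<subseteq> M" "length l = Suc j" for l
  proof -
    have "cob b l = cob (\<lambda>m. cob x m + (g m + ts ! i * a m)) l"
    proof (rule cob_cong)
      fix m assume "set m \<subseteq> set l" "Suc (length m) = length l"
      then have "set m \<subseteq> M" "length m = j" using l by auto
      from ga[OF this] show "b m = cob x m + (g m + ts ! i * a m)" by (simp add: algebra_simps)
    qed
    also have "\<dots> = cob g l + ts ! i * cob a l" by (simp add: cob_add cob_cob cob_mult)
    finally have "cob b l - ts ! i * cob a l = cob g l" by simp
    then show ?thesis using cob_Id[of j g i l] g l by simp
  qed
  with a show ?thesis by (rule that)
qed

text \<open>The connecting homomorphism from H^j(R/I_{i+1}) to H^{j+1}(R/I_i). The quotient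
  \<open>c\<close> of \<open>cob b\<close> by t_i is a cocycle because t_i is regular modulo
  I_i.\<close>

lemma cyc_Suc_connecting:
  assumes "cyc (Suc i) j b" "i < d"
  obtains c where "cyc i (Suc j) c"
    "\<And>l. set l \<subseteq> M \<Longrightarrow> length l = Suc j \<Longrightarrow> cob b l - ts ! i * c l \<in> Id i (set l)"
proof -
  have "\<And>l. set l \<subseteq> M \<Longrightarrow> length l = Suc j \<Longrightarrow> cob b l \<in> Id (Suc i) (set l)"
    using assms(1) by (simp add: cyc_def)
  then obtain g c where g: "\<And>l. set l \<subseteq> M \<Longrightarrow> length l = Suc j \<Longrightarrow> g l \<in> Id i (set l)"
    and gc: "\<And>l. set l \<subseteq> M \<Longrightarrow> length l = Suc j \<Longrightarrow> cob b l = g l + ts ! i * c l" and C: "c \<in> C"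
    using Id_Suc_choose[of "Suc j" "cob b" i] by blast
  have *: "cob b l - ts ! i * c l \<in> Id i (set l)" if "set l \<subseteq> M" "length l = Suc j" for l
    using g[OF that] gc[OF that] by simp
  have "cob c l \<in> Id i (set l)" if l: "set l \<subseteq> M" "length l = Suc (Suc j)" for l
  proof (rule regular_Loc[OF assms(2)])
    show "cob c l \<in> Loc (set l)" using cob_C[OF C] l by (simp add: C_def)
    have "cob (\<lambda>l. cob b l - ts ! i * c l) l \<in> Id i (set l)" by (rule cob_Id[OF * l])
    then have "- (ts ! i * cob c l) \<in> Id i (set l)" by (simp add: cob_diff cob_cob cob_mult)
    then show "ts ! i * cob c l \<in> Id i (set l)" using Id_uminus by fastforce
  qed (rule l)
  then have "cyc i (Suc j) c" using C by (simp add: cyc_def)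
  then show ?thesis using * by (rule that)
qed

lemma bnd_divide:
  assumes "i < d" "c \<in> C" "a \<in> C"
    and "\<And>l. set l \<subseteq> M \<Longrightarrow> length l = j \<Longrightarrow> ts ! i * c l - ts ! i * cob a l \<in> Id i (set l)"
  shows "bnd i j c"
  unfolding bnd_def
proof (intro bexI[of _ a] allI impI)
  fix l assume l: "set l \<subseteq> M" "length l = j"
  show "c l - cob a l \<in> Id i (set l)"
  proof (rule regular_Loc[OF assms(1)])
    show "c l - cob a l \<in> Loc (set l)" using C_diff[OF assms(2) cob_C[OF assms(3)]] l by (simp add: C_def)
    show "ts ! i * (c l - cob a l) \<in> Id i (set l)" using assms(4)[OF l] by (simp add: right_diff_distrib)
  qed (rule l)
qed (rule assms)

text \<open>On H^j(R/I_i) the parameter t_i acts injectively, because H^{j-1}(R/I_{i+1}) vanishes by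
  induction, and every class is killed by a power of it, by \<open>cyc_ts_torsion\<close>; so the
  group is zero. Dividing by \<open>d - k\<close> parameters leaves \<open>k\<close> of them, and
  \<open>k\<close> is the only surviving degree.\<close>

lemma cohomology_vanishes: "k \<le> d \<Longrightarrow> j \<noteq> k \<Longrightarrow> cyc (d - k) j c \<Longrightarrow> bnd (d - k) j c"
proof (induction k arbitrary: j c)
  case 0
  show ?case
  proof (rule bnd_Id)
    fix l assume l: "set l \<subseteq> M" "length l = j"
    then have "set l \<noteq> {}" using 0 by auto
    then show "c l \<in> Id (d - 0) (set l)" using Id_top l cyc_C[OF 0(3)] by (auto simp: C_def)
  qed
next
  case (Suc k)
  define i where "i = d - Suc k"
  have i: "i < d" "d - k = Suc i" using Suc.prems(1) by (auto simp: i_def)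
  have step: "bnd i j c" if c: "cyc i j c" and tc: "bnd i j (\<lambda>l. ts ! i * c l)" for c
  proof -
    obtain b where b: "b \<in> C" "\<And>l. set l \<subseteq> M \<Longrightarrow> length l = j \<Longrightarrow> ts ! i * c l - cob b l \<in> Id i (set l)"
      using tc by (auto simp: bnd_def)
    show ?thesis
    proof (cases j)
      case 0
      \<comment> \<open>There is nothing below degree 0: \<open>cob b []\<close> is 0, so t_i c
        already lies in I_i and t_i can be cancelled.\<close>
      show ?thesis
        by (rule bnd_divide[OF i(1) cyc_C[OF c] C_zero]) (use b(2) 0 in \<open>auto simp: cob_zero\<close>)
    next
      case (Suc j')
      have "cob b l \<in> Id (Suc i) (set l)" if l: "set l \<subseteq> M" "length l = j" for l
      proof -
        have "ts ! i * c l - (ts ! i * c l - cob b l) \<in> Id (Suc i) (set l)"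
          by (intro Id_diff Id_Suc_mult Id_Suc_mono b l)
            (use cyc_C[OF c] l in \<open>auto simp: C_def\<close>)
        then show ?thesis by simp
      qed
      then have "cyc (Suc i) j' b" using b(1) Suc by (simp add: cyc_def)
      then have "bnd (Suc i) j' b" using Suc.IH[of j' b] Suc.prems Suc i by simp
      then obtain a where a: "a \<in> C" "\<And>l. set l \<subseteq> M \<Longrightarrow> length l = Suc j' \<Longrightarrow> cob b l - ts ! i * cob a l \<in> Id i (set l)"
        by (rule bnd_Suc_cob) blast
      show ?thesis
      proof (rule bnd_divide[OF i(1) cyc_C[OF c] a(1)])
        fix l assume l: "set l \<subseteq> M" "length l = j"
        show "ts ! i * c l - ts ! i * cob a l \<in> Id i (set l)"
          using Id_add[OF b(2)[OF l] a(2)] l Suc by simp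
      qed
    qed
  qed
  have c: "cyc i j c" using Suc.prems by (simp add: i_def)
  obtain n where "bnd i j (\<lambda>l. ts ! i ^ n * c l)" using cyc_ts_torsion[OF c i(1)] by blast
  then have "bnd i j c"
  proof (induction n)
    case (Suc n)
    have "bnd i j (\<lambda>l. ts ! i ^ n * c l)"
      by (rule step) (use Suc.prems c i in \<open>auto intro!: cyc_mult Loc_power ts_Loc simp: mult.assoc\<close>)
    then show ?case by (rule Suc.IH)
  qed simp
  then show ?case by (simp add: i_def)
qed

text \<open>\<open>d - i\<close> is one above the only degree in which R/I_{i+1} has cohomology, so
  \<open>c\<close> bounds modulo I_{i+1}; over I_i the difference is a multiple of t_i.\<close>

lemma cohomology_divisible:
  assumes "i < d" "cyc i (d - i) c"
  obtains c' where "cyc i (d - i) c'" "bnd i (d - i) (\<lambda>l. c l - ts ! i * c' l)"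
proof -
  have "bnd (Suc i) (d - i) c"
    using cohomology_vanishes[of "d - Suc i" "d - i" c] cyc_Suc_mono[OF assms(2)] assms(1) by simp
  then obtain x where x: "x \<in> C" "\<And>l. set l \<subseteq> M \<Longrightarrow> length l = d - i \<Longrightarrow> c l - cob x l \<in> Id (Suc i) (set l)"
    by (auto simp: bnd_def)
  obtain g c' where g: "\<And>l. set l \<subseteq> M \<Longrightarrow> length l = d - i \<Longrightarrow> g l \<in> Id i (set l)"
    and gc: "\<And>l. set l \<subseteq> M \<Longrightarrow> length l = d - i \<Longrightarrow> c l - cob x l = g l + ts ! i * c' l" and C: "c' \<in> C"
    using Id_Suc_choose[OF x(2)] by blast
  have "cob c' l \<in> Id i (set l)" if l: "set l \<subseteq> M" "length l = Suc (d - i)" for l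
  proof (rule regular_Loc[OF assms(1)])
    show "cob c' l \<in> Loc (set l)" using cob_C[OF C] l by (simp add: C_def)
    have "cob (\<lambda>m. c m - cob x m - ts ! i * c' m) l \<in> Id i (set l)"
      by (rule cob_Id[OF _ l]) (use g gc in simp)
    then have "cob c l - ts ! i * cob c' l \<in> Id i (set l)" by (simp add: cob_diff cob_cob cob_mult)
    moreover have "cob c l \<in> Id i (set l)" using assms(2) l by (simp add: cyc_def)
    ultimately show "ts ! i * cob c' l \<in> Id i (set l)"
      using Id_diff[of "cob c l" i "set l" "cob c l - ts ! i * cob c' l"] by simp
  qed (rule l)
  then have "cyc i (d - i) c'" using C by (simp add: cyc_def)
  moreover have "bnd i (d - i) (\<lambda>l. c l - ts ! i * c' l)"
  proof (rule bnd_cong[OF _ bnd_cob[OF x(1)]])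
    fix l assume l: "set l \<subseteq> M" "length l = d - i"
    have "c l - ts ! i * c' l - cob x l = g l"
      using gc[OF l] by (simp add: algebra_simps)
    then show "c l - ts ! i * c' l - cob x l \<in> Id i (set l)" using g[OF l] by simp
  qed
  ultimately show ?thesis by (rule that)
qed

end

section \<open>Annihilator, socle and multidegrees of top cohomology\<close>

context gorenstein_monoid_algebra
begin

lemma bnd_Suc_mono: "bnd i j c \<Longrightarrow> bnd (Suc i) j c"
  unfolding bnd_def by (meson Id_Suc_mono)

text \<open>The connecting homomorphism into top cohomology is injective, because H^k(R/I_i) is
  zero: if \<open>e\<close> times the image \<open>c\<close> of \<open>b\<close> bounds, then e b -
  t_i x is a cocycle modulo I_i, hence a boundary.\<close>

lemma bnd_Suc_of_cob:
  assumes i: "i < d" "d - i = Suc k"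
    and "e \<in> Loc {}" "b \<in> C" "x \<in> C"
    and b: "\<And>l. set l \<subseteq> M \<Longrightarrow> length l = Suc k \<Longrightarrow> cob b l - ts ! i * c l \<in> Id i (set l)"
    and x: "\<And>l. set l \<subseteq> M \<Longrightarrow> length l = Suc k \<Longrightarrow> e * c l - cob x l \<in> Id i (set l)"
  shows "bnd (Suc i) k (\<lambda>l. e * b l)"
proof -
  let ?y = "\<lambda>l. e * b l - ts ! i * x l"
  have C: "?y \<in> C" by (intro C_diff C_mult assms ts_Loc i)
  have "cob ?y l \<in> Id i (set l)" if l: "set l \<subseteq> M" "length l = Suc k" for l
  proof -
    have "cob ?y l = e * (cob b l - ts ! i * c l) + ts ! i * (e * c l - cob x l)"
      by (simp add: cob_diff cob_mult) (simp add: algebra_simps)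
    also have "\<dots> \<in> Id i (set l)"
      by (intro Id_add Id_mult b x l Loc_mono'[OF assms(3)] ts_Loc' i)
    finally show ?thesis .
  qed
  then have "cyc i k ?y" using C by (simp add: cyc_def)
  moreover have "d - (d - i) = i" using i(1) by simp
  ultimately have "bnd i k ?y" using cohomology_vanishes[of "d - i" k ?y] i by simp
  then have "bnd (Suc i) k ?y" by (rule bnd_Suc_mono)
  then show ?thesis
  proof (rule bnd_cong[rotated])
    fix l assume l: "set l \<subseteq> M" "length l = k"
    then have "x l \<in> Loc (set l)" using assms(5) by (simp add: C_def)
    then show "e * b l - ?y l \<in> Id (Suc i) (set l)" by (simp add: Id_Suc_mult)
  qed
qed

text \<open>An annihilator of H^{k+1}(R/I_i) also annihilates H^k(R/I_{i+1}), which embeds into it,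
  so by induction it lies in I_{i+1}. Its cofactor at t_i is again an annihilator; iterating, it
  lies in I_i + t_i^n R for every n, and a comparison of degrees takes the place of Krull's
  intersection theorem.\<close>

lemma annihilator_cohomology:
  assumes "k \<le> d" "a \<in> Loc {}" "\<And>c. cyc (d - k) k c \<Longrightarrow> bnd (d - k) k (\<lambda>l. a * c l)"
  shows "a \<in> Id (d - k) {}"
  using assms
proof (induction k arbitrary: a)
  case 0
  \<comment> \<open>The class of 1 generates H^0(R/I_d) = R/I_d; it is a cocycle because by
    \<open>Id_top\<close> everything in positive degree is zero.\<close>
  let ?c = "\<lambda>l::'g list. 1 :: 'g \<Rightarrow>\<^sub>0 'k"
  have C: "?c \<in> C" using Loc_mon[OF gen_0, of "1 :: 'k"] by (simp add: C_def)
  have "cyc d 0 ?c" unfolding cyc_def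
  proof (intro conjI C allI impI Id_top)
    fix l :: "'g list" assume "set l \<subseteq> M" "length l = Suc 0"
    then show "set l \<noteq> {}" "set l \<subseteq> M" "cob ?c l \<in> Loc (set l)" using cob_C[OF C] by (auto simp: C_def)
  qed
  then obtain b where "\<And>l. set l \<subseteq> M \<Longrightarrow> length l = 0 \<Longrightarrow> a * 1 - cob b l \<in> Id d (set l)"
    using 0(3)[of ?c] by (auto simp: bnd_def)
  from this[of "[]"] show ?case by simp
next
  case (Suc k)
  define i where "i = d - Suc k"
  have i: "i < d" "d - k = Suc i" "d - i = Suc k" using Suc.prems(1) by (auto simp: i_def)
  define Ann where "Ann = {a \<in> Loc {}. \<forall>c. cyc i (Suc k) c \<longrightarrow> bnd i (Suc k) (\<lambda>l. a * c l)}"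
  have Ann_Id: "a \<in> Id (Suc i) {}" if a: "a \<in> Ann" for a
  proof -
    have "a \<in> Id (d - k) {}"
    proof (rule Suc.IH)
      show "k \<le> d" "a \<in> Loc {}" using Suc.prems(1) a by (auto simp: Ann_def)
      fix b assume "cyc (d - k) k b"
      then have b: "cyc (Suc i) k b" by (simp add: i)
      then obtain c where c: "cyc i (Suc k) c"
        "\<And>l. set l \<subseteq> M \<Longrightarrow> length l = Suc k \<Longrightarrow> cob b l - ts ! i * c l \<in> Id i (set l)"
        by (rule cyc_Suc_connecting[OF _ i(1)]) blast
      then have "bnd i (Suc k) (\<lambda>l. a * c l)" using a by (simp add: Ann_def)
      then obtain x where x: "x \<in> C" "\<And>l. set l \<subseteq> M \<Longrightarrow> length l = Suc k \<Longrightarrow> a * c l - cob x l \<in> Id i (set l)"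
        by (auto simp: bnd_def)
      show "bnd (d - k) k (\<lambda>l. a * b l)" unfolding i(2)
        by (intro bnd_Suc_of_cob[OF i(1,3) \<open>a \<in> Loc {}\<close> cyc_C[OF b] x(1) c(2) x(2)])
    qed
    then show ?thesis by (simp add: i)
  qed
  \<comment> \<open>Up to a boundary every class \<open>c\<close> is t_i c', by
    \<open>cohomology_divisible\<close>, and a' t_i c' = (a - g) c' with \<open>g\<close> in
    I_i.\<close>
  have Ann_step: "\<exists>a'\<in>Ann. a - ts ! i * a' \<in> Id i {}" if a: "a \<in> Ann" for a
  proof -
    obtain g a' where g: "g \<in> Id i {}" "a' \<in> Loc {}" "a = g + ts ! i * a'" using Ann_Id[OF a] by (auto simp: Id_Suc)
    have "bnd i (Suc k) (\<lambda>l. a' * c l)" if c: "cyc i (Suc k) c" for c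
    proof -
      obtain c' where c': "cyc i (Suc k) c'" "bnd i (Suc k) (\<lambda>l. c l - ts ! i * c' l)"
        using cohomology_divisible[of i c] c i by auto
      have "bnd i (Suc k) (\<lambda>l. a' * (c l - ts ! i * c' l) + a * c' l)"
        using a c'(1) by (intro bnd_add bnd_mult[OF g(2) c'(2)]) (simp add: Ann_def)
      then show ?thesis
      proof (rule bnd_cong[rotated])
        fix l assume l: "set l \<subseteq> M" "length l = Suc k"
        have "c' l * (- g) \<in> Id i (set l)"
          by (rule Id_mult[OF _ Id_mono'[OF Id_uminus[OF g(1)]]]) (use cyc_C[OF c'(1)] l in \<open>simp add: C_def\<close>)
        then show "a' * c l - (a' * (c l - ts ! i * c' l) + a * c' l) \<in> Id i (set l)"
          by (simp add: g(3) algebra_simps)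
      qed
    qed
    then show ?thesis using g by (intro bexI[of _ a']) (auto simp: Ann_def)
  qed
  have a: "a \<in> Ann" using Suc.prems by (auto simp: Ann_def i_def)
  have "\<exists>a'\<in>Ann. a - ts ! i ^ n * a' \<in> Id i {}" for n
  proof (induction n)
    case 0
    show ?case using a by (auto intro!: bexI[of _ a] Id_0)
  next
    case (Suc n)
    then obtain a' where a': "a' \<in> Ann" "a - ts ! i ^ n * a' \<in> Id i {}" by blast
    obtain a'' where a'': "a'' \<in> Ann" "a' - ts ! i * a'' \<in> Id i {}" using Ann_step[OF a'(1)] by blast
    have "ts ! i ^ n * (a' - ts ! i * a'') \<in> Id i {}" by (intro Id_mult Loc_power ts_Loc i a'')
    from Id_add[OF a'(2) this] have "a - ts ! i ^ Suc n * a'' \<in> Id i {}" by (simp add: algebra_simps)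
    then show ?case using a'' by blast
  qed
  then obtain a' where a': "a' \<in> Ann" 
    "a - ts ! i ^ nat (Max (insert 0 (deg ` Poly_Mapping.keys a)) + 1) * a' \<in> Id i {}" by blast
  \<comment> \<open>Beyond every degree of \<open>a\<close>: projecting to degrees below
    \<open>N\<close> keeps \<open>a\<close> and kills t_i^N a', whose exponents have degree at least
    \<open>N\<close>.\<close>
  define N where "N = Max (insert 0 (deg ` Poly_Mapping.keys a)) + 1"
  have N: "deg v < N" if "v \<in> Poly_Mapping.keys a" for v
  proof -
    have "deg v \<le> Max (insert 0 (deg ` Poly_Mapping.keys a))" using that by (intro Max_ge) auto
    then show ?thesis by (simp add: N_def)
  qed
  have "restr (\<lambda>v. deg v < N) (a - ts ! i ^ nat N * a') \<in> Id i {}"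
    using a'(2) i(1) unfolding N_def[symmetric] by (intro Id_restr_deg[where Q = "\<lambda>n. n < N"]) auto
  moreover have "restr (\<lambda>v. deg v < N) a = a"
    by (rule poly_mapping_eqI) (use N in \<open>auto simp: lookup_restr in_keys_iff\<close>)
  moreover have "restr (\<lambda>v. deg v < N) (ts ! i ^ nat N * a') = 0"
  proof (rule poly_mapping_eqI)
    fix v
    have "\<not> deg v < N" if v: "v \<in> Poly_Mapping.keys (ts ! i ^ nat N * a')"
    proof -
      obtain x y where xy: "v = x + y" "x \<in> Poly_Mapping.keys (ts ! i ^ nat N)" "y \<in> Poly_Mapping.keys a'"
        using v keys_mult by blast
      have "deg y \<ge> 0" using xy(3) a'(1) by (auto simp: Ann_def supp_in_def loc_empty intro: deg_nonneg)
      then show ?thesis using ts_power_deg(1)[OF i(1) xy(2)] unfolding xy(1) deg_add by linarith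
    qed
    then show "Poly_Mapping.lookup (restr (\<lambda>v. deg v < N) (ts ! i ^ nat N * a')) v = Poly_Mapping.lookup 0 v"
      by (auto simp: lookup_restr in_keys_iff)
  qed
  ultimately show ?case by (simp add: restr_diff i_def)
qed

text \<open>All exponents of \<open>ts ! e\<close> have positive degree, so each of its monomials is
  divisible by a generator.\<close>

lemma socle_ts:
  assumes "\<And>x. x \<in> M \<Longrightarrow> bnd i j (\<lambda>l. mon x * c l)" "e < d"
  shows "bnd i j (\<lambda>l. ts ! e * c l)"
proof -
  let ?t = "ts ! e"
  have "bnd i j (\<lambda>l. Poly_Mapping.single v (Poly_Mapping.lookup ?t v) * c l)"
    if v: "v \<in> Poly_Mapping.keys ?t" for v
  proof -
    have "v \<in> gen M" "deg v \<ge> 1" using ts_power_deg[of e v 1] assms(2) v by auto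
    then obtain x s where x: "v = x + s" "x \<in> M" "s \<in> gen M" using deg_0 by (auto elim: gen.cases)
    have "bnd i j (\<lambda>l. Poly_Mapping.single s (Poly_Mapping.lookup ?t v) * (mon x * c l))"
      by (rule bnd_mult[OF Loc_mon[OF x(3)] assms(1)[OF x(2)]])
    then show ?thesis by (simp add: mult.assoc[symmetric] mult_single x(1) add.commute)
  qed
  then have "bnd i j (\<lambda>l. \<Sum>v\<in>Poly_Mapping.keys ?t. Poly_Mapping.single v (Poly_Mapping.lookup ?t v) * c l)"
    by (rule bnd_sum)
  moreover have "(\<Sum>v\<in>Poly_Mapping.keys ?t. Poly_Mapping.single v (Poly_Mapping.lookup ?t v) * c l) = ?t * c l" for l
    using poly_mapping_expand[of ?t] by (simp add: sum_distrib_right[symmetric])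
  ultimately show ?thesis by simp
qed

text \<open>Linear dependence of any two socle elements expresses dimension at most one in a form
  that can be lifted. A socle class of H^{k+1}(R/I_i) is killed by t_i, hence is the connecting
  image of a class of H^k(R/I_{i+1}), and this class is in the socle because the connecting map is
  injective.\<close>

lemma socle_cohomology:
  assumes "k \<le> d" "cyc (d - k) k c" "cyc (d - k) k c'"
    "\<And>x. x \<in> M \<Longrightarrow> bnd (d - k) k (\<lambda>l. mon x * c l)"
    "\<And>x. x \<in> M \<Longrightarrow> bnd (d - k) k (\<lambda>l. mon x * c' l)"
  shows "\<exists>\<alpha> \<beta>. (\<alpha> \<noteq> 0 \<or> \<beta> \<noteq> 0) \<and>
    bnd (d - k) k (\<lambda>l. Poly_Mapping.single 0 \<alpha> * c l + Poly_Mapping.single 0 \<beta> * c' l)"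
  using assms
proof (induction k arbitrary: c c')
  case 0
  have L: "c [] \<in> Loc {}" "c' [] \<in> Loc {}"
    using 0(2,3)[THEN cyc_C] by (force simp: C_def dest: spec[of _ "[]"])+
  have I: "f [] \<in> Id d {}" if "bnd d 0 f" for f using that by (force simp: bnd_def)
  have "mon x * c [] \<in> Id d {}" "mon x * c' [] \<in> Id d {}" if "x \<in> M" for x
    using I[OF 0(4)[OF that, simplified]] I[OF 0(5)[OF that, simplified]] by simp_all
  from socle[OF L this] obtain \<alpha> \<beta> where ab: "\<alpha> \<noteq> 0 \<or> \<beta> \<noteq> 0"
    "Poly_Mapping.single 0 \<alpha> * c [] + Poly_Mapping.single 0 \<beta> * c' [] \<in> Id d {}"
    by blast
  have "bnd d 0 (\<lambda>l. Poly_Mapping.single 0 \<alpha> * c l + Poly_Mapping.single 0 \<beta> * c' l)"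
    by (rule bnd_Id) (use ab(2) in simp)
  with ab(1) show ?case unfolding diff_zero by blast
next
  case (Suc k)
  define i where "i = d - Suc k"
  have i: "i < d" "d - k = Suc i" "d - i = Suc k" using Suc.prems(1) by (auto simp: i_def)
  have lift: "\<exists>b. cyc (Suc i) k b \<and> (\<forall>x\<in>M. bnd (Suc i) k (\<lambda>l. mon x * b l)) \<and>
      (\<forall>l. set l \<subseteq> M \<longrightarrow> length l = Suc k \<longrightarrow> cob b l - ts ! i * c l \<in> Id i (set l))"
    if c: "cyc i (Suc k) c" and s: "\<And>x. x \<in> M \<Longrightarrow> bnd i (Suc k) (\<lambda>l. mon x * c l)" for c
  proof -
    obtain b where b: "b \<in> C" "\<And>l. set l \<subseteq> M \<Longrightarrow> length l = Suc k \<Longrightarrow> ts ! i * c l - cob b l \<in> Id i (set l)"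
      using socle_ts[OF s i(1)] by (auto simp: bnd_def)
    have b': "cob b l - ts ! i * c l \<in> Id i (set l)" if "set l \<subseteq> M" "length l = Suc k" for l
      using Id_uminus[OF b(2)[OF that]] by simp
    have "cob b l \<in> Id (Suc i) (set l)" if l: "set l \<subseteq> M" "length l = Suc k" for l
    proof -
      have "c l \<in> Loc (set l)" using cyc_C[OF c] l by (simp add: C_def)
      from Id_add[OF Id_Suc_mono[OF b'[OF l]] Id_Suc_mult[OF this]] show ?thesis by simp
    qed
    then have "cyc (Suc i) k b" using b(1) by (simp add: cyc_def)
    moreover have "bnd (Suc i) k (\<lambda>l. mon x * b l)" if x: "x \<in> M" for x
    proof -
      obtain y where y: "y \<in> C" "\<And>l. set l \<subseteq> M \<Longrightarrow> length l = Suc k \<Longrightarrow> mon x * c l - cob y l \<in> Id i (set l)"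
        using s[OF x] by (auto simp: bnd_def)
      show ?thesis by (rule bnd_Suc_of_cob[OF i(1,3) Loc_mon[OF gen_base[OF x]] b(1) y(1) b' y(2)])
    qed
    ultimately show ?thesis using b' by (intro exI[of _ b]) simp
  qed
  have c: "cyc i (Suc k) c" "cyc i (Suc k) c'" using Suc.prems(2,3) by (simp_all only: i_def)
  note s = Suc.prems(4,5)[folded i_def]
  obtain b where b: "cyc (Suc i) k b" "\<And>x. x \<in> M \<Longrightarrow> bnd (Suc i) k (\<lambda>l. mon x * b l)"
    "\<And>l. set l \<subseteq> M \<Longrightarrow> length l = Suc k \<Longrightarrow> cob b l - ts ! i * c l \<in> Id i (set l)"
    using lift[OF c(1) s(1)] by blast
  obtain b' where b': "cyc (Suc i) k b'" "\<And>x. x \<in> M \<Longrightarrow> bnd (Suc i) k (\<lambda>l. mon x * b' l)"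
    "\<And>l. set l \<subseteq> M \<Longrightarrow> length l = Suc k \<Longrightarrow> cob b' l - ts ! i * c' l \<in> Id i (set l)"
    using lift[OF c(2) s(2)] by blast
  obtain \<alpha> \<beta> where ab: "\<alpha> \<noteq> 0 \<or> \<beta> \<noteq> 0"
    "bnd (Suc i) k (\<lambda>l. Poly_Mapping.single 0 \<alpha> * b l + Poly_Mapping.single 0 \<beta> * b' l)"
    using Suc.IH[unfolded i(2), OF _ b(1) b'(1) b(2) b'(2)] Suc.prems(1) by auto
  let ?u = "\<lambda>l. Poly_Mapping.single 0 \<alpha> * b l + Poly_Mapping.single 0 \<beta> * b' l"
  let ?w = "\<lambda>l. Poly_Mapping.single 0 \<alpha> * c l + Poly_Mapping.single 0 \<beta> * c' l"
  obtain a where a: "a \<in> C" "\<And>l. set l \<subseteq> M \<Longrightarrow> length l = Suc k \<Longrightarrow> cob ?u l - ts ! i * cob a l \<in> Id i (set l)"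
    using ab(2) by (rule bnd_Suc_cob) blast
  \<comment> \<open>The relation between the lifts \<open>b\<close> and \<open>b'\<close>, sent
    through the connecting map, says that t_i times \<open>?w\<close> is t_i times a coboundary
    modulo I_i.\<close>
  have "bnd i (Suc k) ?w"
  proof (rule bnd_divide[OF i(1) _ a(1)])
    show "?w \<in> C"
      by (rule C_add[OF C_mult[OF Loc_mon[OF gen_0] cyc_C[OF c(1)]] C_mult[OF Loc_mon[OF gen_0] cyc_C[OF c(2)]]])
    fix l assume l: "set l \<subseteq> M" "length l = Suc k"
    have identity: "t * (A * x + B * x') - t * e = (A * y + B * y' - t * e) - A * (y - t * x) - B * (y' - t * x')"
      for t A B x x' e y y' :: "'g \<Rightarrow>\<^sub>0 'k" by (simp add: algebra_simps)
    have "cob ?u l = Poly_Mapping.single 0 \<alpha> * cob b l + Poly_Mapping.single 0 \<beta> * cob b' l"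
      by (simp only: cob_add cob_mult)
    then have "ts ! i * ?w l - ts ! i * cob a l = (cob ?u l - ts ! i * cob a l) -
        Poly_Mapping.single 0 \<alpha> * (cob b l - ts ! i * c l) - Poly_Mapping.single 0 \<beta> * (cob b' l - ts ! i * c' l)"
      by (simp only: identity)
    also have "\<dots> \<in> Id i (set l)"
      by (rule Id_diff[OF Id_diff[OF a(2)[OF l] Id_mult[OF Loc_mon[OF gen_0] b(3)[OF l]]]
            Id_mult[OF Loc_mon[OF gen_0] b'(3)[OF l]]])
    finally show "ts ! i * ?w l - ts ! i * cob a l \<in> Id i (set l)" .
  qed
  then show ?case using ab(1) unfolding i_def[symmetric] by (intro exI[of _ \<alpha>] exI[of _ \<beta>] conjI)
qed

text \<open>Top cohomology in the single multidegree \<open>v\<close> is computed by a complex of vector spaces that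
  only records which localisations contain \<open>v\<close>.\<close>

definition coh :: "'g \<Rightarrow> bool" where
  "coh v \<longleftrightarrow> (\<exists>f :: 'g list \<Rightarrow> 'k. (\<forall>l. set l \<subseteq> M \<longrightarrow> f l \<noteq> 0 \<longrightarrow> v \<in> loc (set l)) \<and>
    (\<forall>l. set l \<subseteq> M \<longrightarrow> length l = Suc d \<longrightarrow> cob f l = 0) \<and>
    \<not> (\<exists>g. (\<forall>l. set l \<subseteq> M \<longrightarrow> g l \<noteq> 0 \<longrightarrow> v \<in> loc (set l)) \<and>
        (\<forall>l. set l \<subseteq> M \<longrightarrow> length l = d \<longrightarrow> f l = cob g l)))"

lemma coh_cong:
  assumes "\<And>\<sigma>. \<sigma> \<subseteq> M \<Longrightarrow> v \<in> loc \<sigma> \<longleftrightarrow> w \<in> loc \<sigma>"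
  shows "coh v \<longleftrightarrow> coh w"
proof -
  have "(\<forall>l. set l \<subseteq> M \<longrightarrow> h l \<noteq> 0 \<longrightarrow> v \<in> loc (set l)) \<longleftrightarrow>
      (\<forall>l. set l \<subseteq> M \<longrightarrow> h l \<noteq> 0 \<longrightarrow> w \<in> loc (set l))" for h :: "'g list \<Rightarrow> 'k"
    using assms by blast
  then show ?thesis by (simp only: coh_def)
qed

lemma single_cob: "cob (\<lambda>l. Poly_Mapping.single v (f l)) l = Poly_Mapping.single v (cob f l)"
  by (induction l arbitrary: f) (auto simp: single_diff)

lemma single_C: "(\<lambda>l. Poly_Mapping.single v (f l)) \<in> C \<longleftrightarrow> (\<forall>l. set l \<subseteq> M \<longrightarrow> f l \<noteq> 0 \<longrightarrow> v \<in> loc (set l))"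
  by (auto simp: C_def supp_in_def)

lemma C_component: "c \<in> C \<Longrightarrow> (\<lambda>l. Poly_Mapping.single v (Poly_Mapping.lookup (c l) v)) \<in> C"
  unfolding single_C
proof (intro allI impI)
  fix l :: "'g list" assume "c \<in> C" "set l \<subseteq> M" "Poly_Mapping.lookup (c l) v \<noteq> 0"
  then show "v \<in> loc (set l)" by (intro supp_inD[of "c l"]) (auto simp: C_def)
qed

lemma bnd_component: "bnd 0 j c \<Longrightarrow> bnd 0 j (\<lambda>l. Poly_Mapping.single v (Poly_Mapping.lookup (c l) v))"
proof -
  assume "bnd 0 j c"
  then obtain b where b: "b \<in> C" "\<And>l. set l \<subseteq> M \<Longrightarrow> length l = j \<Longrightarrow> c l = cob b l"
    by (auto simp: bnd_def Id_zero_index)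
  have "(\<lambda>l. Poly_Mapping.single v (Poly_Mapping.lookup (b l) v)) \<in> C"
    by (rule C_component[OF b(1)])
  then show ?thesis unfolding bnd_def Id_zero_index
    by (rule bexI[rotated]) (auto simp: b(2) single_cob lookup_cob)
qed

lemma cyc_component: "cyc 0 j c \<Longrightarrow> cyc 0 j (\<lambda>l. Poly_Mapping.single v (Poly_Mapping.lookup (c l) v))"
  by (simp add: cyc_def Id_zero_index single_cob C_component lookup_cob[symmetric])

text \<open>The complex is graded by exponents, so a bounding cochain may be replaced by its
  component at \<open>v\<close>.\<close>

lemma coh_iff:
  "coh v \<longleftrightarrow> (\<exists>f. cyc 0 d (\<lambda>l. Poly_Mapping.single v (f l)) \<and> \<not> bnd 0 d (\<lambda>l. Poly_Mapping.single v (f l)))"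
proof -
  have "bnd 0 d (\<lambda>l. Poly_Mapping.single v (f l)) \<longleftrightarrow>
      (\<exists>g. (\<forall>l. set l \<subseteq> M \<longrightarrow> g l \<noteq> 0 \<longrightarrow> v \<in> loc (set l)) \<and>
        (\<forall>l. set l \<subseteq> M \<longrightarrow> length l = d \<longrightarrow> f l = cob g l))" for f
  proof
    assume "bnd 0 d (\<lambda>l. Poly_Mapping.single v (f l))"
    then obtain b where b: "b \<in> C" "\<And>l. set l \<subseteq> M \<Longrightarrow> length l = d \<Longrightarrow> Poly_Mapping.single v (f l) = cob b l"
      by (auto simp: bnd_def Id_zero_index)
    have "f l = cob (\<lambda>l. Poly_Mapping.lookup (b l) v) l" if "set l \<subseteq> M" "length l = d" for l
      using b(2)[OF that] lookup_cob[of b l v] by (metis lookup_single_eq)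
    then show "\<exists>g. (\<forall>l. set l \<subseteq> M \<longrightarrow> g l \<noteq> 0 \<longrightarrow> v \<in> loc (set l)) \<and>
        (\<forall>l. set l \<subseteq> M \<longrightarrow> length l = d \<longrightarrow> f l = cob g l)"
      using b(1) by (intro exI[of _ "\<lambda>l. Poly_Mapping.lookup (b l) v"]) (auto simp: C_def dest: supp_inD)
  next
    assume "\<exists>g. (\<forall>l. set l \<subseteq> M \<longrightarrow> g l \<noteq> 0 \<longrightarrow> v \<in> loc (set l)) \<and>
        (\<forall>l. set l \<subseteq> M \<longrightarrow> length l = d \<longrightarrow> f l = cob g l)"
    then obtain g where g: "(\<lambda>l. Poly_Mapping.single v (g l)) \<in> C" "\<forall>l. set l \<subseteq> M \<longrightarrow> length l = d \<longrightarrow> f l = cob g l"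
      by (auto simp: single_C)
    show "bnd 0 d (\<lambda>l. Poly_Mapping.single v (f l))" unfolding bnd_def Id_zero_index
      by (rule bexI[OF _ g(1)]) (use g(2) in \<open>auto simp: single_cob\<close>)
  qed
  moreover have "cyc 0 d (\<lambda>l. Poly_Mapping.single v (f l)) \<longleftrightarrow>
      (\<forall>l. set l \<subseteq> M \<longrightarrow> f l \<noteq> 0 \<longrightarrow> v \<in> loc (set l)) \<and>
      (\<forall>l. set l \<subseteq> M \<longrightarrow> length l = Suc d \<longrightarrow> cob f l = 0)" for f
  proof -
    have "Poly_Mapping.single v a = 0 \<longleftrightarrow> a = 0" for a :: 'k
      using lookup_single_eq[of v a] by (metis lookup_zero single_zero)
    then show ?thesis by (simp add: cyc_def single_C single_cob Id_zero_index)
  qed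
  ultimately show ?thesis unfolding coh_def by (simp only: conj_assoc)
qed

text \<open>The monomials that do not kill the class have bounded degree, by
  \<open>cyc_deg_torsion\<close>; multiplying by one of greatest degree leads into the socle. So the
  socle is essential.\<close>

lemma coh_climb:
  assumes "cyc 0 d (\<lambda>l. Poly_Mapping.single v (f l))" "\<not> bnd 0 d (\<lambda>l. Poly_Mapping.single v (f l))"
  obtains s where "s \<in> gen M" "cyc 0 d (\<lambda>l. Poly_Mapping.single (s + v) (f l))"
    "\<not> bnd 0 d (\<lambda>l. Poly_Mapping.single (s + v) (f l))"
    "\<And>x. x \<in> M \<Longrightarrow> bnd 0 d (\<lambda>l. mon x * Poly_Mapping.single (s + v) (f l))"
proof -
  let ?P = "\<lambda>s. s \<in> gen M \<and> \<not> bnd 0 d (\<lambda>l. Poly_Mapping.single (s + v) (f l))"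
  obtain N where N: "\<And>s. s \<in> gen M \<Longrightarrow> deg s > N \<Longrightarrow> bnd 0 d (\<lambda>l. Poly_Mapping.single (s + v) (f l))"
    using cyc_deg_torsion[OF assms(1)] by (auto simp: mult_single)
  have "?P 0" using assms(2) by (auto intro: gen_0)
  moreover have "\<forall>s. ?P s \<longrightarrow> nat (deg s) < nat (N + 1) + 1"
  proof (intro allI impI)
    fix s assume "?P s"
    then have "\<not> deg s > N" using N by blast
    then show "nat (deg s) < nat (N + 1) + 1" by linarith
  qed
  ultimately have "\<exists>s. ?P s \<and> (\<forall>s'. ?P s' \<longrightarrow> nat (deg s') \<le> nat (deg s))"
    by (rule ex_has_greatest_nat)
  then obtain s where s: "?P s" "\<And>s'. ?P s' \<Longrightarrow> nat (deg s') \<le> nat (deg s)" by blast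
  have "cyc 0 d (\<lambda>l. mon s * Poly_Mapping.single v (f l))" by (rule cyc_mult[OF Loc_mon assms(1)]) (use s in blast)
  moreover have "bnd 0 d (\<lambda>l. mon x * Poly_Mapping.single (s + v) (f l))" if x: "x \<in> M" for x
  proof (rule ccontr)
    assume "\<not> ?thesis"
    then have "?P (x + s)" using s(1) x by (auto simp: mult_single add.assoc intro: gen_step)
    then show False using s(2)[of "x + s"] deg_nonneg[of s] s(1) by (simp add: deg_add deg_M x)
  qed
  ultimately show ?thesis using s(1) that[of s] by (simp add: mult_single)
qed

text \<open>A linear relation between socle classes of distinct multidegrees could be split into
  components, and one of the classes would vanish.\<close>

lemma coh_socle_unique:
  assumes "cyc 0 d (\<lambda>l. Poly_Mapping.single v (f l))" "\<not> bnd 0 d (\<lambda>l. Poly_Mapping.single v (f l))"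
    "\<And>x. x \<in> M \<Longrightarrow> bnd 0 d (\<lambda>l. mon x * Poly_Mapping.single v (f l))"
    "cyc 0 d (\<lambda>l. Poly_Mapping.single w (g l))" "\<not> bnd 0 d (\<lambda>l. Poly_Mapping.single w (g l))"
    "\<And>x. x \<in> M \<Longrightarrow> bnd 0 d (\<lambda>l. mon x * Poly_Mapping.single w (g l))"
  shows "v = w"
proof (rule ccontr)
  assume vw: "v \<noteq> w"
  obtain \<alpha> \<beta> where ab: "\<alpha> \<noteq> 0 \<or> \<beta> \<noteq> 0" and b: "bnd 0 d (\<lambda>l. Poly_Mapping.single 0 \<alpha> * Poly_Mapping.single v (f l) +
      Poly_Mapping.single 0 \<beta> * Poly_Mapping.single w (g l))"
    using socle_cohomology[of d, simplified, OF assms(1,4,3,6)] by blast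
  have scale: "bnd 0 d (\<lambda>l. Poly_Mapping.single u (h l))" if "bnd 0 d (\<lambda>l. Poly_Mapping.single u (\<gamma> * h l))" "\<gamma> \<noteq> 0" for u h \<gamma>
    using bnd_mult[OF Loc_mon[OF gen_0, of "inverse \<gamma>"] that(1)] that(2)
    by (simp add: mult_single mult.assoc[symmetric])
  show False
  proof (cases "\<alpha> = 0")
    case False
    have "bnd 0 d (\<lambda>l. Poly_Mapping.single v (\<alpha> * f l))"
      using bnd_component[OF b, of v] vw by (simp add: mult_single lookup_add lookup_single)
    then show False using scale False assms(2) by blast
  next
    case True
    have "bnd 0 d (\<lambda>l. Poly_Mapping.single w (\<beta> * g l))"
      using bnd_component[OF b, of w] vw by (simp add: mult_single lookup_add lookup_single)
    then show False using scale True ab assms(5) by blast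
  qed
qed

text \<open>-p is the multidegree of the socle. Every class climbs to it, which gives one direction;
  for the other, no monomial annihilates top cohomology by \<open>annihilator_cohomology\<close>, so
  every degree that lies below -p by an element of S is occupied.\<close>

theorem coh_iff_gen: "\<exists>p. \<forall>v. coh v \<longleftrightarrow> - p - v \<in> gen M"
proof -
  \<comment> \<open>The monomial of \<open>s0\<close> is not in I_0 = 0, so some class is not killed
    by it, and one component \<open>v\<close> of that class survives. Climbing from s0 + v by
    \<open>s\<close> ends in the socle; the class in degree s + v is nonzero because its multiple by
    \<open>s0\<close> is.\<close>
  have above: "\<exists>v f s. s \<in> gen M \<and> cyc 0 d (\<lambda>l. Poly_Mapping.single v (f l)) \<and> coh (s + v) \<and>
      \<not> bnd 0 d (\<lambda>l. Poly_Mapping.single (s + s0 + v) (f l)) \<and>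
      cyc 0 d (\<lambda>l. Poly_Mapping.single (s + s0 + v) (f l)) \<and>
      (\<forall>x\<in>M. bnd 0 d (\<lambda>l. mon x * Poly_Mapping.single (s + s0 + v) (f l)))"
    if s0: "s0 \<in> gen M" for s0
  proof -
    have "(mon s0 :: 'g \<Rightarrow>\<^sub>0 'k) \<notin> Id (d - d) {}" 
      by (simp add: Id_zero_index) (metis lookup_single_eq lookup_zero zero_neq_one)
    then obtain c where c: "cyc 0 d c" "\<not> bnd 0 d (\<lambda>l. mon s0 * c l)"
      using annihilator_cohomology[of d "mon s0"] Loc_mon[OF s0, of 1 "{}"] by auto
    let ?V = "\<Union>l\<in>{l. set l \<subseteq> M \<and> length l = d}. Poly_Mapping.keys (c l)"
    have V: "finite ?V" using finite_lists_length_eq[OF finite_M] by auto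
    have "\<exists>v. \<not> bnd 0 d (\<lambda>l. mon s0 * Poly_Mapping.single v (Poly_Mapping.lookup (c l) v))"
    proof (rule ccontr)
      assume "\<not> ?thesis"
      then have "bnd 0 d (\<lambda>l. \<Sum>v\<in>?V. mon s0 * Poly_Mapping.single v (Poly_Mapping.lookup (c l) v))"
        by (intro bnd_sum) blast
      then have "bnd 0 d (\<lambda>l. mon s0 * c l)"
      proof (rule bnd_cong[rotated])
        fix l assume l: "set l \<subseteq> M" "length l = d"
        have "c l = (\<Sum>v\<in>?V. Poly_Mapping.single v (Poly_Mapping.lookup (c l) v))"
          by (subst poly_mapping_expand, rule sum.mono_neutral_left[OF V]) (use l in \<open>auto simp: in_keys_iff\<close>)
        then show "mon s0 * c l - (\<Sum>v\<in>?V. mon s0 * Poly_Mapping.single v (Poly_Mapping.lookup (c l) v)) \<in> Id 0 (set l)"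
          by (simp add: Id_zero_index sum_distrib_left[symmetric])
      qed
      then show False using c by blast
    qed
    then obtain v where v: "\<not> bnd 0 d (\<lambda>l. mon s0 * Poly_Mapping.single v (Poly_Mapping.lookup (c l) v))" by blast
    define f where "f = (\<lambda>l. Poly_Mapping.lookup (c l) v)"
    have f: "cyc 0 d (\<lambda>l. Poly_Mapping.single v (f l))" unfolding f_def by (rule cyc_component[OF c(1)])
    have f': "cyc 0 d (\<lambda>l. Poly_Mapping.single (s0 + v) (f l))"
      using cyc_mult[OF Loc_mon[OF s0, of 1] f] by (simp add: mult_single)
    have "\<not> bnd 0 d (\<lambda>l. Poly_Mapping.single (s0 + v) (f l))" using v by (simp add: f_def mult_single)
    then obtain s where s: "s \<in> gen M" "cyc 0 d (\<lambda>l. Poly_Mapping.single (s + (s0 + v)) (f l))"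
      "\<not> bnd 0 d (\<lambda>l. Poly_Mapping.single (s + (s0 + v)) (f l))"
      "\<And>x. x \<in> M \<Longrightarrow> bnd 0 d (\<lambda>l. mon x * Poly_Mapping.single (s + (s0 + v)) (f l))"
      by (rule coh_climb[OF f']) blast
    have "\<not> bnd 0 d (\<lambda>l. Poly_Mapping.single (s + v) (f l))"
      using bnd_mult[OF Loc_mon[OF s0, of 1 "{}"], of 0 d "\<lambda>l. Poly_Mapping.single (s + v) (f l)"] s(3)
      by (auto simp: mult_single algebra_simps)
    moreover have "cyc 0 d (\<lambda>l. Poly_Mapping.single (s + v) (f l))"
      using cyc_mult[OF Loc_mon[OF s(1), of 1] f] by (simp add: mult_single)
    ultimately have "coh (s + v)" unfolding coh_iff by blast
    with s f show ?thesis
      by (intro exI[of _ v] exI[of _ f] exI[of _ s]) (simp add: add.assoc)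
  qed
  obtain v0 f0 s0 where 0: "\<not> bnd 0 d (\<lambda>l. Poly_Mapping.single (s0 + 0 + v0) (f0 l))"
      "cyc 0 d (\<lambda>l. Poly_Mapping.single (s0 + 0 + v0) (f0 l))"
      "\<And>x. x \<in> M \<Longrightarrow> bnd 0 d (\<lambda>l. mon x * Poly_Mapping.single (s0 + 0 + v0) (f0 l))"
    using above[OF gen_0] by blast
  define p where "p = - (s0 + 0 + v0)"
  have "coh v \<longleftrightarrow> - p - v \<in> gen M" for v
  proof
    assume "coh v"
    then obtain f where "cyc 0 d (\<lambda>l. Poly_Mapping.single v (f l))" "\<not> bnd 0 d (\<lambda>l. Poly_Mapping.single v (f l))"
      by (auto simp: coh_iff)
    then obtain s where s: "s \<in> gen M" "cyc 0 d (\<lambda>l. Poly_Mapping.single (s + v) (f l))"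
      "\<not> bnd 0 d (\<lambda>l. Poly_Mapping.single (s + v) (f l))"
      "\<And>x. x \<in> M \<Longrightarrow> bnd 0 d (\<lambda>l. mon x * Poly_Mapping.single (s + v) (f l))"
      by (rule coh_climb) blast
    have "s + v = s0 + 0 + v0" by (rule coh_socle_unique[OF s(2,3,4) 0(2,1,3)])
    then have "- p - v = s" by (simp add: p_def algebra_simps)
    then show "- p - v \<in> gen M" using s(1) by simp
  next
    assume "- p - v \<in> gen M"
    from above[OF this] obtain w f s where *: "coh (s + w)" 
      "\<not> bnd 0 d (\<lambda>l. Poly_Mapping.single (s + (- p - v) + w) (f l))"
      "cyc 0 d (\<lambda>l. Poly_Mapping.single (s + (- p - v) + w) (f l))"
      "\<And>x. x \<in> M \<Longrightarrow> bnd 0 d (\<lambda>l. mon x * Poly_Mapping.single (s + (- p - v) + w) (f l))" by blast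
    have "s + (- p - v) + w = s0 + 0 + v0" by (rule coh_socle_unique[OF *(3,2,4) 0(2,1,3)])
    then have "s + w = v" by (simp add: p_def algebra_simps)
    then show "coh v" using *(1) by simp
  qed
  then show ?thesis by blast
qed

end

section \<open>A corner of index two\<close>

text \<open>The localisation of the monoid at \<open>u\<close> is the product of a group and the monoid of all
  \<open>(a, b, c)\<close> with nonnegative entries and even sum, that is, the second Veronese monoid of rank
  three. The ring type of \<open>'g\<close> only serves to write multiples as \<open>of_nat n * v\<close>.\<close>

locale veronese_corner = graded_monoid M deg
  for M :: "'g::comm_ring_1 set" and deg :: "'g \<Rightarrow> int" +
  fixes lv :: "nat \<Rightarrow> 'g \<Rightarrow> int" and sq mx :: "nat \<Rightarrow> 'g" and u :: 'g
  assumes lv_add: "lv c (a + b) = lv c a + lv c b"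
    and lv_M: "c < 3 \<Longrightarrow> x \<in> M \<Longrightarrow> lv c x \<ge> 0"
    and lv_even: "even (lv 0 v + lv 1 v + lv 2 v)"
    and sq_gen: "c < 3 \<Longrightarrow> sq c \<in> gen M"
    and mx_gen: "c < 3 \<Longrightarrow> mx c \<in> gen M"
    and lv_sq: "c < 3 \<Longrightarrow> e < 3 \<Longrightarrow> lv c (sq e) = (if c = e then 2 else 0)"
    and lv_mx: "c < 3 \<Longrightarrow> e < 3 \<Longrightarrow> lv c (mx e) = (if c = e then 0 else 1)"
    and u_gen: "u \<in> gen M"
    and lv_u: "c < 3 \<Longrightarrow> lv c u = 0"
    and localisation: "(\<And>c. c < 3 \<Longrightarrow> lv c v \<ge> 0) \<Longrightarrow> \<exists>k. v + of_nat k * u \<in> gen M"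
begin

lemma lv_0: "lv c 0 = 0"
  using lv_add[of c 0 0] by simp

lemma lv_uminus: "lv c (- a) = - lv c a"
  using lv_add[of c a "- a"] by (simp add: lv_0)

lemma lv_diff: "lv c (a - b) = lv c a - lv c b"
  using lv_add[of c a "- b"] by (simp add: lv_uminus)

lemma lv_mult: "lv c (of_nat n * a) = int n * lv c a"
  by (induction n) (auto simp: lv_0 lv_add distrib_right)

lemmas lv_simps = lv_0 lv_add lv_uminus lv_diff lv_mult

lemma lv_nonneg: "c < 3 \<Longrightarrow> s \<in> gen M \<Longrightarrow> lv c s \<ge> 0"
  by (rule additive_gen_nonneg[of "lv c" M]) (auto simp: lv_add lv_M)

lemma add_u: "v + of_nat k * u \<in> gen M \<Longrightarrow> k \<le> k' \<Longrightarrow> v + of_nat k' * u \<in> gen M"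
proof -
  assume v: "v + of_nat k * u \<in> gen M" and "k \<le> k'"
  have "(v + of_nat k * u) + of_nat (k' - k) * u \<in> gen M"
    by (rule gen_add[OF v gen_of_nat_mult[OF u_gen]])
  also have "(v + of_nat k * u) + of_nat (k' - k) * u = v + of_nat (k + (k' - k)) * u"
    unfolding of_nat_add distrib_right by (rule add.assoc)
  finally show ?thesis using \<open>k \<le> k'\<close> by simp
qed

lemma split_generator:
  assumes "s \<in> gen M" "lv c s \<ge> 1" "c < 3"
  shows "\<exists>x\<in>M. \<exists>s'\<in>gen M. s = x + s' \<and> lv c x \<ge> 1"
  using assms(1,2)
proof (induction rule: gen.induct)
  case gen_0
  then show ?case by (simp add: lv_0)
next
  case (gen_step x s)
  show ?case
  proof (cases "lv c x \<ge> 1")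
    case True
    then show ?thesis using gen_step.hyps by blast
  next
    case False
    then have "lv c x = 0" using lv_M[OF assms(3) gen_step.hyps(1)] by linarith
    then obtain y s' where "y \<in> M" "s' \<in> gen M" "s = y + s'" "lv c y \<ge> 1"
      using gen_step by (auto simp: lv_add)
    then have "y \<in> M \<and> x + s' \<in> gen M \<and> x + s = y + (x + s') \<and> lv c y \<ge> 1"
      using gen_step.hyps(1) by (auto intro: gen.gen_step)
    then show ?thesis by blast
  qed
qed

text \<open>The value of \<open>lv c\<close> reaches two after at most two generators, so finitely many sums of
  generators have to be treated.\<close>

lemma subtract_sq:
  assumes c: "c < 3"
  shows "\<exists>k. \<forall>s\<in>gen M. lv c s \<ge> 2 \<longrightarrow> s - sq c + of_nat k * u \<in> gen M"
proof -
  let ?I = "insert 0 M \<times> insert 0 M"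
  have "\<exists>k. \<forall>p\<in>?I. lv c (fst p + snd p) \<ge> 2 \<longrightarrow> fst p + snd p - sq c + of_nat k * u \<in> gen M"
  proof (rule eventually_uniform)
    show "finite ?I" using finite_M by simp
    fix p assume p: "p \<in> ?I"
    have "lv e (fst p + snd p) \<ge> 0" if "e < 3" for e
    proof -
      have "lv e x \<ge> 0" if "x \<in> insert 0 M" for x
        using lv_M[OF \<open>e < 3\<close>, of x] that by (cases "x = 0") (simp_all add: lv_0)
      moreover have "fst p \<in> insert 0 M" "snd p \<in> insert 0 M" using p by (simp_all only: mem_Times_iff)
      ultimately show ?thesis unfolding lv_add by (intro add_nonneg_nonneg)
    qed
    then have "\<exists>k. fst p + snd p - sq c + of_nat k * u \<in> gen M" if "lv c (fst p + snd p) \<ge> 2"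
      using that c by (intro localisation) (auto simp: lv_diff lv_sq)
    then show "\<exists>k. lv c (fst p + snd p) \<ge> 2 \<longrightarrow> fst p + snd p - sq c + of_nat k * u \<in> gen M" by blast
  next
    fix p k k'
    assume "lv c (fst p + snd p) \<ge> 2 \<longrightarrow> fst p + snd p - sq c + of_nat k * u \<in> gen M" "k \<le> k'"
    then show "lv c (fst p + snd p) \<ge> 2 \<longrightarrow> fst p + snd p - sq c + of_nat k' * u \<in> gen M"
      using add_u[of "fst p + snd p - sq c" k k'] by blast
  qed
  then obtain k where k0: "\<forall>p\<in>?I. lv c (fst p + snd p) \<ge> 2 \<longrightarrow> fst p + snd p - sq c + of_nat k * u \<in> gen M" ..
  have k: "x + y - sq c + of_nat k * u \<in> gen M"
    if "x \<in> insert 0 M" "y \<in> insert 0 M" "lv c (x + y) \<ge> 2" for x y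
    using bspec[OF k0, of "(x, y)", OF SigmaI[OF that(1,2)]] that(3) by (simp only: fst_conv snd_conv simp_thms)
  have "s - sq c + of_nat k * u \<in> gen M" if s: "s \<in> gen M" "lv c s \<ge> 2" for s
  proof -
    obtain x s' where x: "x \<in> M" "s' \<in> gen M" "s = x + s'" "lv c x \<ge> 1"
      using split_generator[OF s(1) _ c] s(2) by auto
    obtain y t where y: "y \<in> insert 0 M" "t \<in> gen M" "s' = y + t" "lv c (x + y) \<ge> 2"
    proof (cases "lv c x \<ge> 2")
      case True
      then show ?thesis using that[of 0 s'] x by simp
    next
      case False
      then have "lv c s' \<ge> 1" using x s(2) by (auto simp: lv_add)
      then obtain y t where "y \<in> M" "t \<in> gen M" "s' = y + t" "lv c y \<ge> 1"
        using split_generator[OF x(2) _ c] by blast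
      then show ?thesis using that[of y t] x by (auto simp: lv_add)
    qed
    have "(x + y - sq c + of_nat k * u) + t \<in> gen M" using k[of x y] x y by (intro gen_add[OF _ y(2)]) auto
    then show ?thesis by (simp add: x(3) y(3) algebra_simps)
  qed
  then show ?thesis by blast
qed

text \<open>\<open>localisation\<close> supplies a \<open>k\<close> for each element separately;
  here one \<open>k\<close> serves all differences s - y at once. This uniformity lets the
  localisations containing y - k u stabilise for large \<open>k\<close>.\<close>

definition absorbed :: "'g \<Rightarrow> bool" where
  "absorbed y \<longleftrightarrow> (\<exists>k. \<forall>s\<in>gen M. (\<forall>c<3. lv c s \<ge> lv c y) \<longrightarrow> s - y + of_nat k * u \<in> gen M)"

lemma absorbed_nonpos:
  assumes "\<And>c. c < 3 \<Longrightarrow> lv c y \<le> 0"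
  shows "absorbed y"
proof -
  obtain k where k: "- y + of_nat k * u \<in> gen M"
    using localisation[of "- y"] assms by (auto simp: lv_uminus)
  have "s - y + of_nat k * u \<in> gen M" if "s \<in> gen M" for s
    using gen_add[OF that k] by (simp add: algebra_simps)
  then show ?thesis unfolding absorbed_def by blast
qed

text \<open>Squares are peeled off one at a time with \<open>subtract_sq\<close>. The bound on
  \<open>lv c y\<close> ensures that \<open>lv c s\<close> is at least 2 whenever a square has to be
  removed.\<close>

lemma absorbed_add_sq:
  assumes c: "c < 3" and y: "absorbed y" "lv c y \<ge> 0"
  shows "absorbed (y + of_nat n * sq c)"
proof (induction n)
  case 0
  show ?case using y by simp
next
  case (Suc n)
  let ?y = "y + of_nat n * sq c"
  obtain k where k: "\<And>s. s \<in> gen M \<Longrightarrow> (\<And>e. e < 3 \<Longrightarrow> lv e s \<ge> lv e ?y) \<Longrightarrow> s - ?y + of_nat k * u \<in> gen M"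
    using Suc unfolding absorbed_def by blast
  obtain k' where k': "\<And>s. s \<in> gen M \<Longrightarrow> lv c s \<ge> 2 \<Longrightarrow> s - sq c + of_nat k' * u \<in> gen M"
    using subtract_sq[OF c] by blast
  have "s - (y + of_nat (Suc n) * sq c) + of_nat (k + k') * u \<in> gen M"
    if s: "s \<in> gen M" "\<And>e. e < 3 \<Longrightarrow> lv e s \<ge> lv e (y + of_nat (Suc n) * sq c)" for s
  proof -
    have s': "lv e s \<ge> lv e ?y + lv e (sq c)" if "e < 3" for e
      using s(2)[OF that] by (simp add: lv_simps distrib_right)
    have "lv c ?y \<ge> 0" using y(2) c by (simp add: lv_simps lv_sq)
    then have "lv c s \<ge> 2" using s'[OF c] c by (simp add: lv_sq)
    then have t: "s - sq c + of_nat k' * u \<in> gen M" using k' s(1) by blast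
    have "(s - sq c + of_nat k' * u) - ?y + of_nat k * u \<in> gen M"
    proof (rule k[OF t])
      fix e :: nat assume "e < 3"
      then show "lv e ?y \<le> lv e (s - sq c + of_nat k' * u)" using s'[of e] by (simp add: lv_simps lv_u)
    qed
    then show ?thesis by (simp add: algebra_simps)
  qed
  then show ?case unfolding absorbed_def by blast
qed

text \<open>First condition: inverting \<sigma> also inverts \<open>u\<close>. Second: \<sigma> can
  raise every negative coordinate of \<open>y\<close>. Thus \<open>y\<close> enters only through the
  signs of its coordinates.\<close>

definition sign_pattern :: "'g \<Rightarrow> 'g set \<Rightarrow> bool" where
  "sign_pattern y \<sigma> \<longleftrightarrow> (\<exists>\<tau>\<in>gen \<sigma>. \<tau> - u \<in> gen M) \<and> (\<forall>c<3. lv c y \<ge> 0 \<or> (\<exists>\<tau>\<in>gen \<sigma>. lv c \<tau> > 0))"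

text \<open>A large negative multiple of \<open>u\<close> can only be compensated by a denominator
  that contains \<open>u\<close>; once \<open>u\<close> is a unit, only the three inequalities of
  \<open>localisation\<close> are left.\<close>

lemma loc_sign_pattern:
  assumes "absorbed y"
  shows "\<exists>K. \<forall>k\<ge>K. \<forall>\<sigma>\<subseteq>M. y - of_nat k * u \<in> loc \<sigma> \<longleftrightarrow> sign_pattern y \<sigma>"
proof -
  obtain K where K: "\<And>s. s \<in> gen M \<Longrightarrow> (\<And>c. c < 3 \<Longrightarrow> lv c s \<ge> lv c y) \<Longrightarrow> s - y + of_nat K * u \<in> gen M"
    using assms unfolding absorbed_def by blast
  \<comment> \<open>\<open>Suc K\<close> rather than \<open>K\<close>: after \<open>absorbed\<close>
    has spent \<open>K\<close> copies of \<open>u\<close>, one copy must remain to give \<tau> -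
    u.\<close>
  have "y - of_nat k * u \<in> loc \<sigma> \<longleftrightarrow> sign_pattern y \<sigma>" if k: "k \<ge> Suc K" and \<sigma>: "\<sigma> \<subseteq> M" for k \<sigma>
  proof
    assume "y - of_nat k * u \<in> loc \<sigma>"
    then obtain \<tau> where \<tau>: "\<tau> \<in> gen \<sigma>" "y - of_nat k * u + \<tau> \<in> gen M" by (auto simp: loc_def)
    let ?s = "y - of_nat k * u + \<tau>"
    have \<tau>0: "lv c \<tau> \<ge> 0" if "c < 3" for c using lv_nonneg[OF that] \<tau>(1) gen_mono[OF \<sigma>] by blast
    have s: "lv c ?s = lv c y + lv c \<tau>" if "c < 3" for c by (simp add: lv_simps lv_u that)
    have "?s - y + of_nat K * u \<in> gen M" by (rule K[OF \<tau>(2)]) (use s \<tau>0 in auto)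
    then have "(?s - y) + of_nat (k - 1) * u \<in> gen M" by (rule add_u) (use k in auto)
    moreover obtain k' where "k = Suc k'" using k by (cases k) auto
    ultimately have "\<tau> - u \<in> gen M" by (simp add: algebra_simps)
    moreover have "lv c y \<ge> 0 \<or> lv c \<tau> > 0" if "c < 3" for c
      using s[OF that] lv_nonneg[OF that \<tau>(2)] by linarith
    ultimately show "sign_pattern y \<sigma>" using \<tau>(1) unfolding sign_pattern_def by blast
  next
    assume p: "sign_pattern y \<sigma>"
    then obtain \<tau>1 where \<tau>1: "\<tau>1 \<in> gen \<sigma>" "\<tau>1 - u \<in> gen M" by (auto simp: sign_pattern_def)
    have "\<forall>c. \<exists>\<tau>\<in>gen \<sigma>. c < 3 \<longrightarrow> lv c y + lv c \<tau> \<ge> 0"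
    proof
      fix c
      show "\<exists>\<tau>\<in>gen \<sigma>. c < 3 \<longrightarrow> lv c y + lv c \<tau> \<ge> 0"
      proof (cases "c < 3 \<and> lv c y < 0")
        case True
        then obtain \<tau> where \<tau>: "\<tau> \<in> gen \<sigma>" "lv c \<tau> > 0" using p by (force simp: sign_pattern_def)
        have "- lv c y * 1 \<le> - lv c y * lv c \<tau>" by (rule mult_left_mono) (use \<tau>(2) True in auto)
        moreover have "int (nat (- lv c y)) = - lv c y" using True by simp
        then have "lv c (of_nat (nat (- lv c y)) * \<tau>) = - lv c y * lv c \<tau>" by (simp only: lv_mult)
        ultimately have "c < 3 \<longrightarrow> lv c y + lv c (of_nat (nat (- lv c y)) * \<tau>) \<ge> 0" by linarith
        then show ?thesis
          using gen_of_nat_mult[OF \<tau>(1), of "nat (- lv c y)"] by (rule bexI)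
      next
        case False
        then have "c < 3 \<longrightarrow> lv c y + lv c 0 \<ge> 0" unfolding lv_0 by linarith
        then show ?thesis using gen_0 by (rule bexI)
      qed
    qed
    then have "\<forall>c. \<exists>\<tau>. \<tau> \<in> gen \<sigma> \<and> (c < 3 \<longrightarrow> lv c y + lv c \<tau> \<ge> 0)"
      unfolding Bex_def .
    from choice[OF this] obtain t where "\<forall>c. t c \<in> gen \<sigma> \<and> (c < 3 \<longrightarrow> lv c y + lv c (t c) \<ge> 0)" ..
    then have t: "\<And>c. t c \<in> gen \<sigma>" "\<And>c. c < 3 \<Longrightarrow> lv c y + lv c (t c) \<ge> 0" by simp_all
    \<comment> \<open>The summand \<open>t c\<close> repairs coordinate \<open>c\<close>, and the
      other summands cannot spoil it since \<open>lv\<close> is nonnegative on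
      \<open>gen M\<close>.\<close>
    define \<tau>2 where "\<tau>2 = t 0 + t 1 + t 2"
    have \<tau>2: "\<tau>2 \<in> gen \<sigma>" unfolding \<tau>2_def by (intro gen_add t)
    have "lv c (t e) \<ge> 0" if "c < 3" for c e using lv_nonneg[OF that subsetD[OF gen_mono[OF \<sigma>] t(1)]] .
    then have "lv c (y + \<tau>2) \<ge> 0" if "c < 3" for c
    proof -
      have "c = 0 \<or> c = 1 \<or> c = 2" using that by auto
      then show ?thesis using t(2)[OF that] \<open>\<And>c e. c < 3 \<Longrightarrow> lv c (t e) \<ge> 0\<close>[OF that, of 0]
        \<open>\<And>c e. c < 3 \<Longrightarrow> lv c (t e) \<ge> 0\<close>[OF that, of 1] \<open>\<And>c e. c < 3 \<Longrightarrow> lv c (t e) \<ge> 0\<close>[OF that, of 2]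
        unfolding \<tau>2_def lv_add by (elim disjE; hypsubst; linarith)
    qed
    then obtain m where m: "y + \<tau>2 + of_nat m * u \<in> gen M" using localisation by blast
    have "(y + \<tau>2 + of_nat m * u) + of_nat (k + m) * (\<tau>1 - u) \<in> gen M"
      by (rule gen_add[OF m gen_of_nat_mult[OF \<tau>1(2)]])
    moreover have "(y + \<tau>2 + of_nat m * u) + of_nat (k + m) * (\<tau>1 - u) =
        (y - of_nat k * u) + (\<tau>2 + of_nat (k + m) * \<tau>1)"
    proof -
      have "(y + \<tau>2 + b * u) + (a + b) * (\<tau>1 - u) = (y - a * u) + (\<tau>2 + (a + b) * \<tau>1)" for a b
        by (simp add: algebra_simps)
      then show ?thesis by (simp only: of_nat_add)
    qed
    ultimately have "(y - of_nat k * u) + (\<tau>2 + of_nat (k + m) * \<tau>1) \<in> gen M" by (simp only:)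
    then show "y - of_nat k * u \<in> loc \<sigma>" unfolding loc_def mem_Collect_eq
      by (rule bexI[of _ "\<tau>2 + of_nat (k + m) * \<tau>1"]) (intro gen_add \<tau>2 gen_of_nat_mult \<tau>1(1))
  qed
  then show ?thesis by (intro exI[of _ "Suc K"] allI impI)
qed

lemma loc_same_pattern:
  assumes "absorbed y" "absorbed y'" "\<And>c. c < 3 \<Longrightarrow> lv c y \<ge> 0 \<longleftrightarrow> lv c y' \<ge> 0"
  shows "\<exists>k. \<forall>\<sigma>\<subseteq>M. y - of_nat k * u \<in> loc \<sigma> \<longleftrightarrow> y' - of_nat k * u \<in> loc \<sigma>"
proof -
  obtain K where K: "\<forall>k\<ge>K. \<forall>\<sigma>\<subseteq>M. y - of_nat k * u \<in> loc \<sigma> \<longleftrightarrow> sign_pattern y \<sigma>"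
    using loc_sign_pattern[OF assms(1)] ..
  obtain K' where K': "\<forall>k\<ge>K'. \<forall>\<sigma>\<subseteq>M. y' - of_nat k * u \<in> loc \<sigma> \<longleftrightarrow> sign_pattern y' \<sigma>"
    using loc_sign_pattern[OF assms(2)] ..
  have "(\<forall>c<3. lv c y \<ge> 0 \<or> P c) \<longleftrightarrow> (\<forall>c<3. lv c y' \<ge> 0 \<or> P c)" for P
  proof -
    have "(c < 3 \<longrightarrow> lv c y \<ge> 0 \<or> P c) \<longleftrightarrow> (c < 3 \<longrightarrow> lv c y' \<ge> 0 \<or> P c)" for c
      using assms(3)[of c] by (cases "c < 3") simp_all
    then show ?thesis by (simp only:)
  qed
  then have eq: "sign_pattern y \<sigma> \<longleftrightarrow> sign_pattern y' \<sigma>" for \<sigma>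
    by (simp only: sign_pattern_def)
  have "y - of_nat (max K K') * u \<in> loc \<sigma> \<longleftrightarrow> sign_pattern y \<sigma>"
    "y' - of_nat (max K K') * u \<in> loc \<sigma> \<longleftrightarrow> sign_pattern y' \<sigma>" if "\<sigma> \<subseteq> M" for \<sigma>
    using K[rule_format, OF max.cobounded1 that] K'[rule_format, OF max.cobounded2 that] by simp_all
  then show ?thesis by (intro exI[of _ "max K K'"] allI impI) (simp only: eq)
qed

text \<open>By \<open>cong\<close>, membership in -p - S may depend only on the localisations
  containing a point, hence far out in direction -u only on signs. If a coordinate of
  \<open>p\<close> is at most 0 or at least 2, two points of equal signs are told apart by -p - S;
  parity excludes the remaining case (1, 1, 1).\<close>

theorem no_canonical_degree:
  assumes cong: "\<And>v w. (\<And>\<sigma>. \<sigma> \<subseteq> M \<Longrightarrow> v \<in> loc \<sigma> \<longleftrightarrow> w \<in> loc \<sigma>) \<Longrightarrow> - p - v \<in> gen M \<longleftrightarrow> - p - w \<in> gen M"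
  shows False
proof (cases "\<exists>c<3. lv c p \<le> 0")
  case True
  then obtain c where c: "c < 3" "lv c p \<le> 0" by blast
  obtain c1 c2 :: nat where cc: "c1 < 3" "c2 < 3" "c1 \<noteq> c" "c2 \<noteq> c" "c1 \<noteq> c2" "\<And>e. e < 3 \<Longrightarrow> e = c \<or> e = c1 \<or> e = c2"
  proof (cases "c = 0")
    case True
    show ?thesis by (rule that[of 1 2]) (use True in auto)
  next
    case False
    show ?thesis by (rule that[of 0 "3 - c"]) (use False c(1) in presburger)+
  qed
  define a where "a = nat (- lv c p)"
  define n where "n = nat (\<bar>lv c1 p\<bar> + \<bar>lv c2 p\<bar> + 1)"
  \<comment> \<open>\<open>mx c1\<close> has coordinate 1 at \<open>c\<close>, so \<open>a\<close>
    copies of it bring -p - s to 0 there; \<open>n\<close> copies of the two squares make the other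
    coordinates of -p - s negative.\<close>
  define s where "s = of_nat a * mx c1 + of_nat n * (sq c1 + sq c2)"
  have s: "s \<in> gen M" unfolding s_def by (intro gen_add gen_of_nat_mult mx_gen sq_gen cc)
  define y where "y = - p - s"
  \<comment> \<open>The a + 1 squares preserve the signs of \<open>y\<close> but bring coordinate
    \<open>c\<close> of -p - y' down to a - 2 (a + 1), which is negative.\<close>
  define y' where "y' = y + of_nat (a + 1) * sq c"
  have y: "lv c y = 0" "lv c1 y < 0" "lv c2 y < 0"
  proof -
    have "lv c y = - lv c p - int a" "lv c1 y = - lv c1 p - 2 * int n" "lv c2 y = - lv c2 p - int a - 2 * int n"
      using c cc(1-5) by (simp_all add: y_def s_def lv_simps lv_sq lv_mx)
    moreover have "int a = - lv c p" "int n = \<bar>lv c1 p\<bar> + \<bar>lv c2 p\<bar> + 1" using c by (simp_all add: a_def n_def)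
    ultimately show "lv c y = 0" "lv c1 y < 0" "lv c2 y < 0" using c(2) by linarith+
  qed
  have y': "lv c y' = 2 * (int a + 1)" "lv c1 y' = lv c1 y" "lv c2 y' = lv c2 y"
    unfolding y'_def lv_add lv_mult using c(1) cc(1-5) y(1) by (simp_all add: lv_sq)
  have "lv e y \<le> 0" if "e < 3" for e
    using cc(6)[OF that] y by (elim disjE) simp_all
  then have "absorbed y" by (rule absorbed_nonpos)
  moreover from this have "absorbed y'"
    unfolding y'_def by (rule absorbed_add_sq[OF c(1)]) (simp add: y)
  moreover have "lv e y \<ge> 0 \<longleftrightarrow> lv e y' \<ge> 0" if "e < 3" for e
    using cc(6)[OF that] y(1) y' by (elim disjE) simp_all
  ultimately have "\<exists>k. \<forall>\<sigma>\<subseteq>M. y - of_nat k * u \<in> loc \<sigma> \<longleftrightarrow> y' - of_nat k * u \<in> loc \<sigma>"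
    by (rule loc_same_pattern)
  then obtain k where k: "\<forall>\<sigma>\<subseteq>M. y - of_nat k * u \<in> loc \<sigma> \<longleftrightarrow> y' - of_nat k * u \<in> loc \<sigma>" ..
  have "- p - (y - of_nat k * u) \<in> gen M \<longleftrightarrow> - p - (y' - of_nat k * u) \<in> gen M"
    by (rule cong, rule k[rule_format])
  moreover have "- p - (y - of_nat k * u) = s + of_nat k * u" by (simp add: y_def)
  then have "- p - (y - of_nat k * u) \<in> gen M" by (simp only: gen_add[OF s gen_of_nat_mult[OF u_gen]])
  ultimately have "- p - (y' - of_nat k * u) \<in> gen M" by (rule iffD1)
  then have "lv c (- p - (y' - of_nat k * u)) \<ge> 0" by (rule lv_nonneg[OF c(1)])
  then have "0 \<le> - lv c p - lv c y'" unfolding lv_diff lv_uminus lv_mult by (simp add: lv_u c)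
  moreover have "int a = - lv c p" using c by (simp add: a_def)
  ultimately show False using y'(1) c(2) by simp
next
  case False
  have "\<exists>c<3. lv c p \<ge> 2"
  proof (rule ccontr)
    assume *: "\<not> ?thesis"
    have "lv c p = 1" if "c < 3" for c
    proof -
      have "\<not> lv c p \<ge> 2" "\<not> lv c p \<le> 0" using * False that by blast+
      then show ?thesis by linarith
    qed
    from this[of 0] this[of 1] this[of 2] show False using lv_even[of p] by simp
  qed
  then obtain c where c: "c < 3" "lv c p \<ge> 2" by blast
  obtain c1 :: nat where c1: "c1 < 3" "c1 \<noteq> c"
    by (cases "c = 0") (rule that[of 1], simp, simp, rule that[of 0], simp_all)
  \<comment> \<open>Coordinate \<open>c\<close> rises by one from at most -2, and no other
    coordinate rises, so all stay negative; yet -p - y has the coordinate -1 at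
    \<open>c\<close>.\<close>
  define y where "y = - p + mx c1 - mx c"
  have p1: "lv e p \<ge> 1" if "e < 3" for e
  proof -
    have "\<not> lv e p \<le> 0" using False that by blast
    then show ?thesis by linarith
  qed
  have neg: "lv e (- p) < 0" "lv e y < 0" if "e < 3" for e
  proof -
    have "lv e y \<le> - lv e p + (if e = c then 1 else 0)"
      unfolding y_def lv_add lv_diff lv_uminus using c c1 that by (simp add: lv_mx)
    then show "lv e (- p) < 0" "lv e y < 0" using p1[OF that] c(2) unfolding lv_uminus by (auto split: if_splits)
  qed
  have "absorbed (- p)" "absorbed y" by (rule absorbed_nonpos, rule less_imp_le, erule neg)+
  moreover have "lv e (- p) \<ge> 0 \<longleftrightarrow> lv e y \<ge> 0" if "e < 3" for e using neg[OF that] by linarith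
  ultimately have "\<exists>k. \<forall>\<sigma>\<subseteq>M. - p - of_nat k * u \<in> loc \<sigma> \<longleftrightarrow> y - of_nat k * u \<in> loc \<sigma>"
    by (rule loc_same_pattern)
  then obtain k where k: "\<forall>\<sigma>\<subseteq>M. - p - of_nat k * u \<in> loc \<sigma> \<longleftrightarrow> y - of_nat k * u \<in> loc \<sigma>" ..
  have "- p - (- p - of_nat k * u) \<in> gen M \<longleftrightarrow> - p - (y - of_nat k * u) \<in> gen M"
    by (rule cong, rule k[rule_format])
  moreover have "- p - (- p - of_nat k * u) \<in> gen M" using u_gen by (simp add: gen_of_nat_mult)
  ultimately have "- p - (y - of_nat k * u) \<in> gen M" by (rule iffD1)
  then have "lv c (- p - (y - of_nat k * u)) \<ge> 0" by (rule lv_nonneg[OF c(1)])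
  then have "0 \<le> - lv c p - lv c y" unfolding lv_diff lv_uminus lv_mult by (simp add: lv_u c)
  then show False using c c1 by (simp add: y_def lv_simps lv_mx)
qed

end

section \<open>The Gorenstein property of a graded subring\<close>

definition span_ideal :: "'a::comm_ring_1 set \<Rightarrow> 'a list \<Rightarrow> 'a set" where
  "span_ideal A ts = {\<Sum>m<length ts. r m * ts ! m | r. \<forall>m. r m \<in> A}"

text \<open>\<open>gorenstein_graded_algebra\<close> in terms of elements instead of cosets, a form
  that is easily carried along isomorphisms. Properness of the ideal is contained in the socle
  generator \<open>u\<close> lying outside it; \<open>zip\<close> truncates just as
  \<open>combine\<close> does, so missing coefficients count as zero.\<close>

definition gorenstein_sop :: "'a::comm_ring_1 set \<Rightarrow> 'a set \<Rightarrow> (nat \<Rightarrow> 'a set) \<Rightarrow> 'a list \<Rightarrow> bool" where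
  "gorenstein_sop A K G ts \<longleftrightarrow>
    (\<forall>t\<in>set ts. \<exists>n>0. t \<in> G n) \<and>
    (\<forall>i<length ts. \<forall>a\<in>A. ts ! i * a \<in> span_ideal A (take i ts) \<longrightarrow> a \<in> span_ideal A (take i ts)) \<and>
    (\<exists>us. set us \<subseteq> A \<and> (\<forall>a\<in>A. \<exists>cs. set cs \<subseteq> K \<and>
      a - (\<Sum>(c, u)\<leftarrow>zip cs us. c * u) \<in> span_ideal A ts)) \<and>
    (\<exists>u\<in>A. u \<notin> span_ideal A ts \<and> (\<forall>n>0. \<forall>r\<in>G n. r * u \<in> span_ideal A ts) \<and>
      (\<forall>a\<in>A. (\<forall>n>0. \<forall>r\<in>G n. r * a \<in> span_ideal A ts) \<longrightarrow> (\<exists>c\<in>K. a - c * u \<in> span_ideal A ts)))"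

locale graded_subring =
  fixes A K :: "'a::comm_ring_1 set" and G :: "nat \<Rightarrow> 'a set"
  assumes A_0: "0 \<in> A" and A_1: "1 \<in> A" and A_add: "a \<in> A \<Longrightarrow> b \<in> A \<Longrightarrow> a + b \<in> A"
    and A_mult: "a \<in> A \<Longrightarrow> b \<in> A \<Longrightarrow> a * b \<in> A" and A_uminus: "a \<in> A \<Longrightarrow> - a \<in> A"
    and K_A: "K \<subseteq> A" and K_1: "1 \<in> K" and K_add: "a \<in> K \<Longrightarrow> b \<in> K \<Longrightarrow> a + b \<in> K"
    and K_mult: "a \<in> K \<Longrightarrow> b \<in> K \<Longrightarrow> a * b \<in> K" and K_uminus: "a \<in> K \<Longrightarrow> - a \<in> K"
    and K_inverse: "c \<in> K \<Longrightarrow> c \<noteq> 0 \<Longrightarrow> \<exists>e\<in>K. c * e = 1"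
    and G_A: "G n \<subseteq> A"
begin

abbreviation R :: "'a ring" where "R \<equiv> ring_of_type_algebra\<lparr>carrier := A\<rparr>"

lemma R_simps: "carrier R = A" "a \<otimes>\<^bsub>R\<^esub> b = a * b" "a \<oplus>\<^bsub>R\<^esub> b = a + b" "\<one>\<^bsub>R\<^esub> = 1" "\<zero>\<^bsub>R\<^esub> = 0"
    "(a :: 'a) \<otimes>\<^bsub>ring_of_type_algebra\<^esub> b = a * b" "(a :: 'a) \<oplus>\<^bsub>ring_of_type_algebra\<^esub> b = a + b"
    "\<one>\<^bsub>ring_of_type_algebra\<^esub> = (1 :: 'a)" "\<zero>\<^bsub>ring_of_type_algebra\<^esub> = (0 :: 'a)"
  by (simp_all add: ring_of_type_algebra_def)

lemma cring_R: "cring R"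
proof (rule cringI)
  show "abelian_group R"
    by (rule abelian_groupI) (auto simp: R_simps A_add A_0 add.assoc add.commute intro!: bexI[of _ "- x" for x] A_uminus)
  show "comm_monoid R"
    by (rule comm_monoidI) (auto simp: R_simps A_mult A_1 mult.assoc mult.commute)
qed (auto simp: R_simps distrib_right)

sublocale R: cring R by (rule cring_R)

lemma R_uminus: "a \<in> A \<Longrightarrow> \<ominus>\<^bsub>R\<^esub> a = - a"
  by (rule R.minus_equality) (auto simp: R_simps A_uminus)

lemma R_minus: "a \<in> A \<Longrightarrow> b \<in> A \<Longrightarrow> a \<ominus>\<^bsub>R\<^esub> b = a - b"
  by (simp add: a_minus_def R_uminus R_simps)

lemma span_idealI: "f = (\<Sum>m<length ts. r m * ts ! m) \<Longrightarrow> (\<And>m. r m \<in> A) \<Longrightarrow> f \<in> span_ideal A ts"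
  by (auto simp: span_ideal_def)

lemma span_ideal_A: "set ts \<subseteq> A \<Longrightarrow> span_ideal A ts \<subseteq> A"
proof
  fix f assume ts: "set ts \<subseteq> A" and "f \<in> span_ideal A ts"
  then obtain r where r: "f = (\<Sum>m<length ts. r m * ts ! m)" "\<And>m. r m \<in> A" by (auto simp: span_ideal_def)
  have "(\<Sum>m<n. r m * ts ! m) \<in> A" if "n \<le> length ts" for n
    using that by (induction n) (use r(2) ts in \<open>auto intro!: A_0 A_add A_mult simp: subset_iff\<close>)
  then show "f \<in> A" by (simp add: r(1))
qed

lemma span_ideal_ideal: "set ts \<subseteq> A \<Longrightarrow> ideal (span_ideal A ts) R"
proof (rule idealI)
  assume ts: "set ts \<subseteq> A"
  show "ring R" by (rule R.ring_axioms)
  show "subgroup (span_ideal A ts) (add_monoid R)"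
  proof (rule R.add.subgroupI)
    show "span_ideal A ts \<subseteq> carrier R" using span_ideal_A[OF ts] by (simp add: R_simps)
    have "0 \<in> span_ideal A ts" by (rule span_idealI[where r = "\<lambda>_. 0"]) (auto intro: A_0)
    then show "span_ideal A ts \<noteq> {}" by blast
  next
    fix f assume "f \<in> span_ideal A ts"
    then obtain r where r: "f = (\<Sum>m<length ts. r m * ts ! m)" "\<And>m. r m \<in> A" by (auto simp: span_ideal_def)
    have "- f \<in> span_ideal A ts"
      by (rule span_idealI[where r = "\<lambda>m. - r m"]) (auto simp: r(1) sum_negf intro: A_uminus r(2))
    moreover have "f \<in> A" using \<open>f \<in> span_ideal A ts\<close> span_ideal_A[OF ts] by blast
    ultimately show "\<ominus>\<^bsub>R\<^esub> f \<in> span_ideal A ts" by (simp add: R_uminus)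
  next
    fix f g assume "f \<in> span_ideal A ts" "g \<in> span_ideal A ts"
    then obtain r q where r: "f = (\<Sum>m<length ts. r m * ts ! m)" "\<And>m. r m \<in> A"
      "g = (\<Sum>m<length ts. q m * ts ! m)" "\<And>m. q m \<in> A" by (auto simp: span_ideal_def)
    show "f \<oplus>\<^bsub>R\<^esub> g \<in> span_ideal A ts" unfolding R_simps
      by (rule span_idealI[where r = "\<lambda>m. r m + q m"]) (auto simp: r(1,3) sum.distrib distrib_right intro: A_add r)
  qed
  fix f x assume "f \<in> span_ideal A ts" and x: "x \<in> carrier R"
  then obtain r where r: "f = (\<Sum>m<length ts. r m * ts ! m)" "\<And>m. r m \<in> A" by (auto simp: span_ideal_def)
  show "x \<otimes>\<^bsub>R\<^esub> f \<in> span_ideal A ts" unfolding R_simps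
    by (rule span_idealI[where r = "\<lambda>m. x * r m"])
      (use x in \<open>auto simp: r(1) sum_distrib_left mult.assoc R_simps intro: A_mult r\<close>)
  then show "f \<otimes>\<^bsub>R\<^esub> x \<in> span_ideal A ts" by (simp add: R_simps mult.commute)
qed

lemma span_ideal_eq: "set ts \<subseteq> A \<Longrightarrow> Idl\<^bsub>R\<^esub> (set ts) = span_ideal A ts"
proof (rule antisym)
  assume ts: "set ts \<subseteq> A"
  show "Idl\<^bsub>R\<^esub> (set ts) \<subseteq> span_ideal A ts"
  proof (rule R.genideal_minimal[OF span_ideal_ideal[OF ts]], rule subsetI)
    fix t assume "t \<in> set ts"
    then obtain i where i: "i < length ts" "t = ts ! i" by (auto simp: in_set_conv_nth)
    have "(\<Sum>m<length ts. (if m = i then 1 else 0) * ts ! m) = (\<Sum>m<length ts. if m = i then ts ! m else 0)"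
      by (rule sum.cong) auto
    then show "t \<in> span_ideal A ts"
      by (intro span_idealI[where r = "\<lambda>m. if m = i then 1 else 0"]) (use i in \<open>auto intro: A_0 A_1\<close>)
  qed
  interpret I: ideal "Idl\<^bsub>R\<^esub> (set ts)" R by (rule R.genideal_ideal) (simp add: ts R_simps)
  show "span_ideal A ts \<subseteq> Idl\<^bsub>R\<^esub> (set ts)"
  proof
    fix f assume "f \<in> span_ideal A ts"
    then obtain r where r: "f = (\<Sum>m<length ts. r m * ts ! m)" "\<And>m. r m \<in> A" by (auto simp: span_ideal_def)
    have "(\<Sum>m<n. r m * ts ! m) \<in> Idl\<^bsub>R\<^esub> (set ts)" if "n \<le> length ts" for n
      using that
    proof (induction n)
      case 0
      show ?case using I.zero_closed by (simp add: R_simps)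
    next
      case (Suc n)
      have "ts ! n \<in> Idl\<^bsub>R\<^esub> (set ts)" using R.genideal_self[of "set ts"] ts Suc.prems by (auto simp: R_simps)
      from I.I_l_closed[OF this, of "r n"] have "r n * ts ! n \<in> Idl\<^bsub>R\<^esub> (set ts)" by (simp add: R_simps r(2))
      from I.a_closed[OF Suc.IH this] Suc.prems show ?case by (simp add: R_simps)
    qed
    then show "f \<in> Idl\<^bsub>R\<^esub> (set ts)" by (simp add: r(1))
  qed
qed

lemma subfield_K: "subfield K R"
proof (rule R.subfieldI)
  have "subring K R"
    using K_A by (intro R.subringI) (auto simp: R_simps R_uminus K_1 K_mult K_add K_uminus subset_iff)
  then show "subcring K R" by (rule R.subcringI') 
  have "K \<subseteq> UNIV" by simp
  show "Units (R\<lparr>carrier := K\<rparr>) = K - {\<zero>\<^bsub>R\<^esub>}"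
  proof (intro equalityI subsetI)
    fix c assume "c \<in> Units (R\<lparr>carrier := K\<rparr>)"
    then show "c \<in> K - {\<zero>\<^bsub>R\<^esub>}" by (auto simp: Units_def ring_of_type_algebra_def)
  next
    fix c assume c: "c \<in> K - {\<zero>\<^bsub>R\<^esub>}"
    then obtain e where "e \<in> K" "c * e = 1" using K_inverse[of c] by (auto simp: R_simps)
    then show "c \<in> Units (R\<lparr>carrier := K\<rparr>)"
      using c by (auto simp: Units_def ring_of_type_algebra_def mult.commute intro!: bexI[of _ e])
  qed
qed

end

section \<open>The quotient by a proper ideal\<close>

locale graded_subring_quotient = graded_subring A K G for A K :: "'a::comm_ring_1 set" and G +
  fixes I :: "'a set"
  assumes ideal_I: "ideal I R" and proper_I: "I \<noteq> A"
begin

sublocale I: ideal I R by (rule ideal_I)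

abbreviation h :: "'a \<Rightarrow> 'a set" where "h a \<equiv> I +>\<^bsub>R\<^esub> a"

sublocale Q: ring "R Quot I" by (rule I.quotient_is_ring)

sublocale H: ring_hom_ring R "R Quot I" h by (rule I.rcos_ring_hom_ring)

lemma h_eq_iff: "a \<in> A \<Longrightarrow> b \<in> A \<Longrightarrow> h a = h b \<longleftrightarrow> a - b \<in> I"
  using R.quotient_eq_iff_same_a_r_cos[OF ideal_I, of a b] by (simp add: R_simps R_minus)

lemma zero_Q: "\<zero>\<^bsub>R Quot I\<^esub> = h 0"
  using H.hom_zero by (simp add: R_simps)

lemma h_zero_iff: "a \<in> A \<Longrightarrow> h a = \<zero>\<^bsub>R Quot I\<^esub> \<longleftrightarrow> a \<in> I"
  using h_eq_iff[of a 0] by (simp add: zero_Q A_0)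

lemma carrier_Q: "carrier (R Quot I) = h ` A"
proof -
  have "carrier (R Quot I) = (\<Union>a\<in>carrier R. {h a})" by (simp only: FactRing_def A_RCOSETS_def' partial_object.simps)
  then show ?thesis unfolding R_simps(1) UNION_singleton_eq_range .
qed

lemma h_mult: "a \<in> A \<Longrightarrow> b \<in> A \<Longrightarrow> h a \<otimes>\<^bsub>R Quot I\<^esub> h b = h (a * b)"
  using H.hom_mult[of a b] by (simp add: R_simps)

lemma h_add: "a \<in> A \<Longrightarrow> b \<in> A \<Longrightarrow> h a \<oplus>\<^bsub>R Quot I\<^esub> h b = h (a + b)"
  using H.hom_add[of a b] by (simp add: R_simps)

lemma subfield_quot: "subfield (quot_scalars R K I) (R Quot I)"
proof -
  have "1 \<notin> I" using I.one_imp_carrier proper_I by (auto simp: R_simps)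
  then have "\<one>\<^bsub>R Quot I\<^esub> \<noteq> \<zero>\<^bsub>R Quot I\<^esub>"
    using h_zero_iff[OF A_1] H.hom_one by (simp add: R_simps)
  from H.img_is_subfield(2)[OF subfield_K this] show ?thesis by (simp add: quot_scalars_def)
qed

lemma sum_zip_A:
  "set cs \<subseteq> A \<Longrightarrow> set us \<subseteq> A \<Longrightarrow> (\<Sum>(c, u)\<leftarrow>zip cs us. c * u) \<in> A"
proof (induction cs us rule: list_induct2')
  case (4 c cs u us)
  then show ?case by (auto intro: A_add A_mult)
qed (auto intro: A_0)

lemma combine_h:
  "set cs \<subseteq> A \<Longrightarrow> set us \<subseteq> A \<Longrightarrow> Q.combine (map h cs) (map h us) = h (\<Sum>(c, u)\<leftarrow>zip cs us. c * u)"
proof (induction cs us rule: list_induct2')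
  case (4 c cs u us)
  then have "(\<Sum>(c, u)\<leftarrow>zip cs us. c * u) \<in> A" by (intro sum_zip_A) auto
  then show ?case using 4 by (simp add: h_mult h_add A_mult)
qed (auto simp: zero_Q)

lemma map_h_surj:
  assumes "set xs \<subseteq> h ` B"
  shows "\<exists>as. set as \<subseteq> B \<and> xs = map h as"
  using assms
proof (induction xs)
  case (Cons x xs)
  then obtain a as where "a \<in> B" "x = h a" "set as \<subseteq> B" "xs = map h as" by auto
  then show ?case by (intro exI[of _ "a # as"]) auto
qed simp

lemma finite_dimension_iff:
  "Q.finite_dimension (quot_scalars R K I) (carrier (R Quot I)) \<longleftrightarrow>
    (\<exists>us. set us \<subseteq> A \<and> (\<forall>a\<in>A. \<exists>cs. set cs \<subseteq> K \<and> a - (\<Sum>(c, u)\<leftarrow>zip cs us. c * u) \<in> I))"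
proof
  assume "Q.finite_dimension (quot_scalars R K I) (carrier (R Quot I))"
  then obtain n where "Q.dimension n (quot_scalars R K I) (carrier (R Quot I))"
    unfolding Q.finite_dimension_def by blast
  from Q.exists_base[OF subfield_quot this] obtain Vs
    where Vs: "set Vs \<subseteq> carrier (R Quot I)" "Q.Span (quot_scalars R K I) Vs = carrier (R Quot I)" by blast
  then obtain us where us: "set us \<subseteq> A" "Vs = map h us" using map_h_surj[of Vs A] by (auto simp: carrier_Q)
  have "\<exists>cs. set cs \<subseteq> K \<and> a - (\<Sum>(c, u)\<leftarrow>zip cs us. c * u) \<in> I" if a: "a \<in> A" for a
  proof -
    have "h a \<in> Q.Span (quot_scalars R K I) Vs" unfolding Vs(2) carrier_Q using a by blast
    then obtain Ks where Ks: "set Ks \<subseteq> h ` K" "h a = Q.combine Ks Vs"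
      unfolding Q.Span_eq_combine_set[OF subfield_quot Vs(1)] by (auto simp: quot_scalars_def)
    obtain cs where cs: "set cs \<subseteq> K" "Ks = map h cs" using map_h_surj[OF Ks(1)] by blast
    have csA: "set cs \<subseteq> A" using cs(1) K_A by blast
    have "h a = h (\<Sum>(c, u)\<leftarrow>zip cs us. c * u)" unfolding Ks(2) us(2) cs(2) by (rule combine_h[OF csA us(1)])
    then show ?thesis using h_eq_iff[OF a sum_zip_A[OF csA us(1)]] cs(1) by blast
  qed
  then show "\<exists>us. set us \<subseteq> A \<and> (\<forall>a\<in>A. \<exists>cs. set cs \<subseteq> K \<and> a - (\<Sum>(c, u)\<leftarrow>zip cs us. c * u) \<in> I)"
    using us(1) by blast
next
  assume "\<exists>us. set us \<subseteq> A \<and> (\<forall>a\<in>A. \<exists>cs. set cs \<subseteq> K \<and> a - (\<Sum>(c, u)\<leftarrow>zip cs us. c * u) \<in> I)"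
  then obtain us where us: "set us \<subseteq> A"
    "\<And>a. a \<in> A \<Longrightarrow> \<exists>cs. set cs \<subseteq> K \<and> a - (\<Sum>(c, u)\<leftarrow>zip cs us. c * u) \<in> I" by blast
  have V: "set (map h us) \<subseteq> carrier (R Quot I)" using us(1) by (auto simp: carrier_Q)
  have "Q.Span (quot_scalars R K I) (map h us) = carrier (R Quot I)"
  proof (rule antisym)
    show "Q.Span (quot_scalars R K I) (map h us) \<subseteq> carrier (R Quot I)"
      using Q.Span_in_carrier[OF subfieldE(3)[OF subfield_quot] V] .
    show "carrier (R Quot I) \<subseteq> Q.Span (quot_scalars R K I) (map h us)"
    proof
      fix x assume "x \<in> carrier (R Quot I)"
      then obtain a where a: "a \<in> A" "x = h a" by (auto simp: carrier_Q)
      obtain cs where cs: "set cs \<subseteq> K" "a - (\<Sum>(c, u)\<leftarrow>zip cs us. c * u) \<in> I" using us(2)[OF a(1)] by blast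
      have csA: "set cs \<subseteq> A" using cs(1) K_A by blast
      have "x = Q.combine (map h cs) (map h us)"
        using h_eq_iff[OF a(1) sum_zip_A[OF csA us(1)]] cs(2) by (simp add: combine_h[OF csA us(1)] a(2))
      moreover have "set (map h cs) \<subseteq> quot_scalars R K I" using cs(1) by (auto simp: quot_scalars_def)
      ultimately show "x \<in> Q.Span (quot_scalars R K I) (map h us)"
        unfolding Q.Span_eq_combine_set[OF subfield_quot V] by blast
    qed
  qed
  then show "Q.finite_dimension (quot_scalars R K I) (carrier (R Quot I))"
    using Q.Span_finite_dimension[OF subfield_quot V] by simp
qed

definition soc :: "'a set" where
  "soc = {a \<in> A. \<forall>n>0. \<forall>r\<in>G n. r * a \<in> I}"

lemma quot_socle_eq: "quot_socle R G I = h ` soc"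
proof -
  have "(\<forall>r. homogeneous_of_pos_degree G r \<longrightarrow> h r \<otimes>\<^bsub>R Quot I\<^esub> h a = \<zero>\<^bsub>R Quot I\<^esub>) \<longleftrightarrow>
      (\<forall>n>0. \<forall>r\<in>G n. r * a \<in> I)" if a: "a \<in> A" for a
  proof -
    have "h r \<otimes>\<^bsub>R Quot I\<^esub> h a = \<zero>\<^bsub>R Quot I\<^esub> \<longleftrightarrow> r * a \<in> I" if "r \<in> G n" for r n
    proof -
      have "r \<in> A" using that G_A by blast
      then show ?thesis using h_zero_iff[OF A_mult[OF \<open>r \<in> A\<close> a]] h_mult[OF _ a] by simp
    qed
    then show ?thesis unfolding homogeneous_of_pos_degree_def by blast
  qed
  then show ?thesis unfolding quot_socle_def carrier_Q soc_def by auto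
qed

text \<open>Membership in \<open>soc\<close> depends only on the coset, so it may be tested on any
  representative.\<close>

lemma soc_closed:
  assumes "u \<in> A" "h u \<in> h ` soc"
  shows "u \<in> soc"
proof -
  obtain a where a: "a \<in> soc" "h u = h a" using assms(2) by blast
  then have aA: "a \<in> A" by (simp add: soc_def)
  then have ua: "u - a \<in> I" using h_eq_iff[OF assms(1) aA] a(2) by simp
  have "r * u \<in> I" if "n > 0" "r \<in> G n" for r n
  proof -
    have "r \<in> A" using that G_A by blast
    then have "r * (u - a) \<in> I" using I.I_l_closed[OF ua, of r] by (simp add: R_simps)
    moreover have "r * a \<in> I" using a that by (auto simp: soc_def)
    ultimately have "r * (u - a) + r * a \<in> I" using I.a_closed by (simp add: R_simps)
    then show ?thesis by (simp add: algebra_simps)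
  qed
  then show ?thesis using assms(1) by (simp add: soc_def)
qed

lemma Span_single: "u \<in> A \<Longrightarrow> Q.Span (quot_scalars R K I) [h u] = (\<lambda>c. h (c * u)) ` K"
proof -
  assume u: "u \<in> A"
  have "x \<in> Q.Span (quot_scalars R K I) [h u] \<longleftrightarrow> x \<in> (\<lambda>c. h (c * u)) ` K" for x
  proof -
    have "x \<in> Q.Span (quot_scalars R K I) [h u] \<longleftrightarrow> (\<exists>c\<in>K. x = h c \<otimes>\<^bsub>R Quot I\<^esub> h u \<oplus>\<^bsub>R Quot I\<^esub> \<zero>\<^bsub>R Quot I\<^esub>)"
      by (simp add: Q.line_extension_mem_iff quot_scalars_def)
    also have "\<dots> \<longleftrightarrow> (\<exists>c\<in>K. x = h (c * u))"
    proof (rule bex_cong[OF refl])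
      fix c assume "c \<in> K"
      then have c: "c \<in> A" using K_A by blast
      show "x = h c \<otimes>\<^bsub>R Quot I\<^esub> h u \<oplus>\<^bsub>R Quot I\<^esub> \<zero>\<^bsub>R Quot I\<^esub> \<longleftrightarrow> x = h (c * u)"
        by (simp add: h_mult[OF c u] zero_Q h_add[OF A_mult[OF c u] A_0])
    qed
    also have "\<dots> \<longleftrightarrow> x \<in> (\<lambda>c. h (c * u)) ` K" by blast
    finally show ?thesis .
  qed
  then show ?thesis by blast
qed

lemma dimension_one_iff:
  "Q.dimension 1 (quot_scalars R K I) (quot_socle R G I) \<longleftrightarrow>
    (\<exists>u\<in>A. u \<notin> I \<and> (\<forall>n>0. \<forall>r\<in>G n. r * u \<in> I) \<and>
      (\<forall>a\<in>A. (\<forall>n>0. \<forall>r\<in>G n. r * a \<in> I) \<longrightarrow> (\<exists>c\<in>K. a - c * u \<in> I)))"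
proof
  assume "Q.dimension 1 (quot_scalars R K I) (quot_socle R G I)"
  from Q.exists_base[OF subfield_quot this] obtain Vs where Vs: "set Vs \<subseteq> carrier (R Quot I)"
    "Q.independent (quot_scalars R K I) Vs" "length Vs = 1" "Q.Span (quot_scalars R K I) Vs = h ` soc"
    unfolding quot_socle_eq by blast
  obtain v where v: "Vs = [v]" using Vs(3) by (cases Vs) auto
  obtain u where u: "u \<in> A" "v = h u" using Vs(1) by (auto simp: v carrier_Q)
  have span: "(\<lambda>c. h (c * u)) ` K = h ` soc" using Vs(4) Span_single[OF u(1)] by (simp only: v u(2))
  have "h u \<in> (\<lambda>c. h (c * u)) ` K" by (rule image_eqI[OF _ K_1]) simp
  then have soc: "u \<in> soc" using soc_closed[OF u(1)] span by simp
  have "h u \<notin> Q.Span (quot_scalars R K I) []" using Vs(2) unfolding v u(2) by (auto elim: Q.independent.cases)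
  then have "u \<notin> I" using h_zero_iff[OF u(1)] by simp
  moreover have "\<exists>c\<in>K. a - c * u \<in> I" if "a \<in> soc" for a
  proof -
    have a: "a \<in> A" using that by (simp add: soc_def)
    have "h a \<in> (\<lambda>c. h (c * u)) ` K" unfolding span using that by blast
    then obtain c where c: "c \<in> K" "h a = h (c * u)" by blast
    then have "c * u \<in> A" using K_A u(1) by (auto intro: A_mult)
    then show ?thesis using h_eq_iff[OF a] c by blast
  qed
  ultimately show "\<exists>u\<in>A. u \<notin> I \<and> (\<forall>n>0. \<forall>r\<in>G n. r * u \<in> I) \<and>
      (\<forall>a\<in>A. (\<forall>n>0. \<forall>r\<in>G n. r * a \<in> I) \<longrightarrow> (\<exists>c\<in>K. a - c * u \<in> I))"
    using soc u(1) unfolding soc_def by (intro bexI[of _ u]) simp_all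
next
  assume "\<exists>u\<in>A. u \<notin> I \<and> (\<forall>n>0. \<forall>r\<in>G n. r * u \<in> I) \<and>
      (\<forall>a\<in>A. (\<forall>n>0. \<forall>r\<in>G n. r * a \<in> I) \<longrightarrow> (\<exists>c\<in>K. a - c * u \<in> I))"
  then obtain u where u: "u \<in> A" "u \<notin> I" "u \<in> soc" "\<And>a. a \<in> soc \<Longrightarrow> \<exists>c\<in>K. a - c * u \<in> I"
    unfolding soc_def by auto
  have hu: "h u \<in> carrier (R Quot I)" using u(1) by (simp add: carrier_Q)
  have "Q.independent (quot_scalars R K I) [h u]"
    using h_zero_iff[OF u(1)] u(2) hu by (intro Q.li_Cons) simp_all
  moreover have "Q.Span (quot_scalars R K I) [h u] = h ` soc"
    unfolding Span_single[OF u(1)]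
  proof (intro equalityI subsetI)
    fix x assume "x \<in> (\<lambda>c. h (c * u)) ` K"
    then obtain c where c: "c \<in> K" "x = h (c * u)" by blast
    have cA: "c \<in> A" using c(1) K_A by blast
    have "r * (c * u) \<in> I" if "n > 0" "r \<in> G n" for r n
    proof -
      have "r * u \<in> I" using u(3) that by (auto simp: soc_def)
      from I.I_l_closed[OF this, of c] cA show ?thesis by (simp add: R_simps mult.left_commute)
    qed
    then have "c * u \<in> soc" using A_mult[OF cA u(1)] by (simp add: soc_def)
    then show "x \<in> h ` soc" using c(2) by blast
  next
    fix x assume "x \<in> h ` soc"
    then obtain a where a: "a \<in> soc" "x = h a" by blast
    obtain c where c: "c \<in> K" "a - c * u \<in> I" using u(4)[OF a(1)] by blast
    have cA: "c \<in> A" using c(1) K_A by blast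
    have "h a = h (c * u)" using h_eq_iff[OF _ A_mult[OF cA u(1)]] a(1) c(2) by (simp add: soc_def)
    then show "x \<in> (\<lambda>c. h (c * u)) ` K" using a(2) c(1) by blast
  qed
  ultimately show "Q.dimension 1 (quot_scalars R K I) (quot_socle R G I)"
    using Q.dimensionI[OF subfield_quot, of "[h u]" "h ` soc"] by (simp add: quot_socle_eq)
qed

end

context graded_subring
begin

lemma regular_sequence_iff:
  assumes ts: "set ts \<subseteq> A"
  shows "regular_sequence R ts \<longleftrightarrow> (\<forall>i<length ts. \<forall>a\<in>A. ts ! i * a \<in> span_ideal A (take i ts) \<longrightarrow>
    a \<in> span_ideal A (take i ts)) \<and> span_ideal A ts \<noteq> A"
proof -
  have "set (take i ts) \<subseteq> A" for i using ts set_take_subset[of i ts] by blast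
  then show ?thesis using ts by (simp add: regular_sequence_def R_simps span_ideal_eq)
qed

text \<open>The scalars form a field in the quotient only if the ideal is proper, hence the case
  distinction: an improper ideal makes both sides false for the given sequence, and so does an entry
  that is not homogeneous of positive degree.\<close>

theorem gorenstein_graded_algebra_iff:
  "gorenstein_graded_algebra R K G \<longleftrightarrow> (\<exists>ts. gorenstein_sop A K G ts)"
proof -
  have "regular_sop R K G ts \<and> ring.dimension (R Quot (Idl\<^bsub>R\<^esub> (set ts))) 1
      (quot_scalars R K (Idl\<^bsub>R\<^esub> (set ts))) (quot_socle R G (Idl\<^bsub>R\<^esub> (set ts))) \<longleftrightarrow> gorenstein_sop A K G ts" for ts
  proof (cases "(\<forall>t\<in>set ts. \<exists>n>0. t \<in> G n)")
    case True
    then have ts: "set ts \<subseteq> A" using G_A by blast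
    show ?thesis
    proof (cases "span_ideal A ts = A")
      case True
      then have "\<not> regular_sop R K G ts" by (simp add: regular_sop_def regular_sequence_iff[OF ts])
      moreover have "\<not> gorenstein_sop A K G ts" using True by (simp add: gorenstein_sop_def)
      ultimately show ?thesis by blast
    next
      case False
      interpret graded_subring_quotient A K G "span_ideal A ts"
        by (rule graded_subring_quotient.intro[OF graded_subring_axioms
              graded_subring_quotient_axioms.intro[OF span_ideal_ideal[OF ts] False]])
      show ?thesis unfolding regular_sop_def Let_def span_ideal_eq[OF ts] regular_sequence_iff[OF ts]
          finite_dimension_iff dimension_one_iff gorenstein_sop_def homogeneous_of_pos_degree_def
        using False by (simp only: simp_thms conj_assoc)
    qed
  next
    case False
    then show ?thesis
      unfolding regular_sop_def gorenstein_sop_def homogeneous_of_pos_degree_def by (simp only: simp_thms)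
  qed
  then show ?thesis unfolding gorenstein_graded_algebra_def Let_def by simp
qed

end

section \<open>Transport along injective homomorphisms\<close>

locale subring_embedding = graded_subring A K G for A K :: "'a::comm_ring_1 set" and G +
  fixes \<phi> :: "'a \<Rightarrow> 'b::comm_ring_1"
  assumes \<phi>_inj: "inj_on \<phi> A"
    and \<phi>_add: "a \<in> A \<Longrightarrow> b \<in> A \<Longrightarrow> \<phi> (a + b) = \<phi> a + \<phi> b"
    and \<phi>_mult: "a \<in> A \<Longrightarrow> b \<in> A \<Longrightarrow> \<phi> (a * b) = \<phi> a * \<phi> b"
begin

lemma \<phi>_0: "\<phi> 0 = 0"
  using \<phi>_add[OF A_0 A_0] by simp

lemma \<phi>_diff: "a \<in> A \<Longrightarrow> b \<in> A \<Longrightarrow> \<phi> (a - b) = \<phi> a - \<phi> b"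
  using \<phi>_add[of "a - b" b] A_add[OF _ A_uminus, of a b] by simp

lemma A_diff: "a \<in> A \<Longrightarrow> b \<in> A \<Longrightarrow> a - b \<in> A"
  using A_add[OF _ A_uminus, of a b] by simp

lemma \<phi>_sum:
  fixes n :: nat
  assumes "\<And>m. m < n \<Longrightarrow> f m \<in> A"
  shows "(\<Sum>m<n. f m) \<in> A \<and> \<phi> (\<Sum>m<n. f m) = (\<Sum>m<n. \<phi> (f m))"
  using assms by (induction n) (auto simp: \<phi>_0 \<phi>_add A_0 A_add)

lemma \<phi>_sum_zip:
  "set cs \<subseteq> A \<Longrightarrow> set us \<subseteq> A \<Longrightarrow> (\<Sum>(c, u)\<leftarrow>zip cs us. c * u) \<in> A \<and>
    \<phi> (\<Sum>(c, u)\<leftarrow>zip cs us. c * u) = (\<Sum>(c, u)\<leftarrow>zip (map \<phi> cs) (map \<phi> us). c * u)"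
proof (induction cs arbitrary: us)
  case (Cons c cs)
  then show ?case by (cases us) (auto simp: \<phi>_0 \<phi>_add \<phi>_mult A_0 A_add A_mult)
qed (simp add: \<phi>_0 A_0)

lemma \<phi>_span_ideal:
  assumes ts: "set ts \<subseteq> A" and f: "f \<in> A"
  shows "\<phi> f \<in> span_ideal (\<phi> ` A) (map \<phi> ts) \<longleftrightarrow> f \<in> span_ideal A ts"
proof -
  have *: "\<phi> (\<Sum>m<length ts. r m * ts ! m) = (\<Sum>m<length ts. \<phi> (r m) * \<phi> (ts ! m))"
    "(\<Sum>m<length ts. r m * ts ! m) \<in> A" if "\<And>m. r m \<in> A" for r
  proof -
    have m: "ts ! m \<in> A" if "m < length ts" for m using that ts by auto
    have "\<phi> (r m * ts ! m) = \<phi> (r m) * \<phi> (ts ! m)" if "m < length ts" for m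
      by (rule \<phi>_mult[OF \<open>\<And>m. r m \<in> A\<close> m[OF that]])
    moreover have "r m * ts ! m \<in> A" if "m < length ts" for m
      by (rule A_mult[OF \<open>\<And>m. r m \<in> A\<close> m[OF that]])
    ultimately show "\<phi> (\<Sum>m<length ts. r m * ts ! m) = (\<Sum>m<length ts. \<phi> (r m) * \<phi> (ts ! m))"
      "(\<Sum>m<length ts. r m * ts ! m) \<in> A"
      using \<phi>_sum[of "length ts" "\<lambda>m. r m * ts ! m"] by simp_all
  qed
  show ?thesis
  proof
    assume "\<phi> f \<in> span_ideal (\<phi> ` A) (map \<phi> ts)"
    then obtain r where r: "\<phi> f = (\<Sum>m<length ts. r m * \<phi> (ts ! m))" "\<forall>m. r m \<in> \<phi> ` A"
      by (auto simp: span_ideal_def)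
    then have "\<forall>m. \<exists>a. a \<in> A \<and> r m = \<phi> a" by blast
    from choice[OF this] obtain q where q: "\<And>m. q m \<in> A" "\<And>m. r m = \<phi> (q m)" by blast
    have "\<phi> f = \<phi> (\<Sum>m<length ts. q m * ts ! m)" by (simp add: r(1) q(2) *(1)[OF q(1)])
    then have "f = (\<Sum>m<length ts. q m * ts ! m)" 
      using inj_onD[OF \<phi>_inj _ f *(2)[of q, OF q(1)]] by simp
    then show "f \<in> span_ideal A ts" using q(1) by (rule span_idealI)
  next
    assume "f \<in> span_ideal A ts"
    then obtain r where r: "f = (\<Sum>m<length ts. r m * ts ! m)" "\<And>m. r m \<in> A" by (auto simp: span_ideal_def)
    have "\<phi> f = (\<Sum>m<length (map \<phi> ts). \<phi> (r m) * map \<phi> ts ! m)" by (simp add: r(1) *(1)[OF r(2)])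
    then show "\<phi> f \<in> span_ideal (\<phi> ` A) (map \<phi> ts)" unfolding span_ideal_def mem_Collect_eq
      by (intro exI[of _ "\<lambda>m. \<phi> (r m)"] conjI allI imageI r(2))
  qed
qed

text \<open>Apart from homogeneity, the clauses speak of membership in span ideals, which
  \<open>\<phi>_span_ideal\<close> transfers in both directions.\<close>

lemma gorenstein_sop_transport:
  assumes "gorenstein_sop A K G ts"
  shows "gorenstein_sop (\<phi> ` A) (\<phi> ` K) (\<lambda>n. \<phi> ` G n) (map \<phi> ts)"
proof -
  have 1: "\<forall>t\<in>set ts. \<exists>n>0. t \<in> G n"
    and 2: "\<And>i a. i < length ts \<Longrightarrow> a \<in> A \<Longrightarrow> ts ! i * a \<in> span_ideal A (take i ts) \<Longrightarrow> a \<in> span_ideal A (take i ts)"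
    using assms by (simp_all add: gorenstein_sop_def)
  have 3: "\<exists>us. set us \<subseteq> A \<and> (\<forall>a\<in>A. \<exists>cs. set cs \<subseteq> K \<and>
      a - (\<Sum>(c, u)\<leftarrow>zip cs us. c * u) \<in> span_ideal A ts)"
    and 4: "\<exists>u\<in>A. u \<notin> span_ideal A ts \<and> (\<forall>n>0. \<forall>r\<in>G n. r * u \<in> span_ideal A ts) \<and>
      (\<forall>a\<in>A. (\<forall>n>0. \<forall>r\<in>G n. r * a \<in> span_ideal A ts) \<longrightarrow> (\<exists>c\<in>K. a - c * u \<in> span_ideal A ts))"
    using assms by (simp_all only: gorenstein_sop_def)
  from 3 obtain us where us: "set us \<subseteq> A"
    "\<forall>a\<in>A. \<exists>cs. set cs \<subseteq> K \<and> a - (\<Sum>(c, u)\<leftarrow>zip cs us. c * u) \<in> span_ideal A ts"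
    by (elim exE conjE) (rule that)
  from 4 obtain u where u: "u \<in> A" "u \<notin> span_ideal A ts" "\<forall>n>0. \<forall>r\<in>G n. r * u \<in> span_ideal A ts"
    "\<forall>a\<in>A. (\<forall>n>0. \<forall>r\<in>G n. r * a \<in> span_ideal A ts) \<longrightarrow> (\<exists>c\<in>K. a - c * u \<in> span_ideal A ts)"
    by (elim bexE conjE) (rule that)
  have ts: "set ts \<subseteq> A" using 1 G_A by blast
  have take: "set (take i ts) \<subseteq> A" for i using ts set_take_subset[of i ts] by blast
  have GA: "r \<in> A" if "r \<in> G n" for r n using that G_A by blast
  have KA: "c \<in> A" if "c \<in> K" for c using that K_A by blast
  show ?thesis unfolding gorenstein_sop_def
  proof (intro conjI)
    show "\<forall>t\<in>set (map \<phi> ts). \<exists>n>0. t \<in> \<phi> ` G n" using 1 unfolding set_map by (blast intro: imageI)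
  next
    show "\<forall>i<length (map \<phi> ts). \<forall>a\<in>\<phi> ` A. map \<phi> ts ! i * a \<in> span_ideal (\<phi> ` A) (take i (map \<phi> ts)) \<longrightarrow>
        a \<in> span_ideal (\<phi> ` A) (take i (map \<phi> ts))"
    proof (intro allI impI ballI)
      fix i b assume i: "i < length (map \<phi> ts)" and "b \<in> \<phi> ` A"
        and b: "map \<phi> ts ! i * b \<in> span_ideal (\<phi> ` A) (take i (map \<phi> ts))"
      then obtain a where a: "a \<in> A" "b = \<phi> a" by blast
      have t: "ts ! i \<in> A" using ts i by auto
      have "map \<phi> ts ! i * b = \<phi> (ts ! i * a)" using i by (simp add: a(2) \<phi>_mult[OF t a(1)])
      then have "ts ! i * a \<in> span_ideal A (take i ts)"
        using b \<phi>_span_ideal[OF take A_mult[OF t a(1)], of i] by (simp add: take_map)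
      then have "a \<in> span_ideal A (take i ts)" using 2 i a(1) by simp
      then show "b \<in> span_ideal (\<phi> ` A) (take i (map \<phi> ts))"
        using \<phi>_span_ideal[OF take a(1), of i] by (simp add: a(2) take_map)
    qed
  next
    show "\<exists>vs. set vs \<subseteq> \<phi> ` A \<and> (\<forall>b\<in>\<phi> ` A. \<exists>cs. set cs \<subseteq> \<phi> ` K \<and>
        b - (\<Sum>(c, u)\<leftarrow>zip cs vs. c * u) \<in> span_ideal (\<phi> ` A) (map \<phi> ts))"
    proof (rule exI[of _ "map \<phi> us"], intro conjI ballI)
      show "set (map \<phi> us) \<subseteq> \<phi> ` A" using us(1) by auto
      fix b assume "b \<in> \<phi> ` A"
      then obtain a where a: "a \<in> A" "b = \<phi> a" by blast
      obtain cs where cs: "set cs \<subseteq> K" "a - (\<Sum>(c, u)\<leftarrow>zip cs us. c * u) \<in> span_ideal A ts" using bspec[OF us(2) a(1)] by blast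
      have csA: "set cs \<subseteq> A" using cs(1) K_A by blast
      note z = \<phi>_sum_zip[OF csA us(1)]
      have "b - (\<Sum>(c, u)\<leftarrow>zip (map \<phi> cs) (map \<phi> us). c * u) = \<phi> (a - (\<Sum>(c, u)\<leftarrow>zip cs us. c * u))"
        using \<phi>_diff[OF a(1) conjunct1[OF z]] conjunct2[OF z] by (simp only: a(2))
      also have "\<dots> \<in> span_ideal (\<phi> ` A) (map \<phi> ts)"
        using \<phi>_span_ideal[OF ts A_diff[OF a(1) conjunct1[OF z]]] cs(2) by simp
      finally show "\<exists>cs. set cs \<subseteq> \<phi> ` K \<and> b - (\<Sum>(c, u)\<leftarrow>zip cs (map \<phi> us). c * u) \<in> span_ideal (\<phi> ` A) (map \<phi> ts)"
        using cs(1) by (intro exI[of _ "map \<phi> cs"]) auto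
    qed
  next
    show "\<exists>v\<in>\<phi> ` A. v \<notin> span_ideal (\<phi> ` A) (map \<phi> ts) \<and>
        (\<forall>n>0. \<forall>r\<in>\<phi> ` G n. r * v \<in> span_ideal (\<phi> ` A) (map \<phi> ts)) \<and>
        (\<forall>b\<in>\<phi> ` A. (\<forall>n>0. \<forall>r\<in>\<phi> ` G n. r * b \<in> span_ideal (\<phi> ` A) (map \<phi> ts)) \<longrightarrow>
          (\<exists>c\<in>\<phi> ` K. b - c * v \<in> span_ideal (\<phi> ` A) (map \<phi> ts)))"
    proof (rule bexI[of _ "\<phi> u"], intro conjI allI impI ballI)
      show "\<phi> u \<in> \<phi> ` A" using u(1) by blast
    next
      show "\<phi> u \<notin> span_ideal (\<phi> ` A) (map \<phi> ts)" using \<phi>_span_ideal[OF ts u(1)] u(2) by simp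
    next
      fix n :: nat and r' assume n: "n > 0" "r' \<in> \<phi> ` G n"
      then obtain r where r: "r \<in> G n" "r' = \<phi> r" by blast
      show "r' * \<phi> u \<in> span_ideal (\<phi> ` A) (map \<phi> ts)"
        using \<phi>_span_ideal[OF ts A_mult[OF GA[OF r(1)] u(1)]] u(3)[rule_format, OF n(1) r(1)]
        by (simp add: r(2) \<phi>_mult[OF GA[OF r(1)] u(1)])
    next
      fix b assume "b \<in> \<phi> ` A" and b: "\<forall>n>0. \<forall>r\<in>\<phi> ` G n. r * b \<in> span_ideal (\<phi> ` A) (map \<phi> ts)"
      then obtain a where a: "a \<in> A" "b = \<phi> a" by blast
      have "r * a \<in> span_ideal A ts" if n: "n > 0" "r \<in> G n" for n r
      proof -
        have "\<phi> r * b \<in> span_ideal (\<phi> ` A) (map \<phi> ts)" using b n by blast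
        then show ?thesis using \<phi>_span_ideal[OF ts A_mult[OF GA[OF n(2)] a(1)]]
          by (simp add: a(2) \<phi>_mult[OF GA[OF n(2)] a(1)])
      qed
      then have "\<forall>n>0. \<forall>r\<in>G n. r * a \<in> span_ideal A ts" by simp
      from mp[OF bspec[OF u(4) a(1)] this]
      obtain c where c: "c \<in> K" "a - c * u \<in> span_ideal A ts" by (elim bexE) (rule that)
      have cu: "c * u \<in> A" by (rule A_mult[OF KA[OF c(1)] u(1)])
      have "b - \<phi> c * \<phi> u = \<phi> (a - c * u)"
        by (simp add: a(2) \<phi>_diff[OF a(1) cu] \<phi>_mult[OF KA[OF c(1)] u(1)])
      then have "b - \<phi> c * \<phi> u \<in> span_ideal (\<phi> ` A) (map \<phi> ts)"
        using \<phi>_span_ideal[OF ts A_diff[OF a(1) cu]] c(2) by simp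
      then show "\<exists>c\<in>\<phi> ` K. b - c * \<phi> u \<in> span_ideal (\<phi> ` A) (map \<phi> ts)" using c(1) by blast
    qed
  qed
qed

end

section \<open>Toric rings as monoid algebras\<close>

lemma single_zero_inverse:
  fixes a :: "'m::comm_monoid_add \<Rightarrow>\<^sub>0 'k::field"
  assumes x: "a = Poly_Mapping.single 0 x" and "a \<noteq> 0"
  shows "\<exists>e\<in>range (Poly_Mapping.single 0). a * e = 1"
proof -
  have "x \<noteq> 0" using assms by auto
  then show ?thesis
    by (intro bexI[of _ "Poly_Mapping.single 0 (inverse x)"]) (simp_all add: x mult_single)
qed

lemma graded_subring_supp_in:
  fixes T :: "'m::comm_monoid_add set" and G :: "nat \<Rightarrow> ('m \<Rightarrow>\<^sub>0 'k::field) set"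
  assumes T: "0 \<in> T" "\<And>a b. a \<in> T \<Longrightarrow> b \<in> T \<Longrightarrow> a + b \<in> T" and G: "\<And>n. G n \<subseteq> supp_in T"
  shows "graded_subring (supp_in T) (range (Poly_Mapping.single 0)) G"
proof
  show "(0 :: 'm \<Rightarrow>\<^sub>0 'k) \<in> supp_in T" by (rule supp_in_0)
  have "Poly_Mapping.single 0 1 \<in> (supp_in T :: ('m \<Rightarrow>\<^sub>0 'k) set)" using T(1) by (rule supp_in_single)
  then show "(1 :: 'm \<Rightarrow>\<^sub>0 'k) \<in> supp_in T" by simp
  show "range (Poly_Mapping.single 0) \<subseteq> (supp_in T :: ('m \<Rightarrow>\<^sub>0 'k) set)"
    by (rule image_subsetI) (rule supp_in_single[OF T(1)])
  show "(1 :: 'm \<Rightarrow>\<^sub>0 'k) \<in> range (Poly_Mapping.single 0)" by (rule range_eqI[of _ _ 1]) simp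
next
  fix a b :: "'m \<Rightarrow>\<^sub>0 'k"
  show "a \<in> supp_in T \<Longrightarrow> b \<in> supp_in T \<Longrightarrow> a + b \<in> supp_in T" by (rule supp_in_add)
  show "a \<in> supp_in T \<Longrightarrow> b \<in> supp_in T \<Longrightarrow> a * b \<in> supp_in T" 
    by (rule supp_in_mult[where T = T and U = T]) (assumption+, rule T(2))
  show "a \<in> supp_in T \<Longrightarrow> - a \<in> supp_in T" by (rule supp_in_uminus)
next
  fix a b :: "'m \<Rightarrow>\<^sub>0 'k"
  assume a: "a \<in> range (Poly_Mapping.single 0)"
  then obtain x where x: "a = Poly_Mapping.single 0 x" by blast
  show "- a \<in> range (Poly_Mapping.single 0)"
    unfolding x single_uminus[symmetric] by blast
  show "a \<noteq> 0 \<Longrightarrow> \<exists>e\<in>range (Poly_Mapping.single 0). a * e = 1"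
    by (rule single_zero_inverse[OF x])
  assume "b \<in> range (Poly_Mapping.single 0)"
  then obtain y where y: "b = Poly_Mapping.single 0 y" by blast
  show "a + b \<in> range (Poly_Mapping.single 0)" unfolding x y single_add[symmetric] by blast
  show "a * b \<in> range (Poly_Mapping.single 0)" unfolding x y mult_single by auto
qed (rule G)

section \<open>Change of exponents\<close>

definition map_exponents :: "('m \<Rightarrow> 'n) \<Rightarrow> ('m \<Rightarrow>\<^sub>0 'k::comm_monoid_add) \<Rightarrow> ('n \<Rightarrow>\<^sub>0 'k)" where
  "map_exponents g f = (\<Sum>k\<in>Poly_Mapping.keys f. Poly_Mapping.single (g k) (Poly_Mapping.lookup f k))"

lemma map_exponents_superset:
  assumes "finite B" "Poly_Mapping.keys f \<subseteq> B"
  shows "map_exponents g f = (\<Sum>k\<in>B. Poly_Mapping.single (g k) (Poly_Mapping.lookup f k))"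
  unfolding map_exponents_def by (rule sum.mono_neutral_left) (use assms in \<open>auto simp: in_keys_iff\<close>)

lemma map_exponents_add: "map_exponents g (f1 + f2) = map_exponents g f1 + map_exponents g f2"
proof -
  let ?B = "Poly_Mapping.keys f1 \<union> Poly_Mapping.keys f2"
  have *: "map_exponents g f = (\<Sum>k\<in>?B. Poly_Mapping.single (g k) (Poly_Mapping.lookup f k))"
    if "Poly_Mapping.keys f \<subseteq> ?B" for f by (rule map_exponents_superset) (use that in auto)
  show ?thesis using *[of "f1 + f2"] *[of f1] *[of f2] keys_add[of f1 f2]
    by (simp add: lookup_add single_add sum.distrib)
qed

lemma map_exponents_single: "map_exponents g (Poly_Mapping.single v c) = Poly_Mapping.single (g v) c"
  by (cases "c = 0") (simp_all add: map_exponents_def)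

lemma map_exponents_0: "map_exponents g 0 = 0"
  by (simp add: map_exponents_def)

lemma map_exponents_sum: "map_exponents g (sum f J) = (\<Sum>j\<in>J. map_exponents g (f j))"
  by (induction J rule: infinite_finite_induct) (auto simp: map_exponents_0 map_exponents_add)

lemma map_exponents_mult:
  fixes f1 f2 :: "'m::monoid_add \<Rightarrow>\<^sub>0 'k::semiring_0" and g :: "'m \<Rightarrow> 'n::monoid_add"
  assumes f: "f1 \<in> supp_in T" "f2 \<in> supp_in T" and g: "\<And>a b. a \<in> T \<Longrightarrow> b \<in> T \<Longrightarrow> g (a + b) = g a + g b"
  shows "map_exponents g (f1 * f2) = map_exponents g f1 * map_exponents g f2"
proof -
  have "f1 * f2 = (\<Sum>a\<in>Poly_Mapping.keys f1. Poly_Mapping.single a (Poly_Mapping.lookup f1 a)) *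
      (\<Sum>b\<in>Poly_Mapping.keys f2. Poly_Mapping.single b (Poly_Mapping.lookup f2 b))"
    using poly_mapping_expand[of f1] poly_mapping_expand[of f2] by simp
  also have "\<dots> = (\<Sum>a\<in>Poly_Mapping.keys f1. \<Sum>b\<in>Poly_Mapping.keys f2.
      Poly_Mapping.single (a + b) (Poly_Mapping.lookup f1 a * Poly_Mapping.lookup f2 b))"
    by (simp add: sum_product mult_single)
  finally have "map_exponents g (f1 * f2) = (\<Sum>a\<in>Poly_Mapping.keys f1. \<Sum>b\<in>Poly_Mapping.keys f2.
      Poly_Mapping.single (g (a + b)) (Poly_Mapping.lookup f1 a * Poly_Mapping.lookup f2 b))"
    by (simp only: map_exponents_sum map_exponents_single)
  also have "\<dots> = (\<Sum>a\<in>Poly_Mapping.keys f1. \<Sum>b\<in>Poly_Mapping.keys f2.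
      Poly_Mapping.single (g a) (Poly_Mapping.lookup f1 a) * Poly_Mapping.single (g b) (Poly_Mapping.lookup f2 b))"
  proof (intro sum.cong refl)
    fix a b assume "a \<in> Poly_Mapping.keys f1" "b \<in> Poly_Mapping.keys f2"
    then have "a \<in> T" "b \<in> T" using f unfolding supp_in_def by blast+
    then show "Poly_Mapping.single (g (a + b)) (Poly_Mapping.lookup f1 a * Poly_Mapping.lookup f2 b) =
        Poly_Mapping.single (g a) (Poly_Mapping.lookup f1 a) * Poly_Mapping.single (g b) (Poly_Mapping.lookup f2 b)"
      by (simp add: mult_single g)
  qed
  also have "\<dots> = map_exponents g f1 * map_exponents g f2" by (simp add: map_exponents_def sum_product)
  finally show ?thesis .
qed

lemma map_exponents_comp: "map_exponents g (map_exponents h f) = map_exponents (\<lambda>k. g (h k)) f"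
  unfolding map_exponents_def[of h f] map_exponents_def[of "\<lambda>k. g (h k)" f]
  by (simp only: map_exponents_sum map_exponents_single)

lemma map_exponents_ident: "(\<And>k. k \<in> Poly_Mapping.keys f \<Longrightarrow> g k = k) \<Longrightarrow> map_exponents g f = f"
  using poly_mapping_expand[of f] by (simp add: map_exponents_def)

lemma keys_map_exponents: "Poly_Mapping.keys (map_exponents g f) \<subseteq> g ` Poly_Mapping.keys f"
proof -
  have "Poly_Mapping.keys (map_exponents g f) \<subseteq>
      (\<Union>k\<in>Poly_Mapping.keys f. Poly_Mapping.keys (Poly_Mapping.single (g k) (Poly_Mapping.lookup f k)))"
    unfolding map_exponents_def by (rule keys_sum)
  also have "\<dots> \<subseteq> g ` Poly_Mapping.keys f" by auto
  finally show ?thesis .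
qed

lemma map_exponents_inverse:
  assumes "f \<in> supp_in T" "\<And>k. k \<in> T \<Longrightarrow> h (g k) = k"
  shows "map_exponents h (map_exponents g f) = f"
  unfolding map_exponents_comp using assms by (intro map_exponents_ident) (auto simp: supp_in_def)

text \<open>Isomorphic monoids have isomorphic monoid algebras. The total functions \<open>g\<close>
  and \<open>h\<close> are inverse to each other only between \<open>T\<close> and \<open>U\<close>,
  and \<open>D n\<close> carries the grading across.\<close>

lemma gorenstein_sop_map_exponents:
  fixes T :: "'m::comm_monoid_add set" and g :: "'m \<Rightarrow> 'n::comm_monoid_add"
    and G :: "nat \<Rightarrow> ('m \<Rightarrow>\<^sub>0 'k::field) set"
  assumes T: "0 \<in> T" "\<And>a b. a \<in> T \<Longrightarrow> b \<in> T \<Longrightarrow> a + b \<in> T"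
    and g: "\<And>a b. a \<in> T \<Longrightarrow> b \<in> T \<Longrightarrow> g (a + b) = g a + g b" "g 0 = 0"
    and gh: "\<And>k. k \<in> T \<Longrightarrow> h (g k) = k" "\<And>k. k \<in> U \<Longrightarrow> g (h k) = k" "g ` T \<subseteq> U" "h ` U \<subseteq> T"
    and G: "\<And>n. G n = {f \<in> supp_in T. \<forall>k\<in>Poly_Mapping.keys f. D n k}"
      "\<And>n. G' n = {f \<in> supp_in U. \<forall>k\<in>Poly_Mapping.keys f. D n (h k)}"
    and sop: "gorenstein_sop (supp_in T) (range (Poly_Mapping.single 0)) G ts"
  shows "gorenstein_sop (supp_in U) (range (Poly_Mapping.single 0)) G' (map (map_exponents g) ts)"
proof -
  have GT: "G n \<subseteq> supp_in T" for n by (auto simp: G)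
  interpret graded_subring "supp_in T" "range (Poly_Mapping.single 0)" G
    by (rule graded_subring_supp_in[OF T GT])
  interpret subring_embedding "supp_in T" "range (Poly_Mapping.single 0)" G "map_exponents g"
  proof
    show "inj_on (map_exponents g) (supp_in T :: ('m \<Rightarrow>\<^sub>0 'k) set)"
      by (rule inj_on_inverseI[where g = "map_exponents h"]) (rule map_exponents_inverse, assumption, rule gh)
    show "map_exponents g (a * b) = map_exponents g a * map_exponents g b"
      if "a \<in> supp_in T" "b \<in> supp_in T" for a b :: "'m \<Rightarrow>\<^sub>0 'k"
      by (rule map_exponents_mult[OF that]) (rule g(1))
  qed (rule map_exponents_add)
  have U: "map_exponents g f \<in> supp_in U" if "f \<in> supp_in T" for f :: "'m \<Rightarrow>\<^sub>0 'k"
    using that gh(3) keys_map_exponents[of g f] unfolding supp_in_def by blast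
  have T': "map_exponents h f \<in> supp_in T" if "f \<in> supp_in U" for f :: "'n \<Rightarrow>\<^sub>0 'k"
    using that gh(4) keys_map_exponents[of h f] unfolding supp_in_def by blast
  have inv: "map_exponents g (map_exponents h f) = f" if "f \<in> supp_in U" for f :: "'n \<Rightarrow>\<^sub>0 'k"
    by (rule map_exponents_inverse[where T = U]) (rule that, rule gh(2))
  have 1: "map_exponents g ` supp_in T = (supp_in U :: ('n \<Rightarrow>\<^sub>0 'k) set)"
  proof (intro equalityI subsetI)
    fix f :: "'n \<Rightarrow>\<^sub>0 'k" assume f: "f \<in> supp_in U"
    show "f \<in> map_exponents g ` supp_in T" 
      by (rule image_eqI[where x = "map_exponents h f"]) (simp_all only: inv[OF f] T'[OF f])
  qed (use U in auto)
  have 2: "map_exponents g ` range (Poly_Mapping.single 0) = (range (Poly_Mapping.single 0) :: ('n \<Rightarrow>\<^sub>0 'k) set)"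
    by (simp add: image_image map_exponents_single g)
  have 3: "map_exponents g ` G n = G' n" for n
  proof (intro equalityI subsetI)
    fix f' assume "f' \<in> map_exponents g ` G n"
    then obtain f where f: "f \<in> supp_in T" "\<forall>k\<in>Poly_Mapping.keys f. D n k" "f' = map_exponents g f" by (auto simp: G)
    have "D n (h k)" if k: "k \<in> Poly_Mapping.keys f'" for k
    proof -
      obtain l where l: "l \<in> Poly_Mapping.keys f" "k = g l" using k keys_map_exponents[of g f] f(3) by blast
      then have "l \<in> T" using f(1) unfolding supp_in_def by blast
      then show ?thesis using f(2) l by (simp add: gh(1))
    qed
    then show "f' \<in> G' n" using U[OF f(1)] f(3) by (simp add: G)
  next
    fix f' assume "f' \<in> G' n"
    then have f': "f' \<in> supp_in U" "\<And>k. k \<in> Poly_Mapping.keys f' \<Longrightarrow> D n (h k)" by (auto simp: G)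
    have "D n k" if k: "k \<in> Poly_Mapping.keys (map_exponents h f')" for k
    proof -
      obtain l where "l \<in> Poly_Mapping.keys f'" "k = h l" using k keys_map_exponents[of h f'] by blast
      then show ?thesis using f'(2) by simp
    qed
    then have "map_exponents h f' \<in> G n" using T'[OF f'(1)] by (simp add: G)
    then show "f' \<in> map_exponents g ` G n" 
      by (rule image_eqI[where x = "map_exponents h f'", rotated]) (simp only: inv[OF f'(1)])
  qed
  show ?thesis using gorenstein_sop_transport[OF sop] unfolding 1 2 3 .
qed

lemma generate_ring_supp_in:
  fixes L :: "'m::comm_monoid_add set"
  shows "generate_ring ring_of_type_algebra (range (Poly_Mapping.single 0) \<union> {mon a | a. a \<in> L}) =
    (supp_in (gen L) :: ('m \<Rightarrow>\<^sub>0 'k::field) set)" (is "?G = _")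
proof -
  interpret cring "ring_of_type_algebra :: ('m \<Rightarrow>\<^sub>0 'k) ring" by (rule cring_from_type_algebra)
  have ops: "a \<otimes>\<^bsub>ring_of_type_algebra\<^esub> b = a * b" "a \<oplus>\<^bsub>ring_of_type_algebra\<^esub> b = a + b"
    "\<one>\<^bsub>ring_of_type_algebra\<^esub> = (1 :: 'm \<Rightarrow>\<^sub>0 'k)" "\<zero>\<^bsub>ring_of_type_algebra\<^esub> = (0 :: 'm \<Rightarrow>\<^sub>0 'k)"
    "carrier ring_of_type_algebra = (UNIV :: ('m \<Rightarrow>\<^sub>0 'k) set)" for a b :: "'m \<Rightarrow>\<^sub>0 'k"
    by (simp_all add: ring_of_type_algebra_def)
  have minus: "\<ominus>\<^bsub>ring_of_type_algebra\<^esub> a = - a" for a :: "'m \<Rightarrow>\<^sub>0 'k"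
    by (rule minus_equality) (simp_all add: ops)
  interpret S: graded_subring "supp_in (gen L) :: ('m \<Rightarrow>\<^sub>0 'k) set" "range (Poly_Mapping.single 0)" "\<lambda>_. {}"
    by (rule graded_subring_supp_in) (auto intro: gen_0 gen_add)
  have "f \<in> supp_in (gen L)" if "f \<in> ?G" for f
    using that
  proof (induction rule: generate_ring.induct)
    case (incl h)
    then show ?case by (auto intro: supp_in_single gen_0 gen_base)
  qed (auto simp: ops minus intro: S.A_1 S.A_uminus S.A_add S.A_mult)
  moreover have "f \<in> ?G" if f: "f \<in> supp_in (gen L)" for f
  proof -
    have scalar: "Poly_Mapping.single 0 c \<in> ?G" for c by (rule generate_ring.incl) blast
    have mult: "a * b \<in> ?G" if "a \<in> ?G" "b \<in> ?G" for a b using generate_ring.eng_mult[OF that] by (simp add: ops)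
    have add: "a + b \<in> ?G" if "a \<in> ?G" "b \<in> ?G" for a b using generate_ring.eng_add[OF that] by (simp add: ops)
    have mon: "mon v \<in> ?G" if "v \<in> gen L" for v
      using that
    proof (induction rule: gen.induct)
      case gen_0
      show ?case by (rule scalar)
    next
      case (gen_step x s)
      have "mon x \<in> ?G" by (rule generate_ring.incl) (use gen_step.hyps(1) in blast)
      from mult[OF this gen_step.IH] show ?case by (simp add: mult_single)
    qed
    have "Poly_Mapping.single v c \<in> ?G" if "v \<in> gen L" for v c
      using mult[OF scalar[of c] mon[OF that]] by (simp add: mult_single)
    then have t: "Poly_Mapping.single v (Poly_Mapping.lookup f v) \<in> ?G" if "v \<in> Poly_Mapping.keys f" for v
      using that f unfolding supp_in_def by blast
    have "(\<Sum>v\<in>B. Poly_Mapping.single v (Poly_Mapping.lookup f v)) \<in> ?G" if "B \<subseteq> Poly_Mapping.keys f" for B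
      using finite_subset[OF that finite_keys] that
    proof (induction B)
      case empty
      show ?case using scalar[of 0] by simp
    next
      case (insert v B)
      then show ?case using add[OF t[of v]] by simp
    qed
    from this[OF order_refl] show ?thesis using poly_mapping_expand[of f] by simp
  qed
  ultimately show ?thesis by blast
qed

lemma gorenstein_polytope_iff:
  fixes P :: "(real ^ 'n::finite) set" and deg :: "int ^ 'n \<Rightarrow> int"
  assumes deg: "\<And>a b. deg (a + b) = deg a + deg b" "\<And>a. a \<in> lattice_points P \<Longrightarrow> deg a = 1"
  shows "gorenstein_polytope TYPE('k::field) P \<longleftrightarrow>
    (\<exists>ts. gorenstein_sop (supp_in (gen (lattice_points P)) :: (int ^ 'n \<Rightarrow>\<^sub>0 'k) set) (range (Poly_Mapping.single 0))
      (\<lambda>n. {f \<in> supp_in (gen (lattice_points P)). \<forall>v\<in>Poly_Mapping.keys f. deg v = int n}) ts)"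
proof -
  let ?T = "gen {(a, 1 :: nat) | a. a \<in> lattice_points P}" and ?U = "gen (lattice_points P)"
  let ?h = "\<lambda>v :: int ^ 'n. (v, nat (deg v))"
  let ?G = "toric_component P :: nat \<Rightarrow> ('n, 'k) laurent set"
  let ?G' = "\<lambda>n. {f \<in> supp_in ?U :: (int ^ 'n \<Rightarrow>\<^sub>0 'k) set. \<forall>v\<in>Poly_Mapping.keys f. deg v = int n}"
  have deg0: "deg 0 = 0" using deg(1)[of 0 0] by simp
  have T: "fst k \<in> ?U \<and> ?h (fst k) = k" if "k \<in> ?T" for k
    using that
  proof (induction rule: gen.induct)
    case gen_0
    show ?case by (simp add: deg0 gen.gen_0 zero_prod_def)
  next
    case (gen_step x s)
    then obtain a where a: "x = (a, 1)" "a \<in> lattice_points P" by blast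
    have "deg (fst s) \<ge> 0"
      using gen_step.IH additive_gen_nonneg[of deg "lattice_points P" "fst s"] deg by simp
    moreover have "snd s = nat (deg (fst s))" using gen_step.IH by (metis snd_conv)
    ultimately show ?case using gen_step.IH a
      by (auto simp: deg plus_prod_def nat_add_distrib intro: gen.gen_step)
  qed
  have U: "?h v \<in> ?T" "deg v \<ge> 0" if "v \<in> ?U" for v
  proof -
    have "?h v \<in> ?T \<and> deg v \<ge> 0" using that
    proof (induction rule: gen.induct)
      case gen_0
      show ?case using gen.gen_0[of "{(a, 1 :: nat) | a. a \<in> lattice_points P}"] by (simp add: deg0 zero_prod_def)
    next
      case (gen_step x s)
      have "(x, 1) + ?h s \<in> ?T" using gen_step by (intro gen.gen_step) auto
      moreover have "(x, 1) + ?h s = ?h (x + s)"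
        using gen_step by (simp add: deg plus_prod_def nat_add_distrib)
      ultimately show ?case using gen_step by (simp add: deg)
    qed
    then show "?h v \<in> ?T" "deg v \<ge> 0" by simp_all
  qed
  have add_T: "0 \<in> ?T" "\<And>a b. a \<in> ?T \<Longrightarrow> b \<in> ?T \<Longrightarrow> a + b \<in> ?T" by (auto intro: gen_0 gen_add)
  have add_U: "0 \<in> ?U" "\<And>a b. a \<in> ?U \<Longrightarrow> b \<in> ?U \<Longrightarrow> a + b \<in> ?U" by (auto intro: gen_0 gen_add)
  have carrier: "carrier (toric_ring P) = (supp_in ?T :: ('n, 'k) laurent set)"
  proof -
    have "{mon (a, 1 :: nat) | a. a \<in> lattice_points P} =
        {mon a :: ('n, 'k) laurent | a. a \<in> {(a, 1) | a. a \<in> lattice_points P}}" by blast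
    then show ?thesis unfolding toric_ring_def toric_scalars_def partial_object.simps
      by (simp only: generate_ring_supp_in) simp
  qed
  have G: "?G n = {f \<in> supp_in ?T. \<forall>k\<in>Poly_Mapping.keys f. snd k = n}" for n
    unfolding toric_component_def carrier ..
  have ring: "toric_ring P = ring_of_type_algebra\<lparr>carrier := supp_in ?T :: ('n, 'k) laurent set\<rparr>"
    using carrier unfolding toric_ring_def by simp
  have GT: "?G n \<subseteq> supp_in ?T" for n unfolding G by blast
  interpret graded_subring "supp_in ?T :: ('n, 'k) laurent set" "range (Poly_Mapping.single 0)" ?G
    by (rule graded_subring_supp_in[OF add_T GT])
  have "gorenstein_polytope TYPE('k) P \<longleftrightarrow> (\<exists>ts. gorenstein_sop (supp_in ?T :: ('n, 'k) laurent set) (range (Poly_Mapping.single 0)) ?G ts)"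
    unfolding gorenstein_polytope_def ring toric_scalars_def by (rule gorenstein_graded_algebra_iff)
  also have "\<dots> \<longleftrightarrow> (\<exists>ts. gorenstein_sop (supp_in ?U) (range (Poly_Mapping.single 0)) ?G' ts)"
  proof
    assume "\<exists>ts. gorenstein_sop (supp_in ?T :: ('n, 'k) laurent set) (range (Poly_Mapping.single 0)) ?G ts"
    then obtain ts where ts: "gorenstein_sop (supp_in ?T) (range (Poly_Mapping.single 0)) ?G ts" ..
    have "gorenstein_sop (supp_in ?U) (range (Poly_Mapping.single 0)) ?G' (map (map_exponents fst) ts)"
    proof (rule gorenstein_sop_map_exponents[OF add_T _ _ _ _ _ _ G _ ts])
      show "?G' n = {f \<in> supp_in ?U. \<forall>k\<in>Poly_Mapping.keys f. snd (?h k) = n}" for n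
      proof -
        have "deg k = int n \<longleftrightarrow> nat (deg k) = n" if "k \<in> ?U" for k using U(2)[OF that] by linarith
        then show ?thesis unfolding supp_in_def snd_conv by blast
      qed
    qed (use T U in \<open>auto simp: plus_prod_def\<close>)
    then show "\<exists>ts. gorenstein_sop (supp_in ?U) (range (Poly_Mapping.single 0)) ?G' ts" ..
  next
    assume "\<exists>ts. gorenstein_sop (supp_in ?U) (range (Poly_Mapping.single 0)) ?G' ts"
    then obtain ts where ts: "gorenstein_sop (supp_in ?U) (range (Poly_Mapping.single 0)) ?G' ts" ..
    have "gorenstein_sop (supp_in ?T) (range (Poly_Mapping.single 0)) ?G (map (map_exponents ?h) ts)"
    proof (rule gorenstein_sop_map_exponents[OF add_U _ _ _ _ _ _ refl _ ts])
      show "?G n = {f \<in> supp_in ?T. \<forall>k\<in>Poly_Mapping.keys f. deg (fst k) = int n}" for n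
      proof -
        have "snd k = n \<longleftrightarrow> deg (fst k) = int n" if "k \<in> ?T" for k
          using T[OF that] U(2)[of "fst k"] by (metis int_nat_eq nat_int snd_conv)
        then show ?thesis unfolding G supp_in_def by blast
      qed
      show "?h (a + b) = ?h a + ?h b" if "a \<in> ?U" "b \<in> ?U" for a b
        using U(2)[OF that(1)] U(2)[OF that(2)] by (simp add: plus_prod_def deg nat_add_distrib)
    qed (use T U in \<open>auto simp: zero_prod_def deg0\<close>)
    then show "\<exists>ts. gorenstein_sop (supp_in ?T :: ('n, 'k) laurent set) (range (Poly_Mapping.single 0)) ?G ts" ..
  qed
  finally show ?thesis .
qed

section \<open>An obstruction to the Gorenstein property\<close>

context graded_monoid
begin

abbreviation component :: "nat \<Rightarrow> ('g \<Rightarrow>\<^sub>0 'k::field) set" where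
  "component n \<equiv> {f \<in> supp_in (gen M). \<forall>v\<in>Poly_Mapping.keys f. deg v = int n}"

text \<open>Nilpotency comes from finite dimension: a homogeneous ideal contains everything above
  the degrees of a finite spanning set of the quotient. The socle condition holds because both
  elements are multiples of one generator modulo the ideal.\<close>

lemma gorenstein_monoid_algebraI:
  fixes ts :: "('g \<Rightarrow>\<^sub>0 'k::field) list"
  assumes "gorenstein_sop (supp_in (gen M)) (range (Poly_Mapping.single 0)) component ts"
  shows "gorenstein_monoid_algebra M deg ts"
proof -
  let ?A = "supp_in (gen M) :: ('g \<Rightarrow>\<^sub>0 'k) set"
  note sop = assms[unfolded gorenstein_sop_def]
  have 1: "\<forall>t\<in>set ts. \<exists>n>0. t \<in> component n"
    and 2: "\<forall>i<length ts. \<forall>a\<in>?A. ts ! i * a \<in> span_ideal ?A (take i ts) \<longrightarrow> a \<in> span_ideal ?A (take i ts)"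
    and 3: "\<exists>us. set us \<subseteq> ?A \<and> (\<forall>a\<in>?A. \<exists>cs. set cs \<subseteq> range (Poly_Mapping.single 0) \<and>
      a - (\<Sum>(c, u)\<leftarrow>zip cs us. c * u) \<in> span_ideal ?A ts)"
    and 4: "\<exists>u\<in>?A. u \<notin> span_ideal ?A ts \<and> (\<forall>n>0. \<forall>r\<in>component n. r * u \<in> span_ideal ?A ts) \<and>
      (\<forall>a\<in>?A. (\<forall>n>0. \<forall>r\<in>component n. r * a \<in> span_ideal ?A ts) \<longrightarrow>
        (\<exists>c\<in>range (Poly_Mapping.single 0). a - c * u \<in> span_ideal ?A ts))"
    using conjunct1[OF sop] conjunct1[OF conjunct2[OF sop]] conjunct1[OF conjunct2[OF conjunct2[OF sop]]]
      conjunct2[OF conjunct2[OF conjunct2[OF sop]]] by - assumption+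
  interpret graded_regular_sop M deg ts
  proof (rule graded_regular_sop.intro[OF graded_monoid_axioms], rule graded_regular_sop_axioms.intro)
    fix m assume "m < length ts"
    then have "ts ! m \<in> set ts" by simp
    with 1 obtain n where n: "n > 0" "ts ! m \<in> component n" by blast
    then show "ts ! m \<in> Loc {}" by (simp add: loc_empty)
    show "\<exists>n>0. \<forall>v\<in>Poly_Mapping.keys (ts ! m). deg v = n" using n by (intro exI[of _ "int n"]) simp
  qed
  have Id_eq: "Id i {} = span_ideal ?A (take i ts)" if "i \<le> length ts" for i
  proof -
    have "(\<Sum>m<length (take i ts). r m * take i ts ! m) = (\<Sum>m<i. r m * ts ! m)" for r
      using that by (intro sum.cong) auto
    then show ?thesis by (simp add: Id_def span_ideal_def loc_empty)
  qed
  have Id_d: "Id (length ts) {} = span_ideal ?A ts" using Id_eq[of "length ts"] by simp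
  show ?thesis
  proof (rule gorenstein_monoid_algebra.intro[OF graded_regular_sop_axioms], rule gorenstein_monoid_algebra_axioms.intro)
    fix i a assume "i < length ts" "a \<in> Loc {}" "ts ! i * a \<in> Id i {}"
    then show "a \<in> Id i {}" using 2 Id_eq[of i] by (simp add: loc_empty)
  next
    fix x assume x: "x \<in> M"
    from 3 obtain us where us: "set us \<subseteq> ?A"
      "\<forall>a\<in>?A. \<exists>cs. set cs \<subseteq> range (Poly_Mapping.single 0) \<and> a - (\<Sum>(c, u)\<leftarrow>zip cs us. c * u) \<in> span_ideal ?A ts"
      by (elim exE conjE) (rule that)
    let ?D = "insert 0 (\<Union>u\<in>set us. deg ` Poly_Mapping.keys u)"
    have D: "finite ?D" by simp
    \<comment> \<open>Above every degree in the spanning set, so combinations of \<open>us\<close>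
      have no part of degree \<open>N\<close>.\<close>
    define N where "N = nat (Max ?D) + 1"
    have N: "deg v \<noteq> int N" if "u \<in> set us" "v \<in> Poly_Mapping.keys u" for u v
    proof -
      have "deg v \<le> Max ?D" using that by (intro Max_ge[OF D]) blast
      then show ?thesis by (simp add: N_def)
    qed
    have "\<exists>w\<in>gen M. (mon x :: 'g \<Rightarrow>\<^sub>0 'k) ^ n = mon w \<and> deg w = int n" for n
    proof (induction n)
      case 0
      show ?case by (intro bexI[of _ 0]) (simp_all add: deg_0 gen_0)
    next
      case (Suc n)
      then obtain w where "w \<in> gen M" "(mon x :: 'g \<Rightarrow>\<^sub>0 'k) ^ n = mon w" "deg w = int n" by blast
      then show ?case using x by (intro bexI[of _ "x + w"]) (simp_all add: mult_single deg_add deg_M gen_step)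
    qed
    then obtain w where w: "w \<in> gen M" "(mon x :: 'g \<Rightarrow>\<^sub>0 'k) ^ N = mon w" "deg w = int N" by blast
    have "mon w \<in> ?A" using w(1) by (rule supp_in_single)
    from bspec[OF us(2) this] obtain cs where cs: "set cs \<subseteq> range (Poly_Mapping.single 0)"
      "mon w - (\<Sum>(c, u)\<leftarrow>zip cs us. c * u) \<in> Id (length ts) {}" unfolding Id_d by blast
    have zero: "restr (\<lambda>v. deg v = int N) (\<Sum>(c, u)\<leftarrow>zip cs us. c * u) = 0"
      if "set cs \<subseteq> range (Poly_Mapping.single 0)" "\<And>u v. u \<in> set us \<Longrightarrow> v \<in> Poly_Mapping.keys u \<Longrightarrow> deg v \<noteq> int N"
      for cs us :: "('g \<Rightarrow>\<^sub>0 'k) list"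
      using that
    proof (induction cs arbitrary: us)
      case Nil
      show ?case by (rule poly_mapping_eqI) (simp add: lookup_restr)
    next
      case (Cons c cs)
      show ?case
      proof (cases us)
        case Nil
        then show ?thesis by (intro poly_mapping_eqI) (simp add: lookup_restr)
      next
        case (Cons u us')
        obtain y where y: "c = Poly_Mapping.single 0 y" using Cons.prems(1) by auto
        have "restr (\<lambda>v. deg v = int N) (c * u) = 0"
          by (rule poly_mapping_eqI)
            (use Cons.prems(2)[of u] Cons in \<open>auto simp: lookup_restr y lookup_single_mult in_keys_iff\<close>)
        moreover have "restr (\<lambda>v. deg v = int N) (\<Sum>(c, u)\<leftarrow>zip cs us'. c * u) = 0"
          by (rule Cons.IH) (use Cons.prems Cons in auto)
        ultimately show ?thesis by (simp add: Cons restr_add)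
      qed
    qed
    have "restr (\<lambda>v. deg v = int N) (mon w - (\<Sum>(c, u)\<leftarrow>zip cs us. c * u)) \<in> Id (length ts) {}"
      by (rule Id_restr_deg[where Q = "\<lambda>n. n = int N", OF cs(2)]) simp
    moreover have "restr (\<lambda>v. deg v = int N) (mon w :: 'g \<Rightarrow>\<^sub>0 'k) = mon w"
      by (rule poly_mapping_eqI) (use w(3) in \<open>auto simp: lookup_restr lookup_single when_def\<close>)
    ultimately have "mon w \<in> Id (length ts) {}" using zero[OF cs(1) N] by (simp add: restr_diff)
    then show "\<exists>n. mon x ^ n \<in> Id (length ts) {}" using w(2) by (intro exI[of _ N]) simp
  next
    fix a b :: "'g \<Rightarrow>\<^sub>0 'k"
    assume ab: "a \<in> Loc {}" "b \<in> Loc {}" "\<And>x. x \<in> M \<Longrightarrow> mon x * a \<in> Id (length ts) {}"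
      "\<And>x. x \<in> M \<Longrightarrow> mon x * b \<in> Id (length ts) {}"
    have soc: "r * f \<in> Id (length ts) {}"
      if f: "\<And>x. x \<in> M \<Longrightarrow> mon x * f \<in> Id (length ts) {}" and n: "n > 0" and r: "r \<in> component n" for f r n
    proof -
      have "Poly_Mapping.single v (Poly_Mapping.lookup r v) * f \<in> Id (length ts) {}"
        if v: "v \<in> Poly_Mapping.keys r" for v
      proof -
        have "v \<in> gen M" "deg v > 0" using r v n by (auto simp: supp_in_def)
        then obtain x s where x: "v = x + s" "x \<in> M" "s \<in> gen M" using deg_0 by (auto elim: gen.cases)
        have "Poly_Mapping.single s (Poly_Mapping.lookup r v) * (mon x * f) \<in> Id (length ts) {}"
          by (rule Id_mult[OF Loc_mon[OF x(3)] f[OF x(2)]])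
        then show ?thesis by (simp add: mult.assoc[symmetric] mult_single x(1) add.commute)
      qed
      then have "(\<Sum>v\<in>Poly_Mapping.keys r. Poly_Mapping.single v (Poly_Mapping.lookup r v) * f) \<in> Id (length ts) {}"
        by (rule Id_sum)
      moreover have "(\<Sum>v\<in>Poly_Mapping.keys r. Poly_Mapping.single v (Poly_Mapping.lookup r v) * f) = r * f"
        using poly_mapping_expand[of r] by (simp add: sum_distrib_right[symmetric])
      ultimately show ?thesis by simp
    qed
    from 4 obtain u where u: "\<forall>a\<in>?A. (\<forall>n>0. \<forall>r\<in>component n. r * a \<in> span_ideal ?A ts) \<longrightarrow>
        (\<exists>c\<in>range (Poly_Mapping.single 0). a - c * u \<in> span_ideal ?A ts)"
      by (elim bexE conjE) (rule that)
    have multiple: "\<exists>\<gamma>. f - Poly_Mapping.single 0 \<gamma> * u \<in> Id (length ts) {}"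
      if "f \<in> Loc {}" "\<And>x. x \<in> M \<Longrightarrow> mon x * f \<in> Id (length ts) {}" for f
    proof -
      have "f \<in> ?A" using that(1) by (simp add: loc_empty)
      moreover have "\<forall>n>0. \<forall>r\<in>component n. r * f \<in> span_ideal ?A ts"
        using soc[OF that(2)] unfolding Id_d by simp
      ultimately have "\<exists>c\<in>range (Poly_Mapping.single 0). f - c * u \<in> span_ideal ?A ts" using u by simp
      then show ?thesis unfolding Id_d by auto
    qed
    obtain \<alpha> where \<alpha>: "a - Poly_Mapping.single 0 \<alpha> * u \<in> Id (length ts) {}" using multiple[OF ab(1,3)] by auto
    obtain \<beta> where \<beta>: "b - Poly_Mapping.single 0 \<beta> * u \<in> Id (length ts) {}" using multiple[OF ab(2,4)] by auto
    show "\<exists>\<alpha> \<beta>. (\<alpha> \<noteq> 0 \<or> \<beta> \<noteq> 0) \<and> Poly_Mapping.single 0 \<alpha> * a + Poly_Mapping.single 0 \<beta> * b \<in> Id (length ts) {}"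
    \<comment> \<open>Modulo the ideal a = \<alpha> u and b = \<beta> u, so \<beta> a - \<alpha> b
      vanishes. If \<alpha> is 0 this relation may be trivial, but then \<open>a\<close> itself
      vanishes.\<close>
    proof (cases "\<alpha> = 0")
      case True
      then show ?thesis using \<alpha> by (intro exI[of _ 1] exI[of _ 0]) simp
    next
      case False
      have "Poly_Mapping.single 0 \<beta> * (a - Poly_Mapping.single 0 \<alpha> * u) -
          Poly_Mapping.single 0 \<alpha> * (b - Poly_Mapping.single 0 \<beta> * u) \<in> Id (length ts) {}"
        by (intro Id_diff Id_mult[OF Loc_mon[OF gen_0]] \<alpha> \<beta>)
      moreover have "s * (a - t * u) - t * (b - s * u) = s * a - t * b" for s t :: "'g \<Rightarrow>\<^sub>0 'k"
        by (simp add: algebra_simps)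
      ultimately have "Poly_Mapping.single 0 \<beta> * a + Poly_Mapping.single 0 (- \<alpha>) * b \<in> Id (length ts) {}"
        by (simp add: single_uminus)
      then show ?thesis using False by (intro exI[of _ \<beta>] exI[of _ "- \<alpha>"]) simp
    qed
  qed
qed

end

text \<open>-p - S would be the support of top cohomology, which by \<open>coh_cong\<close> only
  sees localisations, against \<open>no_canonical_degree\<close>.\<close>

lemma (in veronese_corner) not_gorenstein_sop:
  fixes ts :: "('g \<Rightarrow>\<^sub>0 'k::field) list"
  shows "\<not> gorenstein_sop (supp_in (gen M)) (range (Poly_Mapping.single 0)) component ts"
proof
  assume "gorenstein_sop (supp_in (gen M)) (range (Poly_Mapping.single 0)) component ts"
  then interpret gorenstein_monoid_algebra M deg ts by (rule gorenstein_monoid_algebraI)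
  obtain p where p: "\<And>v. coh v \<longleftrightarrow> - p - v \<in> gen M" using coh_iff_gen by auto
  show False
  proof (rule no_canonical_degree[of p])
    fix v w assume "\<And>\<sigma>. \<sigma> \<subseteq> M \<Longrightarrow> v \<in> loc \<sigma> \<longleftrightarrow> w \<in> loc \<sigma>"
    then have "coh v \<longleftrightarrow> coh w" by (rule coh_cong)
    then show "- p - v \<in> gen M \<longleftrightarrow> - p - w \<in> gen M" by (simp only: p)
  qed
qed

section \<open>Lattice points of cosmological polytopes\<close>

definition weight :: "('n \<Rightarrow> int) \<Rightarrow> int ^ 'n::finite \<Rightarrow> int" where
  "weight w a = (\<Sum>k\<in>UNIV. w k * a $ k)"

lemma weight_add: "weight w (a + b) = weight w a + weight w b"
  by (simp add: weight_def sum.distrib distrib_left)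

lemma weight_diff: "weight w (a - b) = weight w a - weight w b"
  by (simp add: weight_def sum_subtractf right_diff_distrib)

lemma weight_axis: "weight w (axis k 1) = w k"
  by (simp add: weight_def axis_def if_distrib sum.delta cong: if_cong)

abbreviation unit :: "'n \<Rightarrow> int ^ 'n::finite" where
  "unit k \<equiv> axis k 1"

lemma Upair_swap: "Upair i j = Upair j i"
  by (simp add: Upair_inject)

context
  fixes ends :: "'e::finite \<Rightarrow> 'v::finite uprod"
begin

abbreviation cosmo_points :: "(int ^ ('v + 'e)) set" where
  "cosmo_points \<equiv> lattice_points (cosmological_polytope ends)"

text \<open>A linear bound need only be tested at the vertices. The third vertex of an edge is the
  second one with \<open>i\<close> and \<open>j\<close> exchanged, so two hypotheses cover all
  three.\<close>

lemma lattice_points_weight_ge: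
  assumes w: "\<And>f i j. ends f = Upair i j \<Longrightarrow> w (Inl i) + w (Inl j) - w (Inr f) \<ge> c"
      "\<And>f i j. ends f = Upair i j \<Longrightarrow> w (Inl i) - w (Inl j) + w (Inr f) \<ge> c"
    and a: "a \<in> cosmo_points"
  shows "weight w a \<ge> c"
proof -
  let ?W = "\<chi> k. real_of_int (w k) :: real ^ ('v + 'e)"
  have W: "inner ?W (axis k 1) = real_of_int (w k)" for k by (simp add: inner_axis)
  have "cosmological_polytope ends \<subseteq> {x. inner ?W x \<ge> real_of_int c}"
    unfolding cosmological_polytope_def
  proof (rule hull_minimal)
    show "convex {x. inner ?W x \<ge> real_of_int c}" by (rule convex_halfspace_ge)
    show "\<Union>{{vertex_vec i + vertex_vec j - edge_vec f, vertex_vec i - vertex_vec j + edge_vec f,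
        - vertex_vec i + vertex_vec j + edge_vec f} | i j f. ends f = Upair i j} \<subseteq> {x. inner ?W x \<ge> real_of_int c}"
    proof
      fix x :: "real ^ ('v + 'e)"
      assume "x \<in> \<Union>{{vertex_vec i + vertex_vec j - edge_vec f, vertex_vec i - vertex_vec j + edge_vec f,
        - vertex_vec i + vertex_vec j + edge_vec f} | i j f. ends f = Upair i j}"
      then obtain i j f where f: "ends f = Upair i j" and x: "x = vertex_vec i + vertex_vec j - edge_vec f \<or>
        x = vertex_vec i - vertex_vec j + edge_vec f \<or> x = - vertex_vec i + vertex_vec j + edge_vec f" by blast
      have f': "ends f = Upair j i" using f Upair_swap by metis
      have "real_of_int c \<le> real_of_int (w (Inl i) + w (Inl j) - w (Inr f))"
        "real_of_int c \<le> real_of_int (w (Inl i) - w (Inl j) + w (Inr f))"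
        "real_of_int c \<le> real_of_int (w (Inl j) - w (Inl i) + w (Inr f))"
        using w(1)[OF f] w(2)[OF f] w(2)[OF f'] by (simp_all only: of_int_le_iff)
      then show "x \<in> {x. inner ?W x \<ge> real_of_int c}"
        using x by (auto simp: inner_add_right inner_diff_right inner_minus_right W)
    qed
  qed
  then have "inner ?W (\<chi> k. real_of_int (a $ k)) \<ge> real_of_int c" using a by (auto simp: lattice_points_def)
  also have "inner ?W (\<chi> k. real_of_int (a $ k)) = real_of_int (weight w a)"
    by (simp add: inner_vec_def weight_def)
  finally show ?thesis by simp
qed

lemma finite_cosmo_points: "finite cosmo_points"
proof -
  \<comment> \<open>The vertex 2 e_i - e_f of a loop attains the coordinate 2.\<close>
  have coord: "a $ k \<in> {-2..2}" if a: "a \<in> cosmo_points" for a :: "int ^ ('v + 'e)" and k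
  proof -
    have "weight (\<lambda>m. if m = k then 1 else 0) a \<ge> -2" by (rule lattice_points_weight_ge[OF _ _ a]) auto
    moreover have "weight (\<lambda>m. if m = k then -1 else 0) a \<ge> -2" by (rule lattice_points_weight_ge[OF _ _ a]) auto
    moreover have "weight (\<lambda>m. if m = k then z else 0) a = z * a $ k" for z
      by (simp add: weight_def if_distrib[of "\<lambda>t. t * _"] cong: if_cong)
    ultimately show ?thesis by simp
  qed
  have "vec_nth ` cosmo_points \<subseteq> (\<Pi>\<^sub>E k\<in>UNIV. {-2..2})" using coord by (auto simp: PiE_iff)
  moreover have "finite (\<Pi>\<^sub>E k\<in>(UNIV :: ('v + 'e) set). {-2..2::int})" by (rule finite_PiE) auto
  ultimately have "finite (vec_nth ` cosmo_points)" by (rule finite_subset)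
  then show ?thesis by (rule finite_imageD) (auto intro!: inj_onI simp: vec_nth_inject)
qed

text \<open>All vertices have coordinate sum 1; this sum serves as the degree in
  \<open>gorenstein_polytope_iff\<close>.\<close>

lemma weight_one: "a \<in> cosmo_points \<Longrightarrow> weight (\<lambda>_. 1) a = 1"
proof -
  assume a: "a \<in> cosmo_points"
  have "weight (\<lambda>_. 1) a \<ge> 1" by (rule lattice_points_weight_ge[OF _ _ a]) auto
  moreover have "weight (\<lambda>_. -1) a \<ge> -1" by (rule lattice_points_weight_ge[OF _ _ a]) auto
  moreover have "weight (\<lambda>_. -1) a = - weight (\<lambda>_. 1) a" by (simp add: weight_def sum_negf)
  ultimately show ?thesis by simp
qed

lemma cosmo_points_vertex:
  assumes "ends f = Upair i j"
  shows "unit (Inl i) + unit (Inl j) - unit (Inr f) \<in> cosmo_points"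
    "unit (Inl i) - unit (Inl j) + unit (Inr f) \<in> cosmo_points"
proof -
  have "vertex_vec i + vertex_vec j - edge_vec f \<in> cosmological_polytope ends"
    "vertex_vec i - vertex_vec j + edge_vec f \<in> cosmological_polytope ends"
    unfolding cosmological_polytope_def by (rule hull_inc, use assms in blast)+
  moreover have "(\<chi> m. real_of_int ((unit (Inl i) + unit (Inl j) - unit (Inr f)) $ m)) = vertex_vec i + vertex_vec j - edge_vec f"
    "(\<chi> m. real_of_int ((unit (Inl i) - unit (Inl j) + unit (Inr f)) $ m)) = vertex_vec i - vertex_vec j + edge_vec f"
    by (auto simp: vec_eq_iff axis_def)
  ultimately show "unit (Inl i) + unit (Inl j) - unit (Inr f) \<in> cosmo_points"
    "unit (Inl i) - unit (Inl j) + unit (Inr f) \<in> cosmo_points" by (simp_all only: lattice_points_def mem_Collect_eq)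
qed

lemma cosmo_points_midpoint:
  assumes "a \<in> cosmo_points" "b \<in> cosmo_points" "a + b = c + c"
  shows "c \<in> cosmo_points"
proof -
  let ?r = "\<lambda>a :: int ^ ('v + 'e). \<chi> m. real_of_int (a $ m)"
  have "convex (cosmological_polytope ends)" unfolding cosmological_polytope_def by (rule convex_convex_hull)
  then have "(1 / 2) *\<^sub>R ?r a + (1 / 2) *\<^sub>R ?r b \<in> cosmological_polytope ends"
    using assms(1,2) by (intro convexD) (auto simp: lattice_points_def)
  moreover have "(1 / 2) *\<^sub>R ?r a + (1 / 2) *\<^sub>R ?r b = ?r c"
  proof -
    have "a $ m + b $ m = 2 * c $ m" for m using arg_cong[OF assms(3), of "\<lambda>v. v $ m"] by simp
    then have "real_of_int (a $ m) + real_of_int (b $ m) = 2 * real_of_int (c $ m)" for m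
      by (metis of_int_add of_int_mult of_int_numeral)
    then show ?thesis by (simp add: vec_eq_iff add_divide_distrib[symmetric])
  qed
  ultimately show ?thesis by (simp add: lattice_points_def)
qed

text \<open>The unit vectors are the midpoints of pairs of vertices belonging to the same
  edge.\<close>

lemma cosmo_points_unit:
  assumes "ends f = Upair i j"
  shows "unit (Inl i) \<in> cosmo_points" "unit (Inl j) \<in> cosmo_points" "unit (Inr f) \<in> cosmo_points"
proof -
  have s: "ends f = Upair j i" using assms Upair_swap by metis
  note v = cosmo_points_vertex[OF assms] cosmo_points_vertex[OF s]
  show "unit (Inl i) \<in> cosmo_points" by (rule cosmo_points_midpoint[OF v(1,2)]) simp
  show "unit (Inl j) \<in> cosmo_points" by (rule cosmo_points_midpoint[OF v(3,4)]) simp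
  show "unit (Inr f) \<in> cosmo_points" by (rule cosmo_points_midpoint[OF v(2,4)]) simp
qed

text \<open>The functional with these weights vanishes on e_a + e_b - e_g and takes on e_a - e_b +
  e_g and -e_a + e_b + e_g the value 2 if a = i, respectively b = i, and 0 otherwise. For this a
  loop at \<open>i\<close> has to count twice.\<close>

definition incidence :: "'v \<Rightarrow> 'v + 'e \<Rightarrow> int" where
  "incidence i x = (case x of Inl k \<Rightarrow> (if k = i then 1 else 0)
    | Inr g \<Rightarrow> (if ends g = Upair i i then 2 else if i \<in> set_uprod (ends g) then 1 else 0))"

lemma incidence_Inl: "incidence i (Inl k) = (if k = i then 1 else 0)"
  by (simp add: incidence_def)

lemma incidence_Inr: "ends g = Upair a b \<Longrightarrow> incidence i (Inr g) = (if a = i then 1 else 0) + (if b = i then 1 else 0)"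
  by (auto simp: incidence_def)

lemma vec_expand: "(\<Sum>x\<in>UNIV. of_int (w $ x) * unit x) = (w :: int ^ 'n::finite)"
proof -
  have "of_int z $ m = (z :: int)" for z and m :: 'n
    by (cases z) (simp_all add: of_nat_index one_index del: of_nat_Suc)
  then show ?thesis
    by (simp add: vec_eq_iff sum_component axis_def if_distrib[of "\<lambda>t. _ * t"] cong: if_cong)
qed

text \<open>The triangle of \<open>f0\<close> supplies the Veronese generators. The lattice points
  of the face \<open>F\<close>, which become units, generate the whole kernel of the three
  functionals; the absence of isolated vertices provides the unit vectors at the other vertices for
  this.\<close>

theorem nonloop_not_gorenstein:
  assumes iso: "no_isolated_vertices ends" and f0: "ends f0 = Upair i j" "i \<noteq> j"
  shows "\<not> gorenstein_polytope TYPE('k::field) (cosmological_polytope ends)"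
proof -
  let ?M = cosmo_points
  \<comment> \<open>The weight -2 at \<open>f0\<close> makes the third functional vanish on the two
    vertices e_i - e_j + e_f0 and -e_i + e_j + e_f0, while on e_i + e_j - e_f0 it is 2.\<close>
  define lv where "lv = (\<lambda>c::nat. if c = 0 then weight (incidence i) else if c = 1 then weight (incidence j)
    else weight (\<lambda>x. incidence i x + incidence j x - (if x = Inr f0 then 2 else 0)))"
  \<comment> \<open>The vertices of the triangle of \<open>f0\<close> have the values (2,0,0),
    (0,2,0), (0,0,2), and its side midpoints e_j, e_i, e_f0 have (0,1,1), (1,0,1), (1,1,0).\<close>
  define sq :: "nat \<Rightarrow> int ^ ('v + 'e)" where "sq = (\<lambda>c. if c = 0 then unit (Inl i) - unit (Inl j) + unit (Inr f0)
    else if c = 1 then unit (Inl j) - unit (Inl i) + unit (Inr f0) else unit (Inl i) + unit (Inl j) - unit (Inr f0))"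
  define mx :: "nat \<Rightarrow> int ^ ('v + 'e)" where "mx = (\<lambda>c. if c = 0 then unit (Inl j) else if c = 1 then unit (Inl i) else unit (Inr f0))"
  define F where "F = {x \<in> ?M. \<forall>c<3. lv c x = 0}"
  \<comment> \<open>Inverting the sum of all points of the face inverts each \<open>x\<close> among
    them, since u - x is again a sum of such points.\<close>
  define u where "u = \<Sum>F"
  have three: "c = 0 \<or> c = 1 \<or> c = 2" if "c < 3" for c :: nat using that by auto
  have f0': "ends f0 = Upair j i" using f0(1) Upair_swap by metis
  have lv_add: "lv c (a + b) = lv c a + lv c b" for c a b by (simp add: lv_def weight_add)
  have lv_diff: "lv c (a - b) = lv c a - lv c b" for c a b by (simp add: lv_def weight_diff)
  have lv0: "lv c 0 = 0" for c using lv_add[of c 0 0] by simp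
  have lv2: "lv 2 a = lv 0 a + lv 1 a - 2 * a $ Inr f0" for a
  proof -
    have "(\<Sum>x\<in>UNIV. (incidence i x + incidence j x - (if x = Inr f0 then 2 else 0)) * a $ x) =
        (\<Sum>x\<in>UNIV. incidence i x * a $ x + incidence j x * a $ x - (if x = Inr f0 then 2 * a $ x else 0))"
      by (rule sum.cong) (auto simp: algebra_simps)
    then show ?thesis by (simp add: lv_def weight_def sum.distrib sum_subtractf)
  qed
  have lv_mult: "lv c (of_nat n * a) = int n * lv c a" for c n a
    by (induction n) (simp_all add: lv0 lv_add distrib_right)
  have inc_f0: "incidence i (Inr f0) = 1" "incidence j (Inr f0) = 1"
    using incidence_Inr[OF f0(1), of i] incidence_Inr[OF f0(1), of j] f0(2) by simp_all
  have inc_g: "g = f0 \<Longrightarrow> ends g = Upair a b \<Longrightarrow> (a = i \<and> b = j) \<or> (a = j \<and> b = i)" for g a b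
    using f0(1) by (auto simp: Upair_inject)
  have lv_M: "lv c x \<ge> 0" if c: "c < 3" and x: "x \<in> ?M" for c x
  proof -
    have w: "weight w x \<ge> 0" if "\<And>g a b. ends g = Upair a b \<Longrightarrow> w (Inl a) + w (Inl b) - w (Inr g) \<ge> 0"
      "\<And>g a b. ends g = Upair a b \<Longrightarrow> w (Inl a) - w (Inl b) + w (Inr g) \<ge> 0" for w
      by (rule lattice_points_weight_ge[OF _ _ x]) (fact that)+
    have 1: "weight (incidence v) x \<ge> 0" for v
    proof (rule w)
      fix g a b assume g: "ends g = Upair a b"
      show "0 \<le> incidence v (Inl a) + incidence v (Inl b) - incidence v (Inr g)"
        "0 \<le> incidence v (Inl a) - incidence v (Inl b) + incidence v (Inr g)"
        by (simp_all add: incidence_Inl incidence_Inr[OF g])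
    qed
    have 2: "weight (\<lambda>x. incidence i x + incidence j x - (if x = Inr f0 then 2 else 0)) x \<ge> 0"
    proof (rule w)
      fix g a b assume g: "ends g = Upair a b"
      show "0 \<le> incidence i (Inl a) + incidence j (Inl a) - (if Inl a = Inr f0 then 2 else 0) +
          (incidence i (Inl b) + incidence j (Inl b) - (if Inl b = Inr f0 then 2 else 0)) -
          (incidence i (Inr g) + incidence j (Inr g) - (if Inr g = Inr f0 then 2 else 0))"
        by (simp add: incidence_Inl incidence_Inr[OF g])
      show "0 \<le> incidence i (Inl a) + incidence j (Inl a) - (if Inl a = Inr f0 then 2 else 0) -
          (incidence i (Inl b) + incidence j (Inl b) - (if Inl b = Inr f0 then 2 else 0)) +
          (incidence i (Inr g) + incidence j (Inr g) - (if Inr g = Inr f0 then 2 else 0))"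
        using inc_g[OF _ g] f0(2) by (auto simp: incidence_Inl incidence_Inr[OF g])
    qed
    show ?thesis using three[OF c] 1 2 by (auto simp: lv_def)
  qed
  have lv_unit: "lv 0 (unit x) = incidence i x" "lv 1 (unit x) = incidence j x" "lv (Suc 0) (unit x) = incidence j x" for x
    by (simp_all add: lv_def weight_axis)
  have f0_coord: "(unit x :: int ^ ('v + 'e)) $ Inr f0 = (if x = Inr f0 then 1 else 0)" for x
    by (simp add: axis_def)
  have lv_sq: "lv c (sq e) = (if c = e then 2 else 0)" if "c < 3" "e < 3" for c e
    using three[OF that(1)] three[OF that(2)] f0(2)
    by (elim disjE) (simp_all add: sq_def lv2 lv_add lv_diff lv_unit incidence_Inl inc_f0 f0_coord)
  have lv_mx: "lv c (mx e) = (if c = e then 0 else 1)" if "c < 3" "e < 3" for c e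
    using three[OF that(1)] three[OF that(2)] f0(2)
    by (elim disjE) (simp_all add: mx_def lv2 lv_unit incidence_Inl inc_f0 f0_coord)
  have sq_gen: "sq c \<in> gen ?M" for c
    unfolding sq_def using cosmo_points_vertex[OF f0(1)] cosmo_points_vertex[OF f0'] by (simp add: gen_base)
  have mx_gen: "mx c \<in> gen ?M" for c
    unfolding mx_def using cosmo_points_unit[OF f0(1)] by (simp add: gen_base)
  have F_M: "F \<subseteq> ?M" by (auto simp: F_def)
  have finF: "finite F" by (rule finite_subset[OF F_M finite_cosmo_points])
  have u_gen: "u \<in> gen ?M" unfolding u_def by (rule gen_sum) (use F_M gen_base in blast)
  have lv_u: "lv c u = 0" if "c < 3" for c
  proof -
    have "lv c (\<Sum>B) = 0" if "B \<subseteq> F" for B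
      using finite_subset[OF that finF] that
      by (induction B) (use \<open>c < 3\<close> in \<open>auto simp: lv0 lv_add F_def\<close>)
    then show ?thesis unfolding u_def by simp
  qed
  define T where "T = {v. \<exists>k. v + of_nat k * u \<in> gen ?M}"
  have T_gen: "v \<in> T" if "v \<in> gen ?M" for v unfolding T_def using that by (auto intro!: exI[of _ 0])
  have T_add: "a + b \<in> T" if ab: "a \<in> T" "b \<in> T" for a b
  proof -
    obtain k l where "a + of_nat k * u \<in> gen ?M" "b + of_nat l * u \<in> gen ?M" using ab by (auto simp: T_def)
    then have "(a + of_nat k * u) + (b + of_nat l * u) \<in> gen ?M" by (rule gen_add)
    moreover have "(a + of_nat k * u) + (b + of_nat l * u) = (a + b) + of_nat (k + l) * u"
      by (simp add: algebra_simps)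
    ultimately show ?thesis unfolding T_def by (auto intro!: exI[of _ "k + l"])
  qed
  have T_F: "- x \<in> T" if x: "x \<in> F" for x
  proof -
    have "\<Sum>(F - {x}) \<in> gen ?M" by (rule gen_sum) (use F_M gen_base in blast)
    moreover have "- x + of_nat 1 * u = \<Sum>(F - {x})" unfolding u_def by (simp add: sum_diff1 finF x)
    ultimately show ?thesis unfolding T_def mem_Collect_eq by (intro exI[of _ 1]) simp
  qed
  \<comment> \<open>The units of the localised monoid \<open>T\<close>.\<close>
  define T0 where "T0 = {v. v \<in> T \<and> - v \<in> T}"
  have T0_zero: "0 \<in> T0" using T_gen[OF gen_0] by (simp add: T0_def)
  have T0_add: "a + b \<in> T0" if "a \<in> T0" "b \<in> T0" for a b
    using T_add[of a b] T_add[of "- a" "- b"] that by (simp add: T0_def)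
  have T0_uminus: "- a \<in> T0" if "a \<in> T0" for a using that by (simp add: T0_def)
  have T0_F: "x \<in> T0" if "x \<in> F" for x
    using that T_F[OF that] T_gen[OF gen_base, of x] F_M by (auto simp: T0_def)
  have T0_int: "of_int z * a \<in> T0" if a: "a \<in> T0" for z a
  proof -
    have "of_nat n * a \<in> T0" for n
      by (induction n) (use a in \<open>auto simp: T0_zero distrib_right intro!: T0_add\<close>)
    then show ?thesis by (cases z rule: int_cases2) (use T0_uminus in auto)
  qed
  have T0_sum: "sum h B \<in> T0" if "\<And>b. b \<in> B \<Longrightarrow> h b \<in> T0" for h and B :: "('v + 'e) set"
    using finite[of B] that by (induction B) (auto simp: T0_zero intro: T0_add)
  \<comment> \<open>The unit vectors corrected along e_i and e_j so that \<open>lv 0\<close> and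
    \<open>lv 1\<close> vanish. A vector in the kernel is then the combination of the \<delta> x
    with its own coordinates as coefficients; its coordinate at \<open>f0\<close> is 0 because of
    \<open>lv 2\<close>.\<close>
  define \<delta> :: "'v + 'e \<Rightarrow> int ^ ('v + 'e)" where
    "\<delta> = (\<lambda>x. unit x - of_int (incidence i x) * unit (Inl i) - of_int (incidence j x) * unit (Inl j))"
  have unit_T0: "unit (Inl k) \<in> T0" if k: "k \<noteq> i" "k \<noteq> j" for k
  proof (rule T0_F)
    obtain g where "k \<in> set_uprod (ends g)" using iso unfolding no_isolated_vertices_def by blast
    moreover obtain a b where g: "ends g = Upair a b" by (cases "ends g") auto
    ultimately have "k = a \<or> k = b" by auto
    then have "unit (Inl k) \<in> ?M" using cosmo_points_unit[OF g] by auto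
    moreover have "lv c (unit (Inl k)) = 0" if "c < 3" for c
      using three[OF that] k by (elim disjE) (simp_all add: lv2 lv_unit incidence_Inl f0_coord)
    ultimately show "unit (Inl k) \<in> F" by (simp add: F_def)
  qed
  have \<delta>_T0: "\<delta> x \<in> T0" if x: "x \<noteq> Inr f0" for x
  proof (cases x)
    case (Inl k)
    show ?thesis
    proof (cases "k = i \<or> k = j")
      case True
      then have "\<delta> x = 0" using f0(2) by (auto simp: \<delta>_def Inl incidence_Inl)
      then show ?thesis using T0_zero by simp
    next
      case False
      then have "\<delta> x = unit (Inl k)" by (simp add: \<delta>_def Inl incidence_Inl)
      then show ?thesis using unit_T0 False by simp
    qed
  next
    case (Inr g)
    obtain a b where g: "ends g = Upair a b" by (cases "ends g") auto
    let ?p = "unit (Inl a) + unit (Inl b) - unit (Inr g)"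
    have "lv c ?p = 0" if "c < 3" for c
      using three[OF that] x by (elim disjE) (simp_all add: Inr lv2 lv_add lv_diff lv_unit incidence_Inl incidence_Inr[OF g] f0_coord)
    then have "?p \<in> T0" using cosmo_points_vertex(1)[OF g] by (intro T0_F) (simp add: F_def)
    then have p: "- ?p \<in> T0" by (rule T0_uminus)
    let ?r = "\<lambda>c. if c = i \<or> c = j then 0 else unit (Inl c) :: int ^ ('v + 'e)"
    have r: "?r c \<in> T0" for c using unit_T0 T0_zero by simp
    \<comment> \<open>The correction cancels those endpoints of \<open>g\<close> that are
      \<open>i\<close> or \<open>j\<close>; the unit vectors of the other endpoints are already in
      \<open>T0\<close>.\<close>
    have "\<delta> x = - ?p + (?r a + ?r b)"
      using f0(2) by (simp add: \<delta>_def Inr incidence_Inr[OF g])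
    then show ?thesis using T0_add[OF p T0_add[OF r r]] by simp
  qed
  have kernel: "w \<in> T0" if w: "\<And>c. c < 3 \<Longrightarrow> lv c w = 0" for w
  proof -
    have w012: "lv 0 w = 0" "lv 1 w = 0" "w $ Inr f0 = 0" using w[of 0] w[of 1] w[of 2] lv2[of w] by simp_all
    have "of_int (w $ x) * \<delta> x = of_int (w $ x) * unit x -
        of_int (incidence i x * w $ x) * unit (Inl i) - of_int (incidence j x * w $ x) * unit (Inl j)" for x
      by (simp add: \<delta>_def algebra_simps)
    then have "(\<Sum>x\<in>UNIV. of_int (w $ x) * \<delta> x) = (\<Sum>x\<in>UNIV. of_int (w $ x) * unit x) -
        (\<Sum>x\<in>UNIV. of_int (incidence i x * w $ x)) * unit (Inl i) -
        (\<Sum>x\<in>UNIV. of_int (incidence j x * w $ x)) * unit (Inl j)"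
      by (simp only: sum_subtractf sum_distrib_right)
    also have "\<dots> = w - of_int (lv 0 w) * unit (Inl i) - of_int (lv 1 w) * unit (Inl j)"
      by (simp only: vec_expand lv_def weight_def of_int_sum if_True if_False simp_thms one_neq_zero)
    finally have "w = (\<Sum>x\<in>UNIV. of_int (w $ x) * \<delta> x)"
      by (simp only: w012 of_int_0 mult_zero_left diff_zero)
    moreover have "(\<Sum>x\<in>UNIV. of_int (w $ x) * \<delta> x) \<in> T0"
    proof (rule T0_sum)
      fix x show "of_int (w $ x) * \<delta> x \<in> T0"
        by (cases "x = Inr f0") (simp_all add: w012 T0_zero T0_int \<delta>_T0)
    qed
    ultimately show ?thesis by simp
  qed
  have localisation: "\<exists>k. v + of_nat k * u \<in> gen ?M" if v: "\<And>c. c < 3 \<Longrightarrow> lv c v \<ge> 0" for v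
  proof -
    \<comment> \<open>Since \<open>lv 2\<close> is congruent to \<open>lv 0 + lv 1\<close> modulo 2,
      the three values are all even or exactly one of them, at \<open>e\<close>, is. In the latter
      case subtracting \<open>mx e\<close> makes all even, and squares do the rest.\<close>
    have "\<exists>r\<in>gen ?M. \<forall>c<3. even (lv c v - lv c r) \<and> lv c v - lv c r \<ge> 0"
    proof (cases "even (lv 0 v) \<and> even (lv 1 v)")
      case True
      then have "even (lv c v)" if "c < 3" for c using three[OF that] lv2[of v] by auto
      then show ?thesis using v by (intro bexI[of _ 0]) (simp_all add: lv0 gen_0)
    next
      case False
      then obtain e where e: "e < 3" "even (lv e v)" "\<And>c. c < 3 \<Longrightarrow> c \<noteq> e \<Longrightarrow> odd (lv c v)"
      proof -
        assume *: "\<not> (even (lv 0 v) \<and> even (lv 1 v))"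
          and that: "\<And>e. e < 3 \<Longrightarrow> even (lv e v) \<Longrightarrow> (\<And>c. c < 3 \<Longrightarrow> c \<noteq> e \<Longrightarrow> odd (lv c v)) \<Longrightarrow> thesis"
        consider "even (lv 0 v)" "odd (lv 1 v)" | "odd (lv 0 v)" "even (lv 1 v)" | "odd (lv 0 v)" "odd (lv 1 v)"
          using * by blast
        then show thesis
        proof cases
          case 1
          show thesis by (rule that[of 0]) (use 1 three lv2[of v] in fastforce)+
        next
          case 2
          show thesis by (rule that[of 1]) (use 2 three lv2[of v] in fastforce)+
        next
          case 3
          show thesis by (rule that[of 2]) (use 3 three lv2[of v] in fastforce)+
        qed
      qed
      have "even (lv c v - lv c (mx e)) \<and> lv c v - lv c (mx e) \<ge> 0" if c: "c < 3" for c
      proof (cases "c = e")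
        case True
        then show ?thesis using e v[OF c] lv_mx[OF c e(1)] by simp
      next
        case False
        then have "odd (lv c v)" using e(3) c by blast
        then have "lv c v \<noteq> 0" by auto
        then show ?thesis using \<open>odd (lv c v)\<close> v[OF c] lv_mx[OF c e(1)] False by simp
      qed
      then show ?thesis using mx_gen[of e] by blast
    qed
    then obtain r where r: "r \<in> gen ?M" "\<And>c. c < 3 \<Longrightarrow> even (lv c v - lv c r) \<and> lv c v - lv c r \<ge> 0" by blast
    define n where "n = (\<lambda>c. nat ((lv c v - lv c r) div 2))"
    have n: "2 * int (n c) = lv c v - lv c r" if "c < 3" for c using r(2)[OF that] by (auto simp: n_def)
    define s where "s = r + of_nat (n 0) * sq 0 + of_nat (n 1) * sq 1 + of_nat (n 2) * sq 2"
    have s: "s \<in> gen ?M" unfolding s_def by (intro gen_add r gen_of_nat_mult sq_gen)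
    have "lv c s = lv c v" if c: "c < 3" for c
    proof -
      have "lv c s = lv c r + int (n 0) * lv c (sq 0) + int (n 1) * lv c (sq 1) + int (n 2) * lv c (sq 2)"
        by (simp add: s_def lv_add lv_mult)
      also have "\<dots> = lv c r + 2 * int (n c)" using three[OF c] by (elim disjE) (simp_all add: lv_sq)
      finally show ?thesis using n[OF c] by simp
    qed
    then have "v - s \<in> T0" by (intro kernel) (simp add: lv_diff)
    then have "(v - s) + s \<in> T" using T_gen[OF s] by (intro T_add) (simp add: T0_def)
    then show ?thesis by (simp add: T_def)
  qed
  interpret veronese_corner ?M "weight (\<lambda>_. 1)" lv sq mx u
  proof
    show "finite ?M" by (rule finite_cosmo_points)
    show "even (lv 0 v + lv 1 v + lv 2 v)" for v by (simp add: lv2)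
    show "\<exists>k. v + of_nat k * u \<in> gen ?M" if "\<And>c. c < 3 \<Longrightarrow> lv c v \<ge> 0" for v
      by (rule localisation) (rule that)
  qed (simp_all only: weight_add weight_one lv_add lv_M lv_sq lv_mx sq_gen mx_gen u_gen lv_u)
  have "\<not> (\<exists>ts. gorenstein_sop (supp_in (gen ?M) :: (int ^ ('v + 'e) \<Rightarrow>\<^sub>0 'k) set) (range (Poly_Mapping.single 0))
      (\<lambda>n. {f \<in> supp_in (gen ?M). \<forall>v\<in>Poly_Mapping.keys f. weight (\<lambda>_. 1) v = int n}) ts)"
    by (simp only: not_gorenstein_sop not_ex simp_thms)
  then show ?thesis
    by (simp only: gorenstein_polytope_iff[of "weight (\<lambda>_. 1)", OF weight_add weight_one] not_False_eq_True)
qed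

end

section \<open>Graphs all of whose edges are loops\<close>

lemma span_ideal_induct:
  assumes "f \<in> span_ideal A ts" "P 0" "\<And>f g. P f \<Longrightarrow> P g \<Longrightarrow> P (f + g)"
    "\<And>r t. r \<in> A \<Longrightarrow> t \<in> set ts \<Longrightarrow> P (r * t)"
  shows "P f"
proof -
  obtain r where r: "f = (\<Sum>m<length ts. r m * ts ! m)" "\<And>m. r m \<in> A"
    using assms(1) by (auto simp: span_ideal_def)
  have "P (\<Sum>m<n. r m * ts ! m)" if "n \<le> length ts" for n
    using that by (induction n) (simp_all add: assms(2) assms(3) assms(4) r(2))
  then show ?thesis by (simp add: r(1))
qed

context graded_subring
begin

lemma
  assumes ts: "set ts \<subseteq> A"
  shows span_ideal_0: "0 \<in> span_ideal A ts"
    and span_ideal_add: "f \<in> span_ideal A ts \<Longrightarrow> g \<in> span_ideal A ts \<Longrightarrow> f + g \<in> span_ideal A ts"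
    and span_ideal_mult: "r \<in> A \<Longrightarrow> f \<in> span_ideal A ts \<Longrightarrow> r * f \<in> span_ideal A ts"
    and span_ideal_base: "t \<in> set ts \<Longrightarrow> t \<in> span_ideal A ts"
proof -
  interpret J: ideal "span_ideal A ts" R by (rule span_ideal_ideal[OF ts])
  show "0 \<in> span_ideal A ts" using J.zero_closed by (simp add: R_simps)
  show "f \<in> span_ideal A ts \<Longrightarrow> g \<in> span_ideal A ts \<Longrightarrow> f + g \<in> span_ideal A ts"
    using J.a_closed[of f g] by (simp add: R_simps)
  show "r \<in> A \<Longrightarrow> f \<in> span_ideal A ts \<Longrightarrow> r * f \<in> span_ideal A ts"
    using J.I_l_closed[of f r] by (simp add: R_simps)
  show "t \<in> set ts \<Longrightarrow> t \<in> span_ideal A ts"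
    using R.genideal_self[of "set ts"] span_ideal_eq[OF ts] ts by (auto simp: R_simps)
qed

lemma span_ideal_sum:
  "set ts \<subseteq> A \<Longrightarrow> (\<And>b. b \<in> B \<Longrightarrow> h b \<in> span_ideal A ts) \<Longrightarrow> sum h B \<in> span_ideal A ts"
  by (induction B rule: infinite_finite_induct) (auto intro: span_ideal_0 span_ideal_add)

lemma span_ideal_uminus: "set ts \<subseteq> A \<Longrightarrow> f \<in> span_ideal A ts \<Longrightarrow> - f \<in> span_ideal A ts"
  using span_ideal_mult[of ts "- 1" f] A_uminus[OF A_1] by simp

lemma span_ideal_diff:
  "set ts \<subseteq> A \<Longrightarrow> f \<in> span_ideal A ts \<Longrightarrow> g \<in> span_ideal A ts \<Longrightarrow> f - g \<in> span_ideal A ts"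
  using span_ideal_add[of ts f "- g"] span_ideal_uminus[of ts g] by simp

end

text \<open>A linear functional; with suitable \<open>Q\<close> it reads off coordinates in the
  quotient by the parameters.\<close>

definition coeff_sum :: "('g \<Rightarrow> bool) \<Rightarrow> ('g \<Rightarrow>\<^sub>0 'k::comm_ring_1) \<Rightarrow> 'k" where
  "coeff_sum Q f = (\<Sum>k\<in>Poly_Mapping.keys f. if Q k then Poly_Mapping.lookup f k else 0)"

lemma coeff_sum_superset:
  assumes "finite B" "Poly_Mapping.keys f \<subseteq> B"
  shows "coeff_sum Q f = (\<Sum>k\<in>B. if Q k then Poly_Mapping.lookup f k else 0)"
  unfolding coeff_sum_def by (rule sum.mono_neutral_left) (use assms in \<open>auto simp: in_keys_iff\<close>)

lemma coeff_sum_add: "coeff_sum Q (f + g) = coeff_sum Q f + coeff_sum Q g"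
proof -
  let ?B = "Poly_Mapping.keys f \<union> Poly_Mapping.keys g"
  have *: "coeff_sum Q h = (\<Sum>k\<in>?B. if Q k then Poly_Mapping.lookup h k else 0)"
    if "Poly_Mapping.keys h \<subseteq> ?B" for h by (rule coeff_sum_superset) (use that in auto)
  show ?thesis using *[of "f + g"] *[of f] *[of g] keys_add[of f g]
    by (simp add: lookup_add sum.distrib[symmetric] if_distrib cong: if_cong)
qed

lemma coeff_sum_0: "coeff_sum Q 0 = 0"
  by (simp add: coeff_sum_def)

lemma coeff_sum_sum: "coeff_sum Q (sum h J) = (\<Sum>j\<in>J. coeff_sum Q (h j))"
  by (induction J rule: infinite_finite_induct) (auto simp: coeff_sum_0 coeff_sum_add)

lemma coeff_sum_uminus: "coeff_sum Q (- f) = - coeff_sum Q f"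
  using coeff_sum_add[of Q f "- f"] by (simp add: coeff_sum_0 eq_neg_iff_add_eq_0 add.commute)

lemma coeff_sum_diff: "coeff_sum Q (f - g) = coeff_sum Q f - coeff_sum Q g"
  using coeff_sum_add[of Q f "- g"] by (simp add: coeff_sum_uminus)

lemma coeff_sum_single: "coeff_sum Q (Poly_Mapping.single k c) = (if Q k then c else 0)"
  by (cases "c = 0") (simp_all add: coeff_sum_def)

lemma coeff_sum_single_mult:
  fixes f :: "'g::ab_group_add \<Rightarrow>\<^sub>0 'k::comm_ring_1"
  shows "coeff_sum Q (Poly_Mapping.single m c * f) = c * coeff_sum (\<lambda>k. Q (k + m)) f"
proof -
  have "Poly_Mapping.single m c * f =
      (\<Sum>k\<in>Poly_Mapping.keys f. Poly_Mapping.single (m + k) (c * Poly_Mapping.lookup f k))"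
    by (subst (1) poly_mapping_expand[of f]) (simp add: sum_distrib_left mult_single)
  then have "coeff_sum Q (Poly_Mapping.single m c * f) =
      (\<Sum>k\<in>Poly_Mapping.keys f. if Q (m + k) then c * Poly_Mapping.lookup f k else 0)"
    by (simp only: coeff_sum_sum coeff_sum_single)
  then show ?thesis
    by (simp add: coeff_sum_def sum_distrib_left add.commute[of m] if_distrib cong: if_cong)
qed

lemma coeff_sum_cong: "(\<And>k. k \<in> Poly_Mapping.keys f \<Longrightarrow> Q k = Q' k) \<Longrightarrow> coeff_sum Q f = coeff_sum Q' f"
  unfolding coeff_sum_def by (rule sum.cong) simp_all

section \<open>The monoid of a graph of loops\<close>

locale loop_graph =
  fixes ends :: "'e::finite \<Rightarrow> 'v::finite uprod" and p :: "'e \<Rightarrow> 'v"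
  assumes ends: "ends f = Upair (p f) (p f)" and surj_p: "\<exists>f. p f = v"
begin

text \<open>The exponent of x_v in the normal form of a monomial in which y_f and z_f never occur
  together: each unit of a negative coordinate at \<open>f\<close> is a factor z_f, which accounts
  for 2 in the coordinate at \<open>v\<close>.\<close>

definition slack :: "'v \<Rightarrow> int ^ ('v + 'e) \<Rightarrow> int" where
  "slack v a = a $ Inl v + 2 * (\<Sum>f\<in>UNIV. if p f = v then min 0 (a $ Inr f) else 0)"

definition S :: "(int ^ ('v + 'e)) set" where
  "S = {a. \<forall>v. slack v a \<ge> 0}"

abbreviation e_v :: "'v \<Rightarrow> int ^ ('v + 'e)" where "e_v v \<equiv> unit (Inl v)"
abbreviation e_e :: "'e \<Rightarrow> int ^ ('v + 'e)" where "e_e f \<equiv> unit (Inr f)"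
abbreviation e_d :: "'e \<Rightarrow> int ^ ('v + 'e)" where "e_d f \<equiv> e_v (p f) + e_v (p f) - e_e f"

lemma coords: "e_v v $ Inl w = (if v = w then 1 else 0)" "e_v v $ Inr f = 0"
    "e_e f $ Inl w = 0" "e_e f $ Inr g = (if f = g then 1 else 0)"
  by (simp_all add: axis_def)

lemma slack_shift:
  assumes "\<And>g. g \<noteq> f \<Longrightarrow> b $ Inr g = 0"
  shows "slack v (a + b) = slack v a + b $ Inl v +
    (if p f = v then 2 * (min 0 (a $ Inr f + b $ Inr f) - min 0 (a $ Inr f)) else 0)"
proof -
  let ?d = "if p f = v then min 0 (a $ Inr f + b $ Inr f) - min 0 (a $ Inr f) else 0"
  have "(\<Sum>g\<in>UNIV. if p g = v then min 0 ((a + b) $ Inr g) else 0) =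
      (\<Sum>g\<in>UNIV. (if p g = v then min 0 (a $ Inr g) else 0) + (if g = f then ?d else 0))"
    by (rule sum.cong) (use assms in auto)
  then show ?thesis by (simp add: slack_def sum.distrib)
qed

lemma slack_e_v: "slack v (a + e_v w) = slack v a + (if v = w then 1 else 0)"
  using slack_shift[of undefined "e_v w" v a] by (auto simp: coords)

text \<open>A new y_f meeting an old z_f turns into x_v^2.\<close>

lemma slack_e_e: "slack v (a + e_e f) = slack v a + (if p f = v \<and> a $ Inr f < 0 then 2 else 0)"
  by (subst slack_shift[of f]) (auto simp: coords min_def)

lemma slack_e_d: "slack v (a + e_d f) = slack v a + (if p f = v \<and> a $ Inr f > 0 then 2 else 0)"
  by (subst slack_shift[of f]) (auto simp: coords min_def)

lemma slack_0: "slack v 0 = 0"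
  by (simp add: slack_def cong: if_cong)

text \<open>\<open>min 0\<close> is superadditive: cancelling y_f against z_f can only release
  powers of x_v.\<close>

lemma slack_superadditive: "slack v a + slack v b \<le> slack v (a + b)"
proof -
  have "(\<Sum>f\<in>UNIV. if p f = v then min 0 (a $ Inr f) else 0) + (\<Sum>f\<in>UNIV. if p f = v then min 0 (b $ Inr f) else 0)
      \<le> (\<Sum>f\<in>UNIV. if p f = v then min 0 ((a + b) $ Inr f) else 0)"
    unfolding sum.distrib[symmetric] by (rule sum_mono) (simp add: min_def)
  then show ?thesis by (simp add: slack_def)
qed

lemma S_0: "0 \<in> S"
  by (simp add: S_def slack_0)

lemma S_add: "a \<in> S \<Longrightarrow> b \<in> S \<Longrightarrow> a + b \<in> S"
  unfolding S_def using slack_superadditive by (smt (verit) mem_Collect_eq)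

lemma S_gens: "e_v v \<in> S" "e_e f \<in> S" "e_d f \<in> S"
  using slack_e_v[of _ 0 v] slack_e_e[of _ 0 f] slack_e_d[of _ 0 f] by (auto simp: S_def slack_0)

lemma S_div_e_v: "k \<in> S \<Longrightarrow> slack v k \<ge> 1 \<Longrightarrow> k - e_v v \<in> S"
proof -
  assume k: "k \<in> S" "slack v k \<ge> 1"
  have "slack w (k - e_v v) = slack w k - (if w = v then 1 else 0)" for w
    using slack_e_v[of w "k - e_v v" v] by simp
  then show ?thesis using k by (auto simp: S_def)
qed

lemma S_div_e_e: "k \<in> S \<Longrightarrow> k $ Inr f \<ge> 1 \<Longrightarrow> k - e_e f \<in> S"
proof -
  assume k: "k \<in> S" "k $ Inr f \<ge> 1"
  have "slack w (k - e_e f) = slack w k" for w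
    using slack_e_e[of w "k - e_e f" f] k(2) by (simp add: coords)
  then show ?thesis using k(1) by (simp add: S_def)
qed

lemma S_div_e_d: "k \<in> S \<Longrightarrow> k $ Inr f \<le> -1 \<Longrightarrow> k - e_d f \<in> S"
proof -
  assume k: "k \<in> S" "k $ Inr f \<le> -1"
  have "slack w (k - e_d f) = slack w k" for w
    using slack_e_d[of w "k - e_d f" f] k(2) by (simp add: coords)
  then show ?thesis using k(1) by (simp add: S_def)
qed

text \<open>One inclusion is the normal form. For the other, the slack of a point becomes a linear
  functional once the signs of its edge coordinates are fixed, and this functional is nonnegative on
  all vertices.\<close>

lemma gen_cosmo_points: "gen (lattice_points (cosmological_polytope ends)) = S"
proof (intro equalityI subsetI)
  fix a assume "a \<in> gen (lattice_points (cosmological_polytope ends))"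
  then show "a \<in> S"
  proof (induction rule: gen.induct)
    case (gen_step x s)
    have "slack v x \<ge> 0" for v
    proof -
      let ?w = "\<lambda>m. case m of Inl k \<Rightarrow> (if k = v then 1 else 0) | Inr f \<Rightarrow> (if p f = v \<and> x $ Inr f < 0 then 2 else 0 :: int)"
      have "weight ?w x \<ge> 0"
        by (rule lattice_points_weight_ge[OF _ _ gen_step.hyps(1)]) (auto simp: ends Upair_inject)
      moreover have "weight ?w x = slack v x"
      proof -
        have "(\<Sum>m\<in>UNIV. ?w m * x $ m) = (\<Sum>k\<in>UNIV. ?w (Inl k) * x $ Inl k) + (\<Sum>f\<in>UNIV. ?w (Inr f) * x $ Inr f)"
          by (simp add: UNIV_Plus_UNIV[symmetric] sum.Plus del: UNIV_Plus_UNIV)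
        moreover have "(\<Sum>f\<in>UNIV. ?w (Inr f) * x $ Inr f) = (\<Sum>f\<in>UNIV. 2 * (if p f = v then min 0 (x $ Inr f) else 0))"
          by (rule sum.cong) (auto simp: min_def)
        moreover have "(\<Sum>k\<in>UNIV. ?w (Inl k) * x $ Inl k) = (\<Sum>k\<in>UNIV. if k = v then x $ Inl k else 0)"
          by (rule sum.cong) auto
        ultimately show ?thesis by (simp add: weight_def slack_def sum_distrib_left)
      qed
      ultimately show ?thesis by simp
    qed
    then show ?case using S_add[of x s] gen_step.IH by (simp add: S_def)
  qed (rule S_0)
next
  let ?M = "lattice_points (cosmological_polytope ends)"
  fix a assume a: "a \<in> S"
  have M: "e_v v \<in> gen ?M" "e_e f \<in> gen ?M" "e_d f \<in> gen ?M" for v f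
  proof -
    obtain g where g: "p g = v" using surj_p by blast
    show "e_v v \<in> gen ?M" using cosmo_points_unit(1)[of ends g "p g" "p g", OF ends] g by (simp add: gen_base)
    show "e_e f \<in> gen ?M" by (rule gen_base[OF cosmo_points_unit(3)[of ends f "p f" "p f", OF ends]])
    show "e_d f \<in> gen ?M" by (rule gen_base[OF cosmo_points_vertex(1)[of ends f "p f" "p f", OF ends]])
  qed
  have int_mult: "of_int z * m \<in> gen ?M" if "m \<in> gen ?M" "z \<ge> 0" for z m
    using gen_of_nat_mult[OF that(1), of "nat z"] that(2) by (simp add: of_nat_nat)
  have idx: "of_int z $ m = (z :: int)" for z and m :: "'v + 'e"
    by (cases z) (simp_all add: of_nat_index one_index del: of_nat_Suc)
  let ?h = "\<lambda>f. if a $ Inr f \<ge> 0 then of_int (a $ Inr f) * e_e f else of_int (- (a $ Inr f)) * e_d f"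
  let ?b = "(\<Sum>v\<in>UNIV. of_int (slack v a) * e_v v) + (\<Sum>f\<in>UNIV. ?h f)"
  have "?b \<in> gen ?M"
    by (intro gen_add gen_sum) (use a M in \<open>auto simp: S_def simp del: of_int_minus intro!: int_mult\<close>)
  moreover have "?b = a"
  proof (rule iffD2[OF vec_eq_iff], rule allI)
    fix m :: "'v + 'e"
    show "?b $ m = a $ m"
    proof (cases m)
      case (Inl k)
      have "(\<Sum>v\<in>UNIV. (of_int (slack v a) * e_v v) $ m) = (\<Sum>v\<in>UNIV. if v = k then slack v a else 0)"
        by (rule sum.cong) (auto simp: Inl coords idx)
      moreover have "(\<Sum>f\<in>UNIV. ?h f $ m) = (\<Sum>f\<in>UNIV. - 2 * (if p f = k then min 0 (a $ Inr f) else 0))"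
        by (rule sum.cong) (auto simp: Inl coords idx min_def simp del: of_int_minus)
      ultimately show ?thesis by (simp add: sum_component slack_def Inl sum_distrib_left sum_negf)
    next
      case (Inr g)
      have "(\<Sum>v\<in>UNIV. (of_int (slack v a) * e_v v) $ m) = 0"
        by (rule sum.neutral) (auto simp: Inr coords)
      moreover have "(\<Sum>f\<in>UNIV. ?h f $ m) = (\<Sum>f\<in>UNIV. if f = g then a $ Inr f else 0)"
        by (rule sum.cong) (auto simp: Inr coords idx simp del: of_int_minus)
      ultimately show ?thesis by (simp add: sum_component Inr)
    qed
  qed
  ultimately show "a \<in> gen ?M" by simp
qed

end

section \<open>Regularity of the parameters\<close>

locale loop_algebra = loop_graph ends p
  for ends :: "'e::finite \<Rightarrow> 'v::finite uprod" and p :: "'e \<Rightarrow> 'v" +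
  fixes field_type :: "'k::field itself"
begin

abbreviation A :: "(int ^ ('v + 'e) \<Rightarrow>\<^sub>0 'k) set" where "A \<equiv> supp_in S"

abbreviation comp :: "nat \<Rightarrow> (int ^ ('v + 'e) \<Rightarrow>\<^sub>0 'k) set" where
  "comp n \<equiv> {f \<in> A. \<forall>v\<in>Poly_Mapping.keys f. weight (\<lambda>_. 1) v = int n}"

lemma graded_subring_A: "graded_subring A (range (Poly_Mapping.single 0)) comp"
  by (rule graded_subring_supp_in) (auto intro: S_0 S_add)

sublocale AA: graded_subring A "range (Poly_Mapping.single 0)" comp
  by (rule graded_subring_A)

abbreviation x_v :: "'v \<Rightarrow> int ^ ('v + 'e) \<Rightarrow>\<^sub>0 'k" where "x_v v \<equiv> mon (e_v v)"
abbreviation y_e :: "'e \<Rightarrow> int ^ ('v + 'e) \<Rightarrow>\<^sub>0 'k" where "y_e f \<equiv> mon (e_e f)"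
abbreviation z_e :: "'e \<Rightarrow> int ^ ('v + 'e) \<Rightarrow>\<^sub>0 'k" where "z_e f \<equiv> mon (e_d f)"
abbreviation \<theta> :: "'e \<Rightarrow> int ^ ('v + 'e) \<Rightarrow>\<^sub>0 'k" where "\<theta> f \<equiv> y_e f - z_e f"

lemma mon_A: "k \<in> S \<Longrightarrow> Poly_Mapping.single k c \<in> A"
  by (rule supp_in_single)

lemma gens_A: "x_v v \<in> A" "y_e f \<in> A" "z_e f \<in> A" "\<theta> f \<in> A"
  by (intro mon_A S_gens supp_in_diff)+

lemma keys_S: "f \<in> A \<Longrightarrow> k \<in> Poly_Mapping.keys f \<Longrightarrow> k \<in> S"
  by (auto simp: supp_in_def)

text \<open>This is a monomial ideal, and \<open>slack v\<close> counts the factors x_v that can be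
  split off within \<open>S\<close>.\<close>

lemma span_ideal_vertices:
  assumes f: "f \<in> A"
  shows "f \<in> span_ideal A (map x_v vs) \<longleftrightarrow> (\<forall>k\<in>Poly_Mapping.keys f. \<exists>v\<in>set vs. slack v k \<ge> 1)"
proof
  assume "f \<in> span_ideal A (map x_v vs)"
  then show "\<forall>k\<in>Poly_Mapping.keys f. \<exists>v\<in>set vs. slack v k \<ge> 1"
  proof (rule span_ideal_induct)
    fix g h :: "int ^ ('v + 'e) \<Rightarrow>\<^sub>0 'k"
    assume "\<forall>k\<in>Poly_Mapping.keys g. \<exists>v\<in>set vs. slack v k \<ge> 1" "\<forall>k\<in>Poly_Mapping.keys h. \<exists>v\<in>set vs. slack v k \<ge> 1"
    then show "\<forall>k\<in>Poly_Mapping.keys (g + h). \<exists>v\<in>set vs. slack v k \<ge> 1" using keys_add[of g h] by blast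
  next
    fix r t :: "int ^ ('v + 'e) \<Rightarrow>\<^sub>0 'k" assume r: "r \<in> A" and "t \<in> set (map x_v vs)"
    then obtain v where v: "v \<in> set vs" "t = x_v v" by auto
    show "\<forall>k\<in>Poly_Mapping.keys (r * t). \<exists>v\<in>set vs. slack v k \<ge> 1"
    proof
      fix k assume "k \<in> Poly_Mapping.keys (r * t)"
      then obtain l where l: "l \<in> Poly_Mapping.keys r" "k = l + e_v v"
        using keys_mult[of r t] v(2) by auto
      then have "slack v l \<ge> 0" using keys_S[OF r] by (simp add: S_def)
      then show "\<exists>v\<in>set vs. slack v k \<ge> 1" using v(1) by (intro bexI[of _ v]) (simp_all add: l(2) slack_e_v)
    qed
  qed simp
next
  have vs: "set (map x_v vs) \<subseteq> A" using gens_A(1) by auto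
  assume *: "\<forall>k\<in>Poly_Mapping.keys f. \<exists>v\<in>set vs. slack v k \<ge> 1"
  have "(\<Sum>k\<in>Poly_Mapping.keys f. Poly_Mapping.single k (Poly_Mapping.lookup f k)) \<in> span_ideal A (map x_v vs)"
  proof (rule AA.span_ideal_sum[OF vs])
    fix k assume k: "k \<in> Poly_Mapping.keys f"
    then obtain v where v: "v \<in> set vs" "slack v k \<ge> 1" using * by blast
    have "Poly_Mapping.single (k - e_v v) (Poly_Mapping.lookup f k) * x_v v \<in> span_ideal A (map x_v vs)"
      by (rule AA.span_ideal_mult[OF vs mon_A[OF S_div_e_v[OF keys_S[OF f k] v(2)]]], rule AA.span_ideal_base[OF vs])
        (use v(1) in simp)
    then show "Poly_Mapping.single k (Poly_Mapping.lookup f k) \<in> span_ideal A (map x_v vs)"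
      by (simp add: mult_single)
  qed
  then show "f \<in> span_ideal A (map x_v vs)" using poly_mapping_expand[of f] by simp
qed

text \<open>Multiplying by x_v changes only \<open>slack v\<close>, so it cannot create divisibility
  by another variable.\<close>

lemma regular_vertex:
  assumes v: "v \<notin> set vs" and a: "a \<in> A" and va: "x_v v * a \<in> span_ideal A (map x_v vs)"
  shows "a \<in> span_ideal A (map x_v vs)"
  unfolding span_ideal_vertices[OF a]
proof
  fix k assume k: "k \<in> Poly_Mapping.keys a"
  have "k + e_v v \<in> Poly_Mapping.keys (x_v v * a)" using k by (simp add: in_keys_iff lookup_single_mult)
  then obtain w where "w \<in> set vs" "slack w (k + e_v v) \<ge> 1"
    using va span_ideal_vertices[OF AA.A_mult[OF gens_A(1) a]] by blast
  then show "\<exists>w\<in>set vs. slack w k \<ge> 1" using v by (intro bexI[of _ w]) (auto simp: slack_e_v)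
qed

text \<open>Multiplication by \<open>mon \<eta>\<close> and \<open>mon \<eta>'\<close> moves the slices of \<open>a\<close> in the \<open>f\<close>-direction in opposite
  ways; starting from the outermost slice, all slices are seen to lie in the ideal.\<close>

lemma slice_in_ideal:
  assumes ts: "set ts \<subseteq> A" and hom: "\<And>t k. t \<in> set ts \<Longrightarrow> k \<in> Poly_Mapping.keys t \<Longrightarrow> k $ Inr f = 0"
    and \<sigma>: "\<sigma> = 1 \<or> \<sigma> = -1" and \<eta>: "\<eta> \<in> S" "\<eta>' \<in> S" "\<eta> $ Inr f = \<sigma>" "\<eta>' $ Inr f = - \<sigma>"
    and div: "\<And>k. k \<in> S \<Longrightarrow> \<sigma> * k $ Inr f \<ge> 1 \<Longrightarrow> k - \<eta> \<in> S"
    and a: "a \<in> A" and rel: "mon \<eta> * a - mon \<eta>' * a \<in> span_ideal A ts"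
  shows "restr (\<lambda>k. \<sigma> * k $ Inr f = int n) a \<in> span_ideal A ts"
proof -
  let ?h = "\<lambda>k :: int ^ ('v + 'e). \<sigma> * k $ Inr f" and ?J = "span_ideal A ts"
  let ?s = "\<lambda>n. restr (\<lambda>k. ?h k = n) :: (int ^ ('v + 'e) \<Rightarrow>\<^sub>0 'k) \<Rightarrow> _"
  have shift: "?s N (r * t) = restr (\<lambda>k. ?h k + m = N) r * t" if "\<And>k. k \<in> Poly_Mapping.keys t \<Longrightarrow> ?h k = m" for N m r t
    by (rule restr_mult_homogeneous[where h = ?h and Q = "\<lambda>x. x = N"]) (simp add: distrib_left, rule that)
  have \<eta>1: "?h \<eta> = 1" "?h \<eta>' = -1" using \<sigma> \<eta>(3,4) by auto
  have s_J: "?s N g \<in> ?J" if "g \<in> ?J" for g N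
    using that
  proof (rule span_ideal_induct)
    fix r t assume r: "r \<in> A" and t: "t \<in> set ts"
    have "?s N (r * t) = ?s N r * t" using shift[of t 0 N r] hom[OF t] by simp
    also have "\<dots> \<in> ?J" by (rule AA.span_ideal_mult[OF ts restr_supp_in[OF r] AA.span_ideal_base[OF ts t]])
    finally show "?s N (r * t) \<in> ?J" .
  next
    have "?s N 0 = 0" by (rule poly_mapping_eqI) (simp add: lookup_restr)
    then show "?s N 0 \<in> ?J" using AA.span_ideal_0[OF ts] by simp
  qed (simp add: restr_add AA.span_ideal_add[OF ts])
  have div_J: "mon (- \<eta>) * ?s N g \<in> ?J" if N: "N \<ge> 1" and "g \<in> ?J" for g N
    using that(2)
  proof (rule span_ideal_induct)
    fix r t assume r: "r \<in> A" and t: "t \<in> set ts"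
    have "mon (- \<eta>) * ?s N r \<in> A"
    proof (rule supp_inI)
      fix k assume "Poly_Mapping.lookup (mon (- \<eta>) * ?s N r) k \<noteq> 0"
      then have "?h (k + \<eta>) = N" "Poly_Mapping.lookup r (k + \<eta>) \<noteq> 0"
        by (auto simp: lookup_single_mult lookup_restr split: if_splits)
      then have "(k + \<eta>) - \<eta> \<in> S" using N by (intro div supp_inD[OF r]) simp_all
      then show "k \<in> S" by simp
    qed
    then have "(mon (- \<eta>) * ?s N r) * t \<in> ?J" by (rule AA.span_ideal_mult[OF ts _ AA.span_ideal_base[OF ts t]])
    then show "mon (- \<eta>) * ?s N (r * t) \<in> ?J" using shift[of t 0 N r] hom[OF t] by (simp add: mult.assoc)
  next
    have "?s N 0 = 0" by (rule poly_mapping_eqI) (simp add: lookup_restr)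
    then show "mon (- \<eta>) * ?s N 0 \<in> ?J" using AA.span_ideal_0[OF ts] by simp
  qed (simp add: restr_add distrib_left AA.span_ideal_add[OF ts])
  define B where "B = nat (Max (insert 0 (?h ` Poly_Mapping.keys a))) + 1"
  have B: "?h k < int B" if "k \<in> Poly_Mapping.keys a" for k
  proof -
    have "?h k \<le> Max (insert 0 (?h ` Poly_Mapping.keys a))" using that by (intro Max_ge) auto
    then show ?thesis by (simp add: B_def)
  qed
  show ?thesis
  \<comment> \<open>Descending induction in steps of two: to slice n + 1 of the relation, \<eta>
    contributes slice n of \<open>a\<close> and \<eta>' contributes slice n + 2. Once slice n + 2 is
    in the ideal, \<eta> can be divided out, because the coordinate n + 1 is positive.\<close>
  proof (induction "B - n" arbitrary: n rule: less_induct)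
    case less
    show ?case
    proof (cases "B \<le> n")
      case True
      have "?s (int n) a = 0"
      proof (rule poly_mapping_eqI)
        fix k show "Poly_Mapping.lookup (?s (int n) a) k = Poly_Mapping.lookup 0 k"
          using B[of k] True by (cases "k \<in> Poly_Mapping.keys a") (auto simp: lookup_restr in_keys_iff)
      qed
      then show ?thesis using AA.span_ideal_0[OF ts] by simp
    next
      case False
      then have next_slice: "?s (int (n + 2)) a \<in> ?J" by (intro less) simp
      have "?s (int n + 1) (a * mon \<eta>) = ?s (int n) a * mon \<eta>"
        using shift[of "mon \<eta>" 1 "int n + 1" a] \<eta>1 by simp
      moreover have "?s (int n + 1) (a * mon \<eta>') = ?s (int (n + 2)) a * mon \<eta>'"
      proof -
        have "(\<lambda>k. ?h k + - 1 = int n + 1) = (\<lambda>k. ?h k = int (n + 2))" by (rule ext) auto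
        then show ?thesis using shift[of "mon \<eta>'" "-1" "int n + 1" a] \<eta>1 by simp
      qed
      ultimately have "?s (int n + 1) (mon \<eta> * a - mon \<eta>' * a) = mon \<eta> * ?s (int n) a - mon \<eta>' * ?s (int (n + 2)) a"
        by (simp only: restr_diff mult.commute[of "mon _"])
      then have "mon \<eta> * ?s (int n) a - mon \<eta>' * ?s (int (n + 2)) a \<in> ?J"
        using s_J[OF rel, of "int n + 1"] by (simp only:)
      from AA.span_ideal_add[OF ts this AA.span_ideal_mult[OF ts mon_A[OF \<eta>(2), of 1] next_slice]]
      have *: "mon \<eta> * ?s (int n) a \<in> ?J" by simp
      have "restr (\<lambda>k. ?h k + 1 = int n + 1) (?s (int n) a) = ?s (int n) a"
        by (rule poly_mapping_eqI) (simp add: lookup_restr)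
      then have "?s (int n + 1) (?s (int n) a * mon \<eta>) = ?s (int n) a * mon \<eta>"
        using shift[of "mon \<eta>" 1 "int n + 1" "?s (int n) a"] \<eta>1 by simp
      then have "mon (- \<eta>) * (?s (int n) a * mon \<eta>) \<in> ?J"
        using div_J[OF _ *, of "int n + 1"] by (simp add: mult.commute)
      moreover have "mon (- \<eta>) * (?s (int n) a * mon \<eta>) = ?s (int n) a * (mon (- \<eta>) * mon \<eta>)"
        by (simp only: ac_simps)
      ultimately show ?thesis by (simp add: mult_single)
    qed
  qed
qed

text \<open>The earlier parameters do not involve coordinate \<open>f\<close>, so their ideal is
  homogeneous for it and the slices of \<open>a\<close> may be treated separately: nonnegative ones
  with y_f leading, negative ones with z_f leading.\<close>

lemma regular_loop:
  assumes ts: "ts = map x_v vs @ map \<theta> es" and f: "f \<notin> set es" and a: "a \<in> A"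
    and rel: "\<theta> f * a \<in> span_ideal A ts"
  shows "a \<in> span_ideal A ts"
proof -
  have tsA: "set ts \<subseteq> A" using gens_A by (auto simp: ts)
  have keys_\<theta>: "Poly_Mapping.keys (\<theta> g) \<subseteq> {e_e g, e_d g}" for g
    using keys_diff[of "y_e g" "z_e g"] by auto
  have hom: "k $ Inr f = 0" if "t \<in> set ts" "k \<in> Poly_Mapping.keys t" for t k
  proof -
    consider v where "t = x_v v" | g where "g \<in> set es" "t = \<theta> g" using \<open>t \<in> set ts\<close> by (auto simp: ts)
    then show ?thesis
    proof cases
      case 1
      then show ?thesis using that(2) by (simp add: coords)
    next
      case 2
      then have "k = e_e g \<or> k = e_d g" "g \<noteq> f" using that(2) keys_\<theta>[of g] f by auto
      then show ?thesis by (auto simp: coords)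
    qed
  qed
  have up: "restr (\<lambda>k. 1 * k $ Inr f = int n) a \<in> span_ideal A ts" for n
  proof (rule slice_in_ideal[OF tsA hom, where \<sigma> = 1 and \<eta> = "e_e f" and \<eta>' = "e_d f"])
    show "mon (e_e f) * a - mon (e_d f) * a \<in> span_ideal A ts" using rel by (simp add: left_diff_distrib)
  qed (use a S_gens S_div_e_e in \<open>simp_all add: coords\<close>)
  have down: "restr (\<lambda>k. -1 * k $ Inr f = int n) a \<in> span_ideal A ts" for n
  proof (rule slice_in_ideal[OF tsA hom, where \<sigma> = "-1" and \<eta> = "e_d f" and \<eta>' = "e_e f"])
    show "mon (e_d f) * a - mon (e_e f) * a \<in> span_ideal A ts"
      using AA.span_ideal_uminus[OF tsA rel] by (simp add: left_diff_distrib)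
  qed (use a S_gens S_div_e_d in \<open>simp_all add: coords\<close>)
  have slice: "restr (\<lambda>k. k $ Inr f = z) a \<in> span_ideal A ts" for z
  proof (cases "z \<ge> 0")
    case True
    then show ?thesis using up[of "nat z"] by simp
  next
    case False
    then have "(\<lambda>k :: int ^ ('v + 'e). -1 * k $ Inr f = int (nat (- z))) = (\<lambda>k. k $ Inr f = z)" by (intro ext) auto
    then show ?thesis using down[of "nat (- z)"] by simp
  qed
  have "a = (\<Sum>z\<in>(\<lambda>k. k $ Inr f) ` Poly_Mapping.keys a. restr (\<lambda>k. k $ Inr f = z) a)"
    by (rule poly_mapping_eqI) (auto simp: lookup_sum lookup_restr sum.delta' in_keys_iff image_iff)
  moreover have "\<dots> \<in> span_ideal A ts" by (rule AA.span_ideal_sum[OF tsA]) (rule slice)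
  ultimately show ?thesis by simp
qed

text \<open>The exponents of the monomials that equal the product of the y_f with f in
  \<open>T\<close> modulo the parameters: no factor x_v, and one factor y_f or z_f for each such
  f.\<close>

definition pattern :: "'e set \<Rightarrow> int ^ ('v + 'e) \<Rightarrow> bool" where
  "pattern T k \<longleftrightarrow> (\<forall>v. slack v k = 0) \<and> (\<forall>f. \<bar>k $ Inr f\<bar> = (if f \<in> T then 1 else 0))"

abbreviation \<Lambda> :: "'e set \<Rightarrow> (int ^ ('v + 'e) \<Rightarrow>\<^sub>0 'k) \<Rightarrow> 'k" where
  "\<Lambda> T \<equiv> coeff_sum (pattern T)"

text \<open>If y_f or z_f already divides the monomial, one of the two products contains its square
  and the other a factor x_v^2, so neither fits. Otherwise the products differ only in y_f against
  z_f, which patterns ignore. Hence \<open>\<Lambda> T\<close> kills the multiples of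
  \<open>\<theta> f\<close>.\<close>

lemma pattern_swap:
  assumes k: "k \<in> S"
  shows "pattern T (k + e_e f) \<longleftrightarrow> pattern T (k + e_d f)"
proof -
  have slack: "slack (p f) k \<ge> 0" using k by (simp add: S_def)
  consider "k $ Inr f = 0" | "k $ Inr f > 0" | "k $ Inr f < 0" by linarith
  then show ?thesis
  proof cases
    case 1
    have "\<bar>(k + e_e f) $ Inr g\<bar> = \<bar>(k + e_d f) $ Inr g\<bar>" for g
      using 1 by (cases "g = f") (simp_all add: coords)
    moreover have "slack v (k + e_e f) = slack v (k + e_d f)" for v
      unfolding slack_e_e slack_e_d using 1 by simp
    ultimately show ?thesis unfolding pattern_def by (simp only:)
  next
    case 2
    have "\<bar>(k + e_e f) $ Inr f\<bar> \<noteq> (if f \<in> T then 1 else 0)" using 2 by (simp add: coords)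
    moreover have "slack (p f) (k + e_d f) \<noteq> 0" unfolding slack_e_d using 2 slack by simp
    ultimately show ?thesis unfolding pattern_def by blast
  next
    case 3
    have "\<bar>(k + e_d f) $ Inr f\<bar> \<noteq> (if f \<in> T then 1 else 0)" using 3 by (simp add: coords)
    moreover have "slack (p f) (k + e_e f) \<noteq> 0" using 3 slack by (simp add: slack_e_e)
    ultimately show ?thesis unfolding pattern_def by blast
  qed
qed

section \<open>The quotient by all parameters\<close>

context
  fixes ts vs es
  assumes ts: "ts = map x_v vs @ map \<theta> es" and vs: "set vs = UNIV" and es: "set es = UNIV"
begin

abbreviation I :: "(int ^ ('v + 'e) \<Rightarrow>\<^sub>0 'k) set" where "I \<equiv> span_ideal A ts"

lemma ts_A: "set ts \<subseteq> A"
  using gens_A by (auto simp: ts)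

lemma x_v_I: "r \<in> A \<Longrightarrow> r * x_v v \<in> I"
  by (rule AA.span_ideal_mult[OF ts_A _ AA.span_ideal_base[OF ts_A]]) (simp_all add: ts vs)

lemma \<theta>_I: "r \<in> A \<Longrightarrow> r * \<theta> f \<in> I"
  by (rule AA.span_ideal_mult[OF ts_A _ AA.span_ideal_base[OF ts_A]]) (simp_all add: ts es)

lemma \<Lambda>_I: "g \<in> I \<Longrightarrow> \<Lambda> T g = 0"
proof (erule span_ideal_induct)
  fix r t :: "int ^ ('v + 'e) \<Rightarrow>\<^sub>0 'k" assume r: "r \<in> A" and "t \<in> set ts"
  then consider v where "t = x_v v" | f where "t = \<theta> f" by (auto simp: ts)
  then show "\<Lambda> T (r * t) = 0"
  proof cases
    case (1 v)
    have "\<Lambda> T (r * t) = coeff_sum (\<lambda>k. pattern T (k + e_v v)) r"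
      using coeff_sum_single_mult[of "pattern T" "e_v v" 1 r] by (simp add: 1 mult.commute)
    also have "\<dots> = coeff_sum (\<lambda>_. False) r"
    proof (rule coeff_sum_cong)
      fix k assume "k \<in> Poly_Mapping.keys r"
      then have "slack v k \<ge> 0" using keys_S[OF r] by (simp add: S_def)
      then have "slack v (k + e_v v) \<noteq> 0" by (simp add: slack_e_v)
      then show "pattern T (k + e_v v) = False" unfolding pattern_def by blast
    qed
    finally show ?thesis by (simp add: coeff_sum_def)
  next
    case (2 f)
    have "\<Lambda> T (r * t) = \<Lambda> T (y_e f * r) - \<Lambda> T (z_e f * r)"
      unfolding 2 right_diff_distrib coeff_sum_diff by (simp only: mult.commute[of r])
    also have "\<dots> = coeff_sum (\<lambda>k. pattern T (k + e_e f)) r - coeff_sum (\<lambda>k. pattern T (k + e_d f)) r"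
      by (simp only: coeff_sum_single_mult mult_1)
    also have "coeff_sum (\<lambda>k. pattern T (k + e_e f)) r = coeff_sum (\<lambda>k. pattern T (k + e_d f)) r"
      by (rule coeff_sum_cong) (rule pattern_swap[OF keys_S[OF r]])
    finally show ?thesis by simp
  qed
qed (simp_all add: coeff_sum_0 coeff_sum_add)

definition e_set :: "'e set \<Rightarrow> int ^ ('v + 'e)" where "e_set T = (\<Sum>f\<in>T. e_e f)"

lemma e_set_coords: "e_set T $ Inl v = 0" "e_set T $ Inr f = (if f \<in> T then 1 else 0)"
proof -
  have "(\<Sum>g\<in>T. e_e g $ Inr f) = (\<Sum>g\<in>T. if g = f then 1 else 0)" by (rule sum.cong) (simp_all add: coords)
  then show "e_set T $ Inr f = (if f \<in> T then 1 else 0)" by (simp add: e_set_def sum_component)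
qed (simp add: e_set_def sum_component coords)

lemma e_set_S: "e_set T \<in> S"
  unfolding e_set_def by (induction T rule: infinite_finite_induct) (auto intro: S_0 S_add S_gens)

lemma slack_eq_coord: "(\<And>f. k $ Inr f \<ge> 0) \<Longrightarrow> slack v k = k $ Inl v"
  by (simp add: slack_def min_def not_less cong: if_cong)

text \<open>Each factor z_f is exchanged for y_f at the cost of a multiple of
  \<open>\<theta> f\<close>; induction on the number of such factors.\<close>

lemma reduce_signs:
  assumes "k \<in> S" "\<And>v. slack v k = 0" "\<And>f. \<bar>k $ Inr f\<bar> \<le> 1"
  shows "mon k - mon (e_set {f. k $ Inr f \<noteq> 0}) \<in> I"
  using assms
proof (induction "card {f. k $ Inr f < 0}" arbitrary: k)
  case 0
  then have nonneg: "k $ Inr f \<ge> 0" for f by (simp add: not_less)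
  have "k = e_set {f. k $ Inr f \<noteq> 0}"
  proof (rule iffD2[OF vec_eq_iff], rule allI)
    fix m show "k $ m = e_set {f. k $ Inr f \<noteq> 0} $ m"
    proof (cases m)
      case (Inl v)
      then show ?thesis using 0(3)[of v] slack_eq_coord[of k v] nonneg by (simp add: e_set_coords)
    next
      case (Inr f)
      then show ?thesis using 0(4)[of f] nonneg[of f] by (auto simp: e_set_coords)
    qed
  qed
  then show ?case using AA.span_ideal_0[OF ts_A] by simp
next
  case (Suc n)
  then obtain f where "k $ Inr f < 0" by (metis (no_types, lifting) card.empty empty_Collect_eq nat.distinct(1))
  then have f: "k $ Inr f = -1" using Suc.prems(3)[of f] by simp
  define l where "l = k - e_d f"
  define k' where "k' = l + e_e f"
  have l: "l \<in> S" unfolding l_def using Suc.prems(1) f by (intro S_div_e_d) simp_all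
  have lf: "l $ Inr f = 0" by (simp add: l_def coords f)
  have k': "k' \<in> S" unfolding k'_def by (intro S_add l S_gens)
  have coord: "k' $ Inr g = (if g = f then 1 else k $ Inr g)" for g by (simp add: k'_def l_def coords f)
  have "slack v k = slack v l" for v using slack_e_d[of v l f] lf by (simp add: l_def)
  then have slack: "slack v k' = 0" for v using slack_e_e[of v l f] lf Suc.prems(2)[of v] by (simp add: k'_def)
  have "{g. k' $ Inr g < 0} = {g. k $ Inr g < 0} - {f}" by (auto simp: coord)
  then have "card {g. k' $ Inr g < 0} = n" using Suc.hyps(2) f by simp
  then have "mon k' - mon (e_set {g. k' $ Inr g \<noteq> 0}) \<in> I"
    using Suc.prems(3) by (intro Suc.hyps(1) k' slack) (simp_all add: coord)
  moreover have "{g. k' $ Inr g \<noteq> 0} = {g. k $ Inr g \<noteq> 0}" using f by (auto simp: coord)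
  moreover have "- (mon l * \<theta> f) \<in> I" by (rule AA.span_ideal_uminus[OF ts_A \<theta>_I[OF mon_A[OF l]]])
  moreover have "- (mon l * \<theta> f) = mon k - mon k'"
    by (simp add: right_diff_distrib mult_single k'_def) (simp add: l_def)
  ultimately show ?case using AA.span_ideal_add[OF ts_A, of "mon k - mon k'"] by fastforce
qed

text \<open>A monomial without pattern contains some x_v or the square of some y_f or z_f, and
  modulo \<open>\<theta> f\<close> these squares equal x_v^2. At most one \<open>T\<close>
  contributes to the sum.\<close>

lemma reduce_mon:
  assumes k: "k \<in> S"
  shows "mon k - (\<Sum>T\<in>UNIV. if pattern T k then mon (e_set T) else 0) \<in> I"
proof (cases "(\<forall>v. slack v k = 0) \<and> (\<forall>f. \<bar>k $ Inr f\<bar> \<le> 1)")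
  case True
  have "pattern T k \<longleftrightarrow> T = {f. k $ Inr f \<noteq> 0}" for T
  proof -
    have "\<bar>k $ Inr f\<bar> = (if f \<in> T then 1 else 0) \<longleftrightarrow> (f \<in> T \<longleftrightarrow> k $ Inr f \<noteq> 0)" for f
      using True by (smt (verit))
    then show ?thesis unfolding pattern_def using True by auto
  qed
  then have "(\<Sum>T\<in>UNIV. if pattern T k then mon (e_set T) else 0) = (mon (e_set {f. k $ Inr f \<noteq> 0}) :: _ \<Rightarrow>\<^sub>0 'k)"
    by simp
  then show ?thesis using reduce_signs[OF k] True by simp
next
  case False
  then have "\<not> pattern T k" for T unfolding pattern_def
    by (metis order_refl zero_le_one)
  moreover have "mon k \<in> I"
  proof -
    consider v where "slack v k \<ge> 1" | f where "k $ Inr f \<ge> 2" | f where "k $ Inr f \<le> -2"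
    proof (cases "\<exists>v. slack v k \<ge> 1")
      case True
      then show thesis using that(1) by (elim exE)
    next
      case no_vertex: False
      have "slack v k = 0" for v
      proof -
        have "slack v k \<ge> 0" "\<not> slack v k \<ge> 1" using k no_vertex by (simp_all add: S_def)
        then show ?thesis by linarith
      qed
      then obtain f where "\<not> \<bar>k $ Inr f\<bar> \<le> 1" using False by (elim de_Morgan_conj[THEN iffD1, THEN disjE]) auto
      then have "k $ Inr f \<ge> 2 \<or> k $ Inr f \<le> -2" by linarith
      then show thesis using that(2,3) by (elim disjE)
    qed
    then show ?thesis
    proof cases
      case (1 v)
      show ?thesis using x_v_I[OF mon_A[OF S_div_e_v[OF k 1], of 1], of v] by (simp add: mult_single)
    next
      case (2 f)
      define l where "l = k - e_e f - e_e f"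
      have l: "l \<in> S" unfolding l_def by (intro S_div_e_e k) (use 2 in \<open>simp_all add: coords\<close>)
      have "mon l * y_e f * \<theta> f + mon l * x_v (p f) * x_v (p f) \<in> I"
        by (intro AA.span_ideal_add[OF ts_A] x_v_I \<theta>_I AA.A_mult mon_A l gens_A)
      moreover have "mon l * y_e f * \<theta> f + mon l * x_v (p f) * x_v (p f) = mon k"
        by (simp add: right_diff_distrib mult_single) (simp add: l_def algebra_simps)
      ultimately show ?thesis by simp
    next
      case (3 f)
      define l where "l = k - e_d f - e_d f"
      have l: "l \<in> S" unfolding l_def by (intro S_div_e_d k) (use 3 in \<open>simp_all add: coords\<close>)
      have "mon l * x_v (p f) * x_v (p f) - mon l * z_e f * \<theta> f \<in> I"
        by (intro AA.span_ideal_diff[OF ts_A] x_v_I \<theta>_I AA.A_mult mon_A l gens_A)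
      moreover have "mon l * x_v (p f) * x_v (p f) - mon l * z_e f * \<theta> f = mon k"
        by (simp add: right_diff_distrib mult_single) (simp add: l_def algebra_simps)
      ultimately show ?thesis by simp
    qed
  qed
  ultimately show ?thesis by simp
qed

text \<open>The squarefree products of the y_f span the quotient with the \<Lambda> T as
  coordinates; together with \<open>\<Lambda>_I\<close>, the ideal is the common kernel of these
  functionals on \<open>A\<close>.\<close>

lemma reduce:
  assumes a: "a \<in> A"
  shows "a - (\<Sum>T\<in>UNIV. Poly_Mapping.single 0 (\<Lambda> T a) * mon (e_set T)) \<in> I"
proof -
  let ?c = "Poly_Mapping.lookup a" and ?B = "Poly_Mapping.keys a"
  have const: "(\<Sum>k\<in>?B. Poly_Mapping.single 0 (if pattern T k then ?c k else 0)) = Poly_Mapping.single 0 (\<Lambda> T a)" for T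
    unfolding coeff_sum_def by (rule poly_mapping_eqI) (simp add: lookup_sum lookup_single when_def)
  have "(\<Sum>k\<in>?B. Poly_Mapping.single 0 (?c k) * (mon k - (\<Sum>T\<in>UNIV. if pattern T k then mon (e_set T) else 0))) \<in> I"
    by (rule AA.span_ideal_sum[OF ts_A], rule AA.span_ideal_mult[OF ts_A mon_A[OF S_0]], rule reduce_mon, rule keys_S[OF a])
  also have "(\<Sum>k\<in>?B. Poly_Mapping.single 0 (?c k) * (mon k - (\<Sum>T\<in>UNIV. if pattern T k then mon (e_set T) else 0))) =
      (\<Sum>k\<in>?B. Poly_Mapping.single k (?c k)) -
      (\<Sum>k\<in>?B. \<Sum>T\<in>UNIV. Poly_Mapping.single 0 (if pattern T k then ?c k else 0) * mon (e_set T))"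
  proof -
    have "Poly_Mapping.single 0 (?c k) * (mon k - (\<Sum>T\<in>UNIV. if pattern T k then mon (e_set T) else 0)) =
        Poly_Mapping.single k (?c k) - (\<Sum>T\<in>UNIV. Poly_Mapping.single 0 (if pattern T k then ?c k else 0) * mon (e_set T))" for k
      by (auto simp: right_diff_distrib sum_distrib_left mult_single intro!: sum.cong)
    then show ?thesis by (simp only: sum_subtractf)
  qed
  also have "(\<Sum>k\<in>?B. Poly_Mapping.single k (?c k)) = a" by (rule poly_mapping_expand[symmetric])
  also have "(\<Sum>k\<in>?B. \<Sum>T\<in>UNIV. Poly_Mapping.single 0 (if pattern T k then ?c k else 0) * mon (e_set T)) =
      (\<Sum>T\<in>UNIV. (\<Sum>k\<in>?B. Poly_Mapping.single 0 (if pattern T k then ?c k else 0)) * mon (e_set T))"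
    by (subst sum.swap) (simp only: sum_distrib_right)
  finally show ?thesis by (simp only: const)
qed

text \<open>Every y_f is already present: a further y_f makes a square, a z_f releases x_v^2, and an
  x_v shows in the slack. So the product of all y_f is in the socle.\<close>

lemma e_set_UNIV_pattern:
  assumes k: "k \<in> S" "k \<noteq> 0"
  shows "\<not> pattern T (e_set UNIV + k)"
proof
  assume q: "pattern T (e_set UNIV + k)"
  have small: "\<bar>1 + k $ Inr f\<bar> \<le> 1" for f using q by (auto simp: pattern_def e_set_coords split: if_splits)
  have nonneg: "k $ Inr f \<ge> 0" for f
  proof -
    \<comment> \<open>The contribution of \<open>g\<close> to the growth of the slack. All
      contributions are nonnegative and the final slack is 0, so each vanishes, which excludes a
      negative coordinate at \<open>f\<close>.\<close>
    let ?t = "\<lambda>g. if p g = p f then min 0 (1 + k $ Inr g) - min 0 (k $ Inr g) else 0"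
    have "slack (p f) (e_set UNIV + k) = slack (p f) k + 2 * (\<Sum>g\<in>UNIV. ?t g)"
    proof -
      have "(\<Sum>g\<in>UNIV. if p g = p f then min 0 ((e_set UNIV + k) $ Inr g) else 0) =
          (\<Sum>g\<in>UNIV. (if p g = p f then min 0 (k $ Inr g) else 0) + ?t g)"
        by (rule sum.cong) (simp_all add: e_set_coords)
      then show ?thesis by (simp add: slack_def sum.distrib e_set_coords)
    qed
    moreover have "slack (p f) (e_set UNIV + k) = 0" using q by (simp add: pattern_def)
    moreover have "slack (p f) k \<ge> 0" using k(1) by (simp add: S_def)
    moreover have "?t f \<le> (\<Sum>g\<in>UNIV. ?t g)" by (rule member_le_sum) (simp_all add: min_def)
    ultimately have "min 0 (1 + k $ Inr f) - min 0 (k $ Inr f) \<le> 0" by simp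
    then show ?thesis by (simp add: min_def split: if_splits)
  qed
  have zero: "k $ Inr f = 0" for f using small[of f] nonneg[of f] by simp
  have "k $ Inl v = 0" for v
  proof -
    have "slack v (e_set UNIV + k) = k $ Inl v"
      using slack_eq_coord[of "e_set UNIV + k" v] by (simp add: e_set_coords zero)
    then show ?thesis using q by (simp add: pattern_def)
  qed
  then have "k = 0" using zero by (simp add: vec_eq_iff) (metis sum.exhaust_sel zero_index)
  then show False using k(2) by simp
qed

lemma I_eq: "a \<in> A \<Longrightarrow> (\<And>T. \<Lambda> T a = 0) \<Longrightarrow> a \<in> I"
  using reduce[of a] by simp

lemma gorenstein_sop_loops:
  assumes "distinct vs" "distinct es"
  shows "gorenstein_sop A (range (Poly_Mapping.single 0)) comp ts"
  unfolding gorenstein_sop_def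
proof (intro conjI)
  have w: "weight (\<lambda>_. 1) (e_v v) = 1" "weight (\<lambda>_. 1) (e_e f) = 1" "weight (\<lambda>_. 1) (e_d f) = 1" for v f
    unfolding weight_diff weight_add weight_axis by simp_all
  have "x_v v \<in> comp 1" for v using gens_A(1) by (simp add: w)
  moreover have "\<theta> f \<in> comp 1" for f
  proof -
    have "Poly_Mapping.keys (\<theta> f) \<subseteq> {e_e f, e_d f}" using keys_diff[of "y_e f" "z_e f"] by auto
    then show ?thesis using gens_A(4)[of f] w by auto
  qed
  ultimately have "t \<in> comp 1" if "t \<in> set ts" for t using that by (auto simp: ts)
  then show "\<forall>t\<in>set ts. \<exists>n>0. t \<in> comp n" by (intro ballI exI[of _ 1]) simp
next
  show "\<forall>i<length ts. \<forall>a\<in>A. ts ! i * a \<in> span_ideal A (take i ts) \<longrightarrow> a \<in> span_ideal A (take i ts)"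
  proof (intro allI impI ballI)
    fix i a assume i: "i < length ts" and a: "a \<in> A" and rel: "ts ! i * a \<in> span_ideal A (take i ts)"
    show "a \<in> span_ideal A (take i ts)"
    proof (cases "i < length vs")
      case True
      have "vs ! i \<notin> set (take i vs)" using assms(1) True by (auto simp: in_set_conv_nth nth_eq_iff_index_eq)
      then show ?thesis using regular_vertex[of "vs ! i" "take i vs" a] a rel True by (simp add: ts nth_append take_map)
    next
      case False
      define j where "j = i - length vs"
      have j: "j < length es" using i False by (simp add: ts j_def)
      have "es ! j \<notin> set (take j es)" using assms(2) j by (auto simp: in_set_conv_nth nth_eq_iff_index_eq)
      moreover have "take i ts = map x_v vs @ map \<theta> (take j es)" using False by (simp add: ts j_def take_map)
      moreover have "ts ! i = \<theta> (es ! j)" using False j by (simp add: ts nth_append j_def)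
      ultimately show ?thesis using regular_loop[of "take i ts" vs "take j es" "es ! j" a] a rel by simp
    qed
  qed
next
  obtain Ts :: "'e set list" where Ts: "set Ts = UNIV" "distinct Ts"
    using finite_distinct_list[of "UNIV :: 'e set set"] by auto
  show "\<exists>us. set us \<subseteq> A \<and> (\<forall>a\<in>A. \<exists>cs. set cs \<subseteq> range (Poly_Mapping.single 0) \<and>
      a - (\<Sum>(c, u)\<leftarrow>zip cs us. c * u) \<in> I)"
  proof (rule exI[of _ "map (\<lambda>T. mon (e_set T)) Ts"], intro conjI ballI)
    show "set (map (\<lambda>T. mon (e_set T)) Ts) \<subseteq> A" using mon_A[OF e_set_S] by auto
    fix a assume a: "a \<in> A"
    have "(\<Sum>(c, u)\<leftarrow>zip (map (\<lambda>T. Poly_Mapping.single 0 (\<Lambda> T a)) Ts) (map (\<lambda>T. mon (e_set T)) Ts). c * u) =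
        (\<Sum>T\<leftarrow>Ts. Poly_Mapping.single 0 (\<Lambda> T a) * mon (e_set T))"
      by (induction Ts) simp_all
    also have "\<dots> = (\<Sum>T\<in>UNIV. Poly_Mapping.single 0 (\<Lambda> T a) * mon (e_set T))"
      using Ts by (simp add: sum_list_distinct_conv_sum_set)
    finally show "\<exists>cs. set cs \<subseteq> range (Poly_Mapping.single 0) \<and>
        a - (\<Sum>(c, u)\<leftarrow>zip cs (map (\<lambda>T. mon (e_set T)) Ts). c * u) \<in> I"
      using reduce[OF a] by (intro exI[of _ "map (\<lambda>T. Poly_Mapping.single 0 (\<Lambda> T a)) Ts"]) auto
  qed
next
  let ?u = "mon (e_set UNIV) :: int ^ ('v + 'e) \<Rightarrow>\<^sub>0 'k"
  have u: "?u \<in> A" by (rule mon_A[OF e_set_S])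
  have pattern_e_set: "pattern T (e_set T') \<longleftrightarrow> T = T'" for T T'
    unfolding pattern_def using slack_eq_coord[of "e_set T'"] by (auto simp: e_set_coords split: if_splits)
  have pos: "k \<noteq> 0" if "weight (\<lambda>_. 1) k = int n" "n > 0" for k :: "int ^ ('v + 'e)" and n
    using that by (auto simp: weight_def)
  show "\<exists>u\<in>A. u \<notin> I \<and> (\<forall>n>0. \<forall>r\<in>comp n. r * u \<in> I) \<and>
      (\<forall>a\<in>A. (\<forall>n>0. \<forall>r\<in>comp n. r * a \<in> I) \<longrightarrow> (\<exists>c\<in>range (Poly_Mapping.single 0). a - c * u \<in> I))"
  proof (rule bexI[OF _ u], intro conjI allI impI ballI)
    have "\<Lambda> UNIV ?u = 1" by (simp add: coeff_sum_single pattern_e_set)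
    then show "?u \<notin> I" using \<Lambda>_I[of ?u UNIV] by auto
  next
    fix n :: nat and r assume n: "n > 0" and r: "r \<in> comp n"
    have rA: "r \<in> A" using r by simp
    show "r * ?u \<in> I"
    proof (rule I_eq[OF AA.A_mult[OF rA u]])
      fix T
      have "\<Lambda> T (r * ?u) = coeff_sum (\<lambda>k. pattern T (k + e_set UNIV)) r"
        using coeff_sum_single_mult[of "pattern T" "e_set UNIV" 1 r] by (simp add: mult.commute)
      also have "\<dots> = coeff_sum (\<lambda>_. False) r"
      proof (rule coeff_sum_cong)
        fix k assume k: "k \<in> Poly_Mapping.keys r"
        then have "k \<in> S" "k \<noteq> 0" using keys_S[OF rA] pos[OF _ n] r by auto
        then show "pattern T (k + e_set UNIV) = False" using e_set_UNIV_pattern by (simp add: add.commute)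
      qed
      finally show "\<Lambda> T (r * ?u) = 0" by (simp add: coeff_sum_def)
    qed
  next
    fix a assume a: "a \<in> A" and soc: "\<forall>n>0. \<forall>r\<in>comp n. r * a \<in> I"
    \<comment> \<open>For \<open>f\<close> outside \<open>T\<close>, multiplication by y_f moves the
      coordinate at \<open>T\<close> to \<open>insert f T\<close>, where it is 0 for a socle
      element.\<close>
    have "\<Lambda> T a = 0" if "T \<noteq> UNIV" for T
    proof -
      have "\<exists>f. f \<notin> T" using that by auto
      then obtain f where f: "f \<notin> T" ..
      have "y_e f \<in> comp 1" using gens_A(2) by (simp add: weight_axis)
      then have "y_e f * a \<in> I" by (rule soc[rule_format, OF zero_less_one])
      then have "0 = \<Lambda> (insert f T) (y_e f * a)" by (simp only: \<Lambda>_I)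
      also have "\<dots> = coeff_sum (\<lambda>k. pattern (insert f T) (k + e_e f)) a"
        by (simp only: coeff_sum_single_mult mult_1)
      also have "\<dots> = \<Lambda> T a"
      proof (rule coeff_sum_cong)
        fix k assume "k \<in> Poly_Mapping.keys a"
        then have slack: "slack (p f) k \<ge> 0" using keys_S[OF a] by (simp add: S_def)
        show "pattern (insert f T) (k + e_e f) = pattern T k"
        proof (cases "k $ Inr f = 0")
          case True
          have "\<bar>(k + e_e f) $ Inr g\<bar> = (if g \<in> insert f T then 1 else 0) \<longleftrightarrow> \<bar>k $ Inr g\<bar> = (if g \<in> T then 1 else 0)" for g
            using True f by (cases "g = f") (simp_all add: coords)
          then show ?thesis unfolding pattern_def using True by (simp add: slack_e_e)
        next
          case False
          then have "\<not> pattern T k" using f by (auto simp: pattern_def)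
          moreover have "\<not> pattern (insert f T) (k + e_e f)"
          proof
            assume q: "pattern (insert f T) (k + e_e f)"
            then have "\<bar>(k + e_e f) $ Inr f\<bar> = (if f \<in> insert f T then 1 else 0)" unfolding pattern_def by blast
            then have "\<bar>k $ Inr f + 1\<bar> = 1" by (simp add: coords)
            then have "k $ Inr f < 0" using False by simp
            then have "slack (p f) (k + e_e f) \<noteq> 0" using slack by (simp add: slack_e_e)
            then show False using q by (simp add: pattern_def)
          qed
          ultimately show ?thesis by simp
        qed
      qed
      finally show ?thesis ..
    qed
    then have "\<Lambda> T (a - Poly_Mapping.single 0 (\<Lambda> UNIV a) * ?u) = 0" for T
      by (cases "T = UNIV") (simp_all add: coeff_sum_diff mult_single coeff_sum_single pattern_e_set)
    then have "a - Poly_Mapping.single 0 (\<Lambda> UNIV a) * ?u \<in> I"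
      by (intro I_eq supp_in_diff a AA.A_mult mon_A S_0 u)
    then show "\<exists>c\<in>range (Poly_Mapping.single 0). a - c * ?u \<in> I" by blast
  qed
qed

end

end

theorem loops_gorenstein:
  fixes ends :: "'e::finite \<Rightarrow> 'v::finite uprod"
  assumes iso: "no_isolated_vertices ends" and loops: "\<And>f. is_loop ends f"
  shows "gorenstein_polytope TYPE('k::field) (cosmological_polytope ends)"
proof -
  have "\<exists>p. \<forall>f. ends f = Upair (p f) (p f)"
    using loops unfolding is_loop_def by (intro choice) blast
  then obtain p where p: "\<And>f. ends f = Upair (p f) (p f)" by blast
  interpret loop_algebra ends p "TYPE('k)"
  proof
    show "ends f = Upair (p f) (p f)" for f by (rule p)
    fix v
    obtain f where "v \<in> set_uprod (ends f)" using iso unfolding no_isolated_vertices_def by blast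
    then show "\<exists>f. p f = v" by (auto simp: p)
  qed
  obtain vs :: "'v list" where vs: "set vs = UNIV" "distinct vs"
    using finite_distinct_list[of "UNIV :: 'v set"] by auto
  obtain es :: "'e list" where es: "set es = UNIV" "distinct es"
    using finite_distinct_list[of "UNIV :: 'e set"] by auto
  have "\<exists>ts. gorenstein_sop A (range (Poly_Mapping.single 0)) comp ts"
    using gorenstein_sop_loops[OF refl vs(1) es(1) vs(2) es(2)] by (rule exI)
  then show ?thesis
    by (simp only: gorenstein_polytope_iff[of "weight (\<lambda>_. 1)", OF weight_add weight_one] gen_cosmo_points)
qed

theorem theorem3p12:
  fixes ends :: "'e::finite \<Rightarrow> 'v::finite uprod"
  assumes "no_isolated_vertices ends"
  shows "gorenstein_polytope TYPE('k::field) (cosmological_polytope ends) \<longleftrightarrow>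
         (\<forall>f. is_loop ends f)"
proof
  assume g: "gorenstein_polytope TYPE('k) (cosmological_polytope ends)"
  show "\<forall>f. is_loop ends f"
  proof
    fix f
    obtain i j where ij: "ends f = Upair i j" by (cases "ends f") auto
    show "is_loop ends f"
    proof (cases "i = j")
      case True
      then show ?thesis using ij unfolding is_loop_def by blast
    next
      case False
      from nonloop_not_gorenstein[OF assms ij False, where 'k = 'k] g show ?thesis by (rule notE)
    qed
  qed
next
  assume "\<forall>f. is_loop ends f"
  then show "gorenstein_polytope TYPE('k) (cosmological_polytope ends)"
    by (intro loops_gorenstein[OF assms]) simp
qed

end
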